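(* (Probability of ruin in finite time.) Assume $\overline{\Pi}_X^+\in\mathcal S^{(\alpha)}$ and let $T\in(0,\infty)$. Then $$\lim_{u\to\infty}\frac{P(\tau(u)<T)}{\overline{\Pi}_X^+(u)}=\int_{[0,T)}\nu(T-t)\,\mu(dt)=\int_{[0,T)}e^{\psi(\alpha)t}\,Ee^{\alpha\overline X_{T-t}}\,dt.$$
   Context: Let $\alpha>0$ and $X$ a real-valued Lévy process with Lévy measure $\Pi_X$; $\overline{\Pi}_X^+(u)=\Pi_X((u,\infty))$. A distribution $F$ on $[0,\infty)$ is in $\mathcal S^{(\alpha)}$ if $\overline F(u)>0$ for all $u>0$, $\overline F(u+y)/\overline F(u)\to e^{-\alpha y}$ for all real $y$, and $\lim_{u\to\infty}\overline{F*F}(u)/\overline F(u)$ exists and is finite; $\overline{\Pi}_X^+\in\mathcal S^{(\alpha)}$ means the renormalized tail $\overline{\Pi}_X^+(u)/\overline{\Pi}_X^+(x_0)$, $u\ge x_0$, is the tail of a distribution in $\mathcal S^{(\alpha)}$ for some $x_0>0$ with $\overline\Pi_X^+$ positive on $[x_0,\infty)$. $P_z$ is the law of $X$ started at $z$, $P=P_0$; $\tau(u)=\inf\{t>0:X_t>u\}$; $\overline X_t=\sup_{s\le t}X_s$; $\psi(\alpha)=\ln Ee^{\alpha X_1}$. $\mu(dt)=Ee^{\alpha X_t}\,dt$ and $\nu(s)=\int_{\mathbb R}\alpha e^{-\alpha z}P_z(\tau(0)<s)\,dz$. *)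

theory Defs
  imports "HOL-Probability.Probability"
begin

definition levy_process :: "'a measure \<Rightarrow> (real \<Rightarrow> 'a \<Rightarrow> real) \<Rightarrow> bool" where
  "levy_process M X \<longleftrightarrow>
     prob_space M \<and>
     (\<forall>t\<ge>0. X t \<in> borel_measurable M) \<and>
     (\<forall>\<omega>\<in>space M. X 0 \<omega> = 0) \<and>
     (\<forall>\<omega>\<in>space M. \<forall>t\<ge>0. continuous (at_right t) (\<lambda>s. X s \<omega>)) \<and>
     (\<forall>\<omega>\<in>space M. \<forall>t>0. \<exists>l. ((\<lambda>s. X s \<omega>) \<longlongrightarrow> l) (at_left t)) \<and>
     (\<forall>(n::nat) (t::nat \<Rightarrow> real). 0 \<le> t 0 \<and> (\<forall>i<n. t i \<le> t (Suc i)) \<longrightarrow>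
        prob_space.indep_vars M (\<lambda>_. borel) (\<lambda>i \<omega>. X (t (Suc i)) \<omega> - X (t i) \<omega>) {..<n}) \<and>
     (\<forall>s t. 0 \<le> s \<and> s \<le> t \<longrightarrow>
        distr M borel (\<lambda>\<omega>. X t \<omega> - X s \<omega>) = distr M borel (X (t - s)))"

text \<open>LM is the Levy measure of X, i.e. the jump measure in the Levy-Khintchine
  representation of the characteristic function of X 1.\<close>
definition levy_measure :: "'a measure \<Rightarrow> (real \<Rightarrow> 'a \<Rightarrow> real) \<Rightarrow> real measure \<Rightarrow> bool" where
  "levy_measure M X LM \<longleftrightarrow>
     sets LM = sets borel \<and> emeasure LM {0} = 0 \<and>
     (\<integral>\<^sup>+ x. ennreal (min 1 (x\<^sup>2)) \<partial>LM) < \<infinity> \<and>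
     (\<exists>(\<gamma>::real) (\<sigma>2::real). \<sigma>2 \<ge> 0 \<and>
        (\<forall>\<theta>::real. char (distr M borel (X 1)) \<theta> =
           exp (\<i> * complex_of_real (\<gamma> * \<theta>) - complex_of_real (\<sigma>2 * \<theta>\<^sup>2 / 2) +
                (CLINT x|LM. iexp (\<theta> * x) - 1
                    - \<i> * complex_of_real (\<theta> * x * indicator {-1<..<1} x)))))"

definition levy_tail_plus :: "real measure \<Rightarrow> real \<Rightarrow> real" where
  "levy_tail_plus LM u = measure LM {u<..}"

definition S_alpha :: "real \<Rightarrow> real measure \<Rightarrow> bool" where
  "S_alpha \<alpha> F \<longleftrightarrow>
     prob_space F \<and> sets F = sets borel \<and> emeasure F {..<0} = 0 \<and>
     (\<forall>u>0. measure F {u<..} > 0) \<and>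
     (\<forall>y::real. ((\<lambda>u. measure F {u + y<..} / measure F {u<..}) \<longlongrightarrow> exp (- \<alpha> * y)) at_top) \<and>
     (\<exists>c::real. ((\<lambda>u. measure (F \<star> F) {u<..} / measure F {u<..}) \<longlongrightarrow> c) at_top)"

definition tail_in_S_alpha :: "real \<Rightarrow> (real \<Rightarrow> real) \<Rightarrow> bool" where
  "tail_in_S_alpha \<alpha> Fbar \<longleftrightarrow>
     (\<exists>x0>0. (\<forall>u\<ge>x0. Fbar u > 0) \<and>
        (\<exists>G. S_alpha \<alpha> G \<and> (\<forall>u\<ge>x0. measure G {u<..} = Fbar u / Fbar x0)))"

text \<open>First passage time above level u of the process started at z:
  inf {t > 0. z + X t > u} (with inf of the empty set = \<infinity>).\<close>
definition passage_time :: "(real \<Rightarrow> 'a \<Rightarrow> real) \<Rightarrow> real \<Rightarrow> real \<Rightarrow> 'a \<Rightarrow> ereal" where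
  "passage_time X z u \<omega> = Inf {ereal t | t. 0 < t \<and> z + X t \<omega> > u}"

definition running_sup :: "(real \<Rightarrow> 'a \<Rightarrow> real) \<Rightarrow> real \<Rightarrow> 'a \<Rightarrow> real" where
  "running_sup X t \<omega> = Sup ((\<lambda>s. X s \<omega>) ` {0..t})"

definition levy_psi :: "'a measure \<Rightarrow> (real \<Rightarrow> 'a \<Rightarrow> real) \<Rightarrow> real \<Rightarrow> real" where
  "levy_psi M X \<alpha> = ln (\<integral>\<omega>. exp (\<alpha> * X 1 \<omega>) \<partial>M)"

definition levy_nu :: "'a measure \<Rightarrow> (real \<Rightarrow> 'a \<Rightarrow> real) \<Rightarrow> real \<Rightarrow> real \<Rightarrow> real" where
  "levy_nu M X \<alpha> s = (\<integral>z. \<alpha> * exp (- \<alpha> * z) *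
       measure M {\<omega> \<in> space M. passage_time X z 0 \<omega> < ereal s} \<partial>lborel)"

end

theory Submission
  imports Defs
begin

text \<open>
  The value of \<open>X\<close> at a fixed time is the sum of independent variables, a compound Poisson sum of the
  large positive jumps, whose law \<open>F\<close> is the normalised Levy measure on \<open>(x0, \<infinity>)\<close>, and a remainder with
  exponential moments of all positive orders. Convolution equivalence of \<open>F\<close>, including the identity
  \<open>lim (1 - F*F) / (1 - F) = 2 * \<integral> exp (\<alpha> * x) dF\<close>, which is not part of the definition, gives
  \<open>P (X t > u) ~ t * E exp (\<alpha> * X t) * LM (u, \<infinity>)\<close>. The maximum of \<open>X\<close> over a grid of mesh \<open>h\<close> satisfies
  \<open>M_(k+1) = max 0 (\<xi> + M_k)\<close> in law, so its tail is asymptotically a sum over the grid, which is a Riemann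
  sum of the claimed integral. Ottaviani's maximal inequality compares the supremum over an interval with
  the maximum over the grid, at the cost of lowering the level by \<open>\<epsilon>\<close>, uniformly in \<open>u\<close>.
\<close>

section \<open>Tails of convolutions\<close>

text \<open>A single large jump causes the crossing. If it falls at time t, the path before it
  contributes the factor \<open>exp (\<psi> * t)\<close>, the path after it contributes the
  exponential moment of the supremum over the remaining time T - t, and integrating over t gives the
  limit. Convolution asymptotics see sums of independent variables, not suprema of paths; hence the
  discretised time axis and a recursion for the maximum that adds one increment at a time. No
  pathwise splitting of \<open>X\<close> is used: large jumps are separated only at the level of
  laws, through characteristic functions. Two facts make the error terms vanish: the exact constant
  in the convolution limit, without which the event that both summands are large would leave a
  positive contribution, and the shift relation for F, by which lowering the level by \<epsilon>
  multiplies limits by \<open>exp (\<alpha> * \<epsilon>)\<close>. Finally, \<open>levy_nu\<close>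
  refers to passage strictly before s, whereas the supremum includes time s; the two agree except at
  countably many s, which the integral does not see.\<close>

lemma sets_pair_borelI:
  fixes M N :: "real measure"
  assumes "sets M = sets borel" "sets N = sets borel"
    and "Measurable.pred (borel \<Otimes>\<^sub>M borel) (\<lambda>p. P (fst p) (snd p))"
  shows "{(x, y). P x y} \<in> sets (M \<Otimes>\<^sub>M N)"
proof -
  have "{p \<in> space (borel \<Otimes>\<^sub>M borel). P (fst p) (snd p)} \<in> sets (borel \<Otimes>\<^sub>M borel)"
    using assms(3) by measurable
  moreover have "sets (M \<Otimes>\<^sub>M N) = sets (borel \<Otimes>\<^sub>M borel)"
    using assms by (intro sets_pair_measure_cong)
  ultimately show ?thesis
    by (simp add: space_pair_measure case_prod_beta')
qed

lemma measure_pair_fst: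
  assumes "prob_space M" "prob_space N" "S \<in> sets (M \<Otimes>\<^sub>M N)"
  shows "measure (M \<Otimes>\<^sub>M N) S = (\<integral>x. measure N (Pair x -` S) \<partial>M)"
proof -
  interpret M: prob_space M by fact
  interpret N: prob_space N by fact
  interpret pair_prob_space M N ..
  have "emeasure (M \<Otimes>\<^sub>M N) S = (\<integral>\<^sup>+x. ennreal (measure N (Pair x -` S)) \<partial>M)"
    using assms(3) by (subst N.emeasure_pair_measure_alt) (simp_all add: N.emeasure_eq_measure)
  moreover have "(\<lambda>x. measure N (Pair x -` S)) \<in> borel_measurable M"
    using N.measurable_emeasure_Pair[OF assms(3)] unfolding measure_def by measurable
  ultimately show ?thesis
    by (subst integral_eq_nn_integral) (auto simp: measure_def)
qed

lemma measure_pair_snd: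
  assumes "prob_space M" "prob_space N" "S \<in> sets (M \<Otimes>\<^sub>M N)"
  shows "measure (M \<Otimes>\<^sub>M N) S = (\<integral>y. measure M ((\<lambda>x. (x, y)) -` S) \<partial>N)"
proof -
  interpret M: prob_space M by fact
  interpret N: prob_space N by fact
  interpret pair_prob_space M N ..
  have "emeasure (M \<Otimes>\<^sub>M N) S = (\<integral>\<^sup>+y. ennreal (measure M ((\<lambda>x. (x, y)) -` S)) \<partial>N)"
    using assms(3) by (subst emeasure_pair_measure_alt2) (simp_all add: M.emeasure_eq_measure)
  moreover have "(\<lambda>y. measure M ((\<lambda>x. (x, y)) -` S)) \<in> borel_measurable N"
    using measurable_emeasure_Pair2[OF assms(3)] unfolding measure_def by measurable
  ultimately show ?thesis
    by (subst integral_eq_nn_integral) (auto simp: measure_def)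
qed

lemma real_distribution_convolution:
  assumes "real_distribution M" "real_distribution N"
  shows "real_distribution (M \<star> N)"
proof -
  interpret M: real_distribution M by fact
  interpret N: real_distribution N by fact
  interpret pair_prob_space M N ..
  show ?thesis
    unfolding convolution_def
    by (intro real_distribution.intro prob_space_distr) (auto simp: real_distribution_axioms_def)
qed

lemma measure_convolution:
  assumes "real_distribution M" "real_distribution N" "A \<in> sets borel"
  shows "measure (M \<star> N) A = measure (M \<Otimes>\<^sub>M N) {(x, y). x + y \<in> A}"
proof -
  interpret M: real_distribution M by fact
  interpret N: real_distribution N by fact
  show ?thesis
    unfolding convolution_def using assms(3)
    by (subst measure_distr) (auto simp: space_pair_measure intro!: arg_cong2[where f=measure])
qed

abbreviation tail :: "real measure \<Rightarrow> real \<Rightarrow> real" where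
  "tail H u \<equiv> measure H {u<..}"

lemma (in real_distribution) prob_UNIV [simp]: "prob UNIV = 1"
  using prob_space by simp

lemma (in real_distribution) tail_mono: "x \<le> y \<Longrightarrow> tail M y \<le> tail M x"
  by (intro finite_measure_mono) auto

lemma (in real_distribution) tail_measurable [measurable]: "tail M \<in> borel_measurable borel"
proof -
  have "mono (\<lambda>x. - tail M x)" by (auto intro!: monoI tail_mono)
  from borel_measurable_mono[OF this] show ?thesis by simp
qed

lemma (in real_distribution) tail_measurable' [measurable (raw)]:
  "f \<in> borel_measurable N \<Longrightarrow> (\<lambda>x. tail M (f x)) \<in> borel_measurable N"
  by (rule measurable_compose[OF _ tail_measurable])

lemma tail_convolution:
  assumes "real_distribution M" "real_distribution N"
  shows "tail (M \<star> N) u = (\<integral>y. tail M (u - y) \<partial>N)"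
proof -
  interpret M: real_distribution M by fact
  interpret N: real_distribution N by fact
  have *: "{(x, y). u < x + y} \<in> sets (M \<Otimes>\<^sub>M N)" by (rule sets_pair_borelI) auto
  have "tail (M \<star> N) u = (\<integral>y. measure M ((\<lambda>x. (x, y)) -` {(x, y). u < x + y}) \<partial>N)"
    using measure_pair_snd[OF _ _ *] by (simp add: measure_convolution[OF assms] M.prob_space_axioms N.prob_space_axioms)
  then show ?thesis
    by (simp add: vimage_def greaterThan_def algebra_simps)
qed

text \<open>This is the part of \<open>tail (M \<star> N) u\<close> that no dominated convergence
  argument reaches; it is estimated only by comparison with the same quantity for
  \<open>F\<close>.\<close>

definition both_large :: "real \<Rightarrow> real measure \<Rightarrow> real measure \<Rightarrow> real \<Rightarrow> real" where
  "both_large A M N u = measure (M \<Otimes>\<^sub>M N) {(x, y). A < x \<and> A < y \<and> u < x + y}"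

lemma both_large_fst:
  assumes "real_distribution M" "real_distribution N"
  shows "both_large A M N u = (\<integral>x. indicator {A<..} x * tail N (max A (u - x)) \<partial>M)"
proof -
  interpret M: real_distribution M by fact
  interpret N: real_distribution N by fact
  have *: "{(x, y). A < x \<and> A < y \<and> u < x + y} \<in> sets (M \<Otimes>\<^sub>M N)" by (rule sets_pair_borelI) auto
  show ?thesis
    unfolding both_large_def
    by (subst measure_pair_fst[OF _ _ *])
       (auto intro!: M.prob_space_axioms N.prob_space_axioms Bochner_Integration.integral_cong arg_cong2[where f=measure]
         simp: indicator_def)
qed

lemma both_large_snd:
  assumes "real_distribution M" "real_distribution N"
  shows "both_large A M N u = (\<integral>y. indicator {A<..} y * tail M (max A (u - y)) \<partial>N)"
proof -
  interpret M: real_distribution M by fact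
  interpret N: real_distribution N by fact
  have *: "{(x, y). A < x \<and> A < y \<and> u < x + y} \<in> sets (M \<Otimes>\<^sub>M N)" by (rule sets_pair_borelI) auto
  show ?thesis
    unfolding both_large_def
    by (subst measure_pair_snd[OF _ _ *])
       (auto intro!: M.prob_space_axioms N.prob_space_axioms Bochner_Integration.integral_cong arg_cong2[where f=measure]
         simp: indicator_def)
qed

text \<open>The two laws are replaced by \<open>F\<close> one at a time: integrating in either order
  shows \<open>both_large\<close> as an integral of one tail against the other law. The
  \<open>max A\<close> in these integrals keeps every argument at least A, so domination is needed
  from A on only.\<close>

lemma both_large_mono:
  assumes "real_distribution M1" "real_distribution M2" "real_distribution F" "K \<ge> 0"
    and 1: "\<And>x. A \<le> x \<Longrightarrow> tail M1 x \<le> K * tail F x"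
    and 2: "\<And>x. A \<le> x \<Longrightarrow> tail M2 x \<le> K * tail F x"
  shows "both_large A M1 M2 u \<le> K\<^sup>2 * both_large A F F u"
proof -
  interpret M1: real_distribution M1 by fact
  interpret M2: real_distribution M2 by fact
  interpret F: real_distribution F by fact
  have "both_large A M1 M2 u \<le> (\<integral>x. K * (indicator {A<..} x * tail F (max A (u - x))) \<partial>M1)"
    unfolding both_large_fst[OF assms(1,2)]
  proof (rule integral_mono)
    show "integrable M1 (\<lambda>x. indicator {A<..} x * tail M2 (max A (u - x)))"
      by (rule M1.integrable_const_bound[where B=1]) (auto simp: indicator_def)
    show "integrable M1 (\<lambda>x. K * (indicator {A<..} x * tail F (max A (u - x))))"
      by (intro integrable_mult_right M1.integrable_const_bound[where B=1]) (auto simp: indicator_def)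
    show "indicator {A<..} x * tail M2 (max A (u - x)) \<le> K * (indicator {A<..} x * tail F (max A (u - x)))" for x
      using 2[of "max A (u - x)"] by (auto simp: indicator_def)
  qed
  also have "\<dots> = K * both_large A M1 F u"
    by (simp add: both_large_fst[OF assms(1,3)])
  also have "both_large A M1 F u \<le> (\<integral>x. K * (indicator {A<..} x * tail F (max A (u - x))) \<partial>F)"
    unfolding both_large_snd[OF assms(1,3)]
  proof (rule integral_mono)
    show "integrable F (\<lambda>x. indicator {A<..} x * tail M1 (max A (u - x)))"
      by (rule F.integrable_const_bound[where B=1]) (auto simp: indicator_def)
    show "integrable F (\<lambda>x. K * (indicator {A<..} x * tail F (max A (u - x))))"
      by (intro integrable_mult_right F.integrable_const_bound[where B=1]) (auto simp: indicator_def)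
    show "indicator {A<..} x * tail M1 (max A (u - x)) \<le> K * (indicator {A<..} x * tail F (max A (u - x)))" for x
      using 1[of "max A (u - x)"] by (auto simp: indicator_def)
  qed
  also have "\<dots> = K * both_large A F F u"
    by (simp add: both_large_fst[OF assms(3,3)])
  finally show ?thesis
    using \<open>K \<ge> 0\<close> by (simp add: power2_eq_square mult_left_mono mult.assoc)
qed

text \<open>The hypothesis \<open>2 * A \<le> u\<close> makes the first two events disjoint: two
  summands that are both at most A cannot add up to more than u. Hence an equality, with no overlap
  to subtract.\<close>

lemma tail_convolution_split:
  assumes "real_distribution M" "real_distribution N" "2 * A \<le> u"
  shows "tail (M \<star> N) u = (\<integral>y. indicator {..A} y * tail M (u - y) \<partial>N) +
    (\<integral>x. indicator {..A} x * tail N (u - x) \<partial>M) + both_large A M N u"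
proof -
  interpret M: real_distribution M by fact
  interpret N: real_distribution N by fact
  interpret P: pair_prob_space M N ..
  note ps = M.prob_space_axioms N.prob_space_axioms
  define S1 where "S1 = {(x, y). y \<le> A \<and> u < x + y}"
  define S2 where "S2 = {(x, y). x \<le> A \<and> u < x + y}"
  define S3 where "S3 = {(x, y). A < x \<and> A < y \<and> u < x + y}"
  have S: "S1 \<in> sets (M \<Otimes>\<^sub>M N)" "S2 \<in> sets (M \<Otimes>\<^sub>M N)" "S3 \<in> sets (M \<Otimes>\<^sub>M N)"
    unfolding S1_def S2_def S3_def by (auto intro!: sets_pair_borelI)
  have eq: "{(x, y). x + y \<in> {u<..}} = (S1 \<union> S2) \<union> S3"
    by (auto simp: S1_def S2_def S3_def)
  have disj: "(S1 \<union> S2) \<inter> S3 = {}" "S1 \<inter> S2 = {}"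
    using assms(3) by (auto simp: S1_def S2_def S3_def)
  have sets_u: "{u<..} \<in> sets borel" by simp
  have "tail (M \<star> N) u = measure (M \<Otimes>\<^sub>M N) (S1 \<union> S2) + measure (M \<Otimes>\<^sub>M N) S3"
    unfolding measure_convolution[OF assms(1,2) sets_u] eq
    by (rule P.finite_measure_Union) (use S disj in blast)+
  also have "measure (M \<Otimes>\<^sub>M N) (S1 \<union> S2) = measure (M \<Otimes>\<^sub>M N) S1 + measure (M \<Otimes>\<^sub>M N) S2"
    by (rule P.finite_measure_Union) (use S disj in blast)+
  also have "measure (M \<Otimes>\<^sub>M N) S1 = (\<integral>y. indicator {..A} y * tail M (u - y) \<partial>N)"
    by (subst measure_pair_snd[OF ps S(1)])
      (auto simp: S1_def indicator_def intro!: Bochner_Integration.integral_cong arg_cong2[where f=measure])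
  also have "measure (M \<Otimes>\<^sub>M N) S2 = (\<integral>x. indicator {..A} x * tail N (u - x) \<partial>M)"
    by (subst measure_pair_fst[OF ps S(2)])
      (auto simp: S2_def indicator_def intro!: Bochner_Integration.integral_cong arg_cong2[where f=measure])
  also have "measure (M \<Otimes>\<^sub>M N) S3 = both_large A M N u"
    by (simp add: both_large_def S3_def)
  finally show ?thesis .
qed

section \<open>Comparison with a tail of exponential type\<close>

locale exp_tail = real_distribution F for F :: "real measure" +
  fixes \<alpha> :: real
  assumes alpha_pos: "\<alpha> > 0"
    and tail_pos: "\<And>u. tail F u > 0"
    and long_tail: "\<And>y. ((\<lambda>u. tail F (u + y) / tail F u) \<longlongrightarrow> exp (- \<alpha> * y)) at_top"
begin

lemma tail_shift:
  assumes "((\<lambda>u. tail H u / tail F u) \<longlongrightarrow> k) at_top"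
  shows "((\<lambda>u. tail H (u - y) / tail F u) \<longlongrightarrow> k * exp (\<alpha> * y)) at_top"
proof -
  have "filterlim (\<lambda>u. u - y) at_top at_top"
    using filterlim_tendsto_add_at_top[OF tendsto_const[of "-y"] filterlim_ident[of at_top]] by simp
  from filterlim_compose[OF assms this]
  have 1: "((\<lambda>u. tail H (u - y) / tail F (u - y)) \<longlongrightarrow> k) at_top" .
  from tendsto_mult[OF 1 long_tail[of "-y"]] show ?thesis
    using tail_pos by (simp add: less_imp_neq[symmetric])
qed

text \<open>Truncation at A supplies the dominating constant: for \<open>y \<le> A\<close>
  monotonicity bounds the ratio by its value at y = A, which converges and is therefore eventually
  below its limit plus one. For unbounded y no such bound is at hand.\<close>

lemma truncated_tail_convolution:
  assumes "real_distribution H" "real_distribution N"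
    and k: "((\<lambda>u. tail H u / tail F u) \<longlongrightarrow> k) at_top"
  shows "((\<lambda>u. (\<integral>y. indicator {..A} y * tail H (u - y) \<partial>N) / tail F u) \<longlongrightarrow>
    k * (\<integral>y. indicator {..A} y * exp (\<alpha> * y) \<partial>N)) at_top"
proof -
  interpret H: real_distribution H by fact
  interpret N: real_distribution N by fact
  have "((\<lambda>u. \<integral>y. indicator {..A} y * (tail H (u - y) / tail F u) \<partial>N) \<longlongrightarrow>
    (\<integral>y. indicator {..A} y * (k * exp (\<alpha> * y)) \<partial>N)) at_top"
  proof (rule integral_dominated_convergence_at_top)
    show "integrable N (\<lambda>_. k * exp (\<alpha> * A) + 1)" by simp
    show "AE y in N. ((\<lambda>u. indicator {..A} y * (tail H (u - y) / tail F u)) \<longlongrightarrow> indicator {..A} y * (k * exp (\<alpha> * y))) at_top"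
      by (intro AE_I2 tendsto_mult tendsto_const tail_shift k)
    have "\<forall>\<^sub>F u in at_top. tail H (u - A) / tail F u < k * exp (\<alpha> * A) + 1"
      by (rule order_tendstoD[OF tail_shift[OF k]]) simp
    then show "\<forall>\<^sub>F u in at_top. AE y in N. norm (indicator {..A} y * (tail H (u - y) / tail F u)) \<le> k * exp (\<alpha> * A) + 1"
    proof eventually_elim
      case (elim u)
      have nn: "0 \<le> k * exp (\<alpha> * A) + 1"
        using elim by (smt (verit) divide_nonneg_nonneg measure_nonneg)
      have "y \<le> A \<Longrightarrow> tail H (u - y) / tail F u \<le> k * exp (\<alpha> * A) + 1" for y
        using elim H.tail_mono[of "u - A" "u - y"] tail_pos[of u]
        by (smt (verit) divide_right_mono)
      then show ?case using nn tail_pos by (auto simp: indicator_def)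
    qed
  qed measurable
  then show ?thesis
    by (simp add: mult.left_commute mult.commute[of _ k])
qed

text \<open>Over a unit step the tail shrinks by a factor that tends to
  \<open>exp (- \<alpha>)\<close>, hence eventually exceeds \<open>exp (- \<beta>)\<close>; the
  bound follows by iterating such steps.\<close>

lemma exp_tail_lower:
  assumes "\<beta> > \<alpha>"
  obtains \<kappa> u0 where "\<kappa> > 0" "\<And>u. u \<ge> u0 \<Longrightarrow> tail F u \<ge> \<kappa> * exp (- \<beta> * u)"
proof -
  have "\<forall>\<^sub>F u in at_top. tail F (u + 1) / tail F u > exp (- \<beta>)"
    using long_tail[of 1] assms by (intro order_tendstoD[OF long_tail[of 1]]) simp
  then obtain u0 where u0: "\<And>u. u \<ge> u0 \<Longrightarrow> tail F (u + 1) / tail F u > exp (- \<beta>)"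
    by (auto simp: eventually_at_top_linorder)
  have step: "tail F (u + 1) \<ge> exp (- \<beta>) * tail F u" if "u \<ge> u0" for u
    using u0[OF that] tail_pos[of u] by (simp add: field_simps)
  have n: "tail F (u0 + real n) \<ge> exp (- \<beta>) ^ n * tail F u0" for n
  proof (induction n)
    case (Suc n)
    have "exp (- \<beta>) ^ Suc n * tail F u0 \<le> exp (- \<beta>) * tail F (u0 + real n)"
      using Suc by simp
    also have "\<dots> \<le> tail F (u0 + real n + 1)" by (rule step) simp
    finally show ?case by (simp add: add_ac)
  qed simp
  show ?thesis
  proof
    \<comment> \<open>The factor \<open>exp (\<beta> * u0)\<close> moves the origin to u0, and
      \<open>exp (- \<beta>)\<close> pays for rounding u - u0 up to an integer.\<close>
    show "tail F u0 * exp (\<beta> * u0) * exp (-\<beta>) > 0" using tail_pos by simp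
    fix u assume u: "u \<ge> u0"
    define n where "n = nat \<lceil>u - u0\<rceil>"
    have n1: "u \<le> u0 + real n" "real n \<le> u - u0 + 1" unfolding n_def using u by linarith+
    have "\<beta> > 0" using assms alpha_pos by simp
    have "tail F u0 * exp (\<beta> * u0) * exp (-\<beta>) * exp (- \<beta> * u) = tail F u0 * exp (- \<beta> * (u - u0 + 1))"
      by (simp add: mult_exp_exp algebra_simps)
    also have "\<dots> \<le> tail F u0 * exp (- \<beta> * real n)"
      using n1 \<open>\<beta> > 0\<close> by (intro mult_left_mono) auto
    also have "\<dots> \<le> tail F (u0 + real n)" using n[of n] by (simp add: exp_of_nat_mult[symmetric] mult.commute)
    also have "\<dots> \<le> tail F u" using n1 by (intro tail_mono) simp
    finally show "tail F u0 * exp (\<beta> * u0) * exp (-\<beta>) * exp (- \<beta> * u) \<le> tail F u" .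
  qed
qed

text \<open>Markov's inequality bounds \<open>tail H u\<close> by a multiple of
  \<open>exp (- \<beta> * u)\<close>, while \<open>tail F u\<close> is eventually at least a
  multiple of \<open>exp (- \<beta>' * u)\<close>. The midpoint \<open>\<beta>'\<close> of \<alpha>
  and \<beta> leaves room on both sides.\<close>

lemma tail_negligible:
  assumes "real_distribution H" "\<beta> > \<alpha>" "integrable H (\<lambda>x. exp (\<beta> * x))"
  shows "((\<lambda>u. tail H u / tail F u) \<longlongrightarrow> 0) at_top"
proof -
  interpret H: real_distribution H by fact
  define \<beta>' where "\<beta>' = (\<alpha> + \<beta>) / 2"
  have b: "\<alpha> < \<beta>'" "\<beta>' < \<beta>" "0 < \<beta>" using assms(2) alpha_pos by (auto simp: \<beta>'_def)
  obtain \<kappa> u0 where \<kappa>: "\<kappa> > 0" "\<And>u. u \<ge> u0 \<Longrightarrow> tail F u \<ge> \<kappa> * exp (- \<beta>' * u)"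
    using exp_tail_lower[OF b(1)] by blast
  define C where "C = (\<integral>x. exp (\<beta> * x) \<partial>H)"
  have C: "C \<ge> 0" unfolding C_def by simp
  have ub: "tail H u \<le> C * exp (- \<beta> * u)" for u
  proof -
    have "exp (\<beta> * u) * tail H u = (\<integral>x. exp (\<beta> * u) * indicator {u<..} x \<partial>H)" by simp
    also have "\<dots> \<le> C" unfolding C_def
      using b by (intro integral_mono integrable_mult_right assms(3) H.integrable_const_bound[where B=1])
        (auto simp: indicator_def)
    finally show ?thesis by (simp add: exp_minus field_simps)
  qed
  show ?thesis
  proof (rule tendsto_sandwich[of "\<lambda>_. 0" _ _ "\<lambda>u. C / \<kappa> * exp (- (\<beta> - \<beta>') * u)"])
    show "\<forall>\<^sub>F u in at_top. tail H u / tail F u \<le> C / \<kappa> * exp (- (\<beta> - \<beta>') * u)"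
      using eventually_ge_at_top[of u0]
    proof eventually_elim
      case (elim u)
      have "tail H u / tail F u \<le> C * exp (- \<beta> * u) / (\<kappa> * exp (- \<beta>' * u))"
        using ub[of u] \<kappa>(2)[OF elim] \<kappa>(1) C by (intro frac_le) auto
      also have "\<dots> = C / \<kappa> * (exp (- \<beta> * u) / exp (- \<beta>' * u))" by simp
      also have "exp (- \<beta> * u) / exp (- \<beta>' * u) = exp (- (\<beta> - \<beta>') * u)"
        by (simp add: exp_diff[symmetric] algebra_simps)
      finally show ?case .
    qed
    have "((\<lambda>u. exp (- (\<beta> - \<beta>') * u)) \<longlongrightarrow> 0) at_top"
      using b by real_asymp
    from tendsto_mult_right_zero[OF this] show "((\<lambda>u. C / \<kappa> * exp (- (\<beta> - \<beta>') * u)) \<longlongrightarrow> 0) at_top" .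
  qed (auto intro!: always_eventually divide_nonneg_nonneg)
qed

end

text \<open>An interchange of limits by squeezing: the limit in u is taken with the cutoff A fixed,
  and A goes to infinity only afterwards, so no uniformity in A is required.\<close>

lemma tendsto_approx:
  fixes f :: "'a \<Rightarrow> real"
  assumes g: "\<And>A. (g A \<longlongrightarrow> L A) F" and r: "\<And>A. (r A \<longlongrightarrow> R A) F"
    and le: "\<And>A. \<forall>\<^sub>F u in F. g A u \<le> f u \<and> f u \<le> g A u + r A u"
    and L: "(L \<longlongrightarrow> l) at_top" and R: "(R \<longlongrightarrow> (0::real)) (at_top :: real filter)"
  shows "(f \<longlongrightarrow> l) F"
proof (rule order_tendstoI)
  fix a assume "a < l"
  with order_tendstoD(1)[OF L this] obtain A where A: "a < L A"
    by (auto simp: eventually_at_top_linorder)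
  from order_tendstoD(1)[OF g[of A] A] le[of A] show "\<forall>\<^sub>F u in F. a < f u"
    by eventually_elim linarith
next
  fix a assume "l < a"
  have "((\<lambda>A. L A + R A) \<longlongrightarrow> l) at_top" using tendsto_add[OF L R] by simp
  from order_tendstoD(2)[OF this \<open>l < a\<close>] obtain A where A: "L A + R A < a"
    by (auto simp: eventually_at_top_linorder)
  from order_tendstoD(2)[OF tendsto_add[OF g[of A] r[of A]] A] le[of A] show "\<forall>\<^sub>F u in F. f u < a"
    by eventually_elim linarith
qed

text \<open>Layer cake formula by Fubini; g plays the derivative of the function whose expectation
  is taken.\<close>

lemma nn_integral_tail:
  assumes "real_distribution D" and [measurable]: "g \<in> borel_measurable borel"
  shows "(\<integral>\<^sup>+x. (\<integral>\<^sup>+u. g u * indicator {..<x} u \<partial>lborel) \<partial>D) = (\<integral>\<^sup>+u. g u * tail D u \<partial>lborel)"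
proof -
  interpret D: real_distribution D by fact
  interpret pair_sigma_finite lborel D ..
  have "(\<integral>\<^sup>+x. (\<integral>\<^sup>+u. g u * indicator {..<x} u \<partial>lborel) \<partial>D) = (\<integral>\<^sup>+u. (\<integral>\<^sup>+x. g u * indicator {..<x} u \<partial>D) \<partial>lborel)"
    by (rule Fubini') (simp add: case_prod_beta' indicator_def of_bool_def)
  also have "\<dots> = (\<integral>\<^sup>+u. g u * tail D u \<partial>lborel)"
  proof (rule nn_integral_cong)
    fix u
    have "(\<integral>\<^sup>+x. g u * indicator {..<x} u \<partial>D) = (\<integral>\<^sup>+x. g u * indicator {u<..} x \<partial>D)"
      by (auto intro!: nn_integral_cong simp: indicator_def)
    also have "\<dots> = g u * emeasure D {u<..}" by (subst nn_integral_cmult_indicator) auto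
    finally show "(\<integral>\<^sup>+x. g u * indicator {..<x} u \<partial>D) = g u * tail D u"
      by (simp add: D.emeasure_eq_measure)
  qed
  finally show ?thesis .
qed

text \<open>Layer cake over the whole line, without boundary term since
  \<open>exp (\<alpha> * u)\<close> vanishes at minus infinity. It turns inequalities between tails
  into inequalities between exponential moments.\<close>

lemma nn_integral_exp_tail:
  assumes "real_distribution D" "\<alpha> > 0"
  shows "(\<integral>\<^sup>+x. exp (\<alpha> * x) \<partial>D) = (\<integral>\<^sup>+u. ennreal (\<alpha> * exp (\<alpha> * u)) * tail D u \<partial>lborel)"
proof -
  have "(\<integral>\<^sup>+u. ennreal (\<alpha> * exp (\<alpha> * u)) * indicator {..<x} u \<partial>lborel) = exp (\<alpha> * x)" for x
  proof -
    have "(\<integral>\<^sup>+u. ennreal (\<alpha> * exp (\<alpha> * u)) * indicator {..<x} u \<partial>lborel) =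
      (\<integral>\<^sup>+u. ennreal (\<alpha> * exp (\<alpha> * u)) * indicator {..x} u \<partial>lborel)"
      by (rule nn_integral_cong_AE) (use AE_lborel_singleton[of x] in \<open>auto simp: indicator_def\<close>)
    \<comment> \<open>Reflection, because the improper fundamental theorem is applied on a half-line
      unbounded to the right.\<close>
    also have "\<dots> = (\<integral>\<^sup>+u. ennreal (\<alpha> * exp (\<alpha> * (0 + (-1) * u))) * indicator {..x} (0 + (-1) * u) \<partial>lborel)"
      by (subst nn_integral_real_affine[where c="-1" and t=0]) auto
    also have "\<dots> = (\<integral>\<^sup>+u. ennreal (\<alpha> * exp (- \<alpha> * u)) * indicator {-x..} u \<partial>lborel)"
      by (auto intro!: nn_integral_cong simp: indicator_def)
    also have "\<dots> = ennreal (0 - (- exp (- \<alpha> * (-x))))"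
    proof (rule nn_integral_FTC_atLeast)
      show "((\<lambda>u. - exp (- \<alpha> * u)) \<longlongrightarrow> 0) at_top"
        using \<open>\<alpha> > 0\<close> by real_asymp
    qed (use \<open>\<alpha> > 0\<close> in \<open>auto intro!: derivative_eq_intros\<close>)
    finally show ?thesis by simp
  qed
  then show ?thesis
    using nn_integral_tail[OF assms(1), of "\<lambda>u. ennreal (\<alpha> * exp (\<alpha> * u))"] by simp
qed

lemma integrable_pair_mult:
  fixes f :: "_ \<Rightarrow> 'b::{real_normed_field, banach, second_countable_topology}"
  assumes "prob_space M" "prob_space N" "integrable M f" "integrable N g"
  shows "integrable (M \<Otimes>\<^sub>M N) (\<lambda>(x, y). f x * g y)" (is ?I)
    and "(\<integral>(x, y). f x * g y \<partial>(M \<Otimes>\<^sub>M N)) = (\<integral>x. f x \<partial>M) * (\<integral>y. g y \<partial>N)" (is ?E)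
proof -
  interpret M: prob_space M by fact
  interpret N: prob_space N by fact
  interpret pair_prob_space M N ..
  note [measurable] = borel_measurable_integrable[OF assms(3)] borel_measurable_integrable[OF assms(4)]
  show ?I
    by (rule Fubini_integrable) (use assms in \<open>auto simp: norm_mult\<close>)
  from integral_fst'[OF this] show ?E
    using assms by simp
qed

text \<open>Stated for any multiplicative f, so that characteristic functions and exponential
  moments are both instances.\<close>

lemma integral_convolution_mult:
  fixes f :: "real \<Rightarrow> 'b::{real_normed_field, banach, second_countable_topology}"
  assumes "real_distribution M" "real_distribution N" and hom: "\<And>x y. f (x + y) = f x * f y"
    and [measurable]: "f \<in> borel_measurable borel"
    and "integrable M f" "integrable N f"
  shows "integrable (M \<star> N) f" and "(\<integral>x. f x \<partial>(M \<star> N)) = (\<integral>x. f x \<partial>M) * (\<integral>y. f y \<partial>N)"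
proof -
  interpret M: real_distribution M by fact
  interpret N: real_distribution N by fact
  note ps = M.prob_space_axioms N.prob_space_axioms
  have [measurable]: "(\<lambda>(x::real, y). x + y) \<in> borel_measurable (M \<Otimes>\<^sub>M N)"
    by simp
  show "integrable (M \<star> N) f"
    unfolding convolution_def using integrable_pair_mult(1)[OF ps assms(5,6)]
    by (subst integrable_distr_eq) (auto simp: case_prod_beta' hom)
  show "(\<integral>x. f x \<partial>(M \<star> N)) = (\<integral>x. f x \<partial>M) * (\<integral>y. f y \<partial>N)"
    unfolding convolution_def using integrable_pair_mult(2)[OF ps assms(5,6)]
    by (subst integral_distr) (auto simp: case_prod_beta' hom)
qed

lemma char_convolution:
  assumes "real_distribution M" "real_distribution N"
  shows "char (M \<star> N) \<theta> = char M \<theta> * char N \<theta>"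
proof -
  interpret M: real_distribution M by fact
  interpret N: real_distribution N by fact
  show ?thesis
    unfolding char_def
    by (intro integral_convolution_mult assms)
       (auto simp: distrib_left exp_add intro!: M.integrable_iexp N.integrable_iexp)
qed

lemma exp_moment_convolution:
  fixes a :: real
  assumes "real_distribution M" "real_distribution N"
    "integrable M (\<lambda>x. exp (a * x))" "integrable N (\<lambda>x. exp (a * x))"
  shows "integrable (M \<star> N) (\<lambda>x. exp (a * x))"
    and "(\<integral>x. exp (a * x) \<partial>(M \<star> N)) = (\<integral>x. exp (a * x) \<partial>M) * (\<integral>x. exp (a * x) \<partial>N)"
  using assms by (auto intro!: integral_convolution_mult simp: distrib_left exp_add)

lemma tendsto_truncated_integral:
  fixes f :: "real \<Rightarrow> real"
  assumes "real_distribution N" "integrable N f"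
  shows "((\<lambda>A. \<integral>y. indicator {..A} y * f y \<partial>N) \<longlongrightarrow> (\<integral>y. f y \<partial>N)) at_top"
proof -
  interpret N: real_distribution N by fact
  note [measurable] = borel_measurable_integrable[OF assms(2)]
  show ?thesis
  proof (rule integral_dominated_convergence_at_top[where w="\<lambda>y. norm (f y)"])
    show "AE y in N. ((\<lambda>A. indicator {..A} y * f y) \<longlongrightarrow> f y) at_top"
    proof (rule AE_I2, rule tendsto_eventually)
      fix y show "\<forall>\<^sub>F A in at_top. indicator {..A} y * f y = f y"
        using eventually_ge_at_top[of y] by eventually_elim auto
    qed
  qed (use assms(2) in \<open>auto intro!: always_eventually simp: indicator_def\<close>)
qed

text \<open>Layer cake for a difference of capped exponentials, which vanishes at x = 0;
  \<open>a \<le> b\<close> makes its derivative nonnegative on the positive axis, and the cap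
  confines the integral to [0, A].\<close>

lemma nn_integral_exp_difference:
  assumes "real_distribution D" "0 \<le> A" "0 < a" "a \<le> b" and nonneg: "AE x in D. 0 \<le> x"
  shows "(\<integral>\<^sup>+x. ennreal (exp (b * min x A) - exp (a * min x A)) \<partial>D) =
    (\<integral>\<^sup>+u. ennreal (b * exp (b * u) - a * exp (a * u)) * indicator {0..A} u * tail D u \<partial>lborel)"
proof -
  let ?g = "\<lambda>u. ennreal (b * exp (b * u) - a * exp (a * u)) * indicator {0..A} u"
  have "(\<integral>\<^sup>+u. ?g u * indicator {..<x} u \<partial>lborel) = ennreal (exp (b * min x A) - exp (a * min x A))"
    if "0 \<le> x" for x
  proof -
    have "(\<integral>\<^sup>+u. ?g u * indicator {..<x} u \<partial>lborel) =
      (\<integral>\<^sup>+u. ennreal (b * exp (b * u) - a * exp (a * u)) * indicator {0..min x A} u \<partial>lborel)"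
      by (rule nn_integral_cong_AE) (use AE_lborel_singleton[of x] in \<open>auto simp: indicator_def\<close>)
    also have "\<dots> = ennreal ((exp (b * min x A) - exp (a * min x A)) - (exp (b * 0) - exp (a * 0)))"
      using assms that
      by (intro nn_integral_FTC_Icc) (auto intro!: derivative_eq_intros mult_mono)
    finally show ?thesis by simp
  qed
  then have "(\<integral>\<^sup>+x. ennreal (exp (b * min x A) - exp (a * min x A)) \<partial>D) =
    (\<integral>\<^sup>+x. (\<integral>\<^sup>+u. ?g u * indicator {..<x} u \<partial>lborel) \<partial>D)"
    using nonneg by (intro nn_integral_cong_AE) auto
  also have "\<dots> = (\<integral>\<^sup>+u. ?g u * tail D u \<partial>lborel)"
    by (rule nn_integral_tail[OF assms(1)]) measurable
  finally show ?thesis .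
qed


section \<open>Convolution equivalence and the value of its constant\<close>

locale conv_equiv = exp_tail F \<alpha> for F :: "real measure" and \<alpha> :: real +
  fixes c :: real
  assumes nonneg: "AE x in F. 0 \<le> x"
    and tail_conv: "((\<lambda>u. tail (F \<star> F) u / tail F u) \<longlongrightarrow> c) at_top"
begin

lemma tail_self: "((\<lambda>u. tail F u / tail F u) \<longlongrightarrow> 1) at_top"
  using tail_pos by (simp add: less_imp_neq[symmetric])

text \<open>By the splitting of the tail, this is what remains of \<open>F \<star> F\<close> once
  the two pieces with one summand at most A are removed. That it vanishes as A grows is the content
  of \<open>tail_convolution_constant\<close>.\<close>

lemma truncated_moment_self:
  "((\<lambda>u. both_large A F F u / tail F u) \<longlongrightarrow> c - 2 * (\<integral>y. indicator {..A} y * exp (\<alpha> * y) \<partial>F)) at_top"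
proof -
  have rd: "real_distribution F" ..
  note l = truncated_tail_convolution[OF rd rd tail_self, of A]
  have "((\<lambda>u. tail (F \<star> F) u / tail F u - 2 * ((\<integral>y. indicator {..A} y * tail F (u - y) \<partial>F) / tail F u)) \<longlongrightarrow>
      c - 2 * (1 * (\<integral>y. indicator {..A} y * exp (\<alpha> * y) \<partial>F))) at_top"
    by (intro tendsto_intros tail_conv l)
  moreover have "\<forall>\<^sub>F u in at_top. tail (F \<star> F) u / tail F u - 2 * ((\<integral>y. indicator {..A} y * tail F (u - y) \<partial>F) / tail F u)
      = both_large A F F u / tail F u"
    using eventually_ge_at_top[of "2 * A"]
    by eventually_elim (simp add: tail_convolution_split[OF rd rd] add_divide_distrib)
  ultimately show ?thesis
    using Lim_transform_eventually by fastforce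
qed

text \<open>A limit of nonnegative ratios is nonnegative. The bound is uniform in A, which makes the
  moment of order \<alpha> finite.\<close>

lemma truncated_moment_le: "(\<integral>y. indicator {..A} y * exp (\<alpha> * y) \<partial>F) \<le> c / 2"
proof -
  have "0 \<le> c - 2 * (\<integral>y. indicator {..A} y * exp (\<alpha> * y) \<partial>F)"
    by (rule tendsto_lowerbound[OF truncated_moment_self[of A]])
       (auto simp: both_large_def intro!: always_eventually divide_nonneg_nonneg)
  then show ?thesis by simp
qed

text \<open>Monotone convergence along integer cutoffs, under the uniform bound c / 2.\<close>

lemma integrable_exp: "integrable F (\<lambda>x. exp (\<alpha> * x))"
proof -
  let ?f = "\<lambda>(n::nat) y. indicator {..real n} y * exp (\<alpha> * y)"
  have int: "integrable F (?f n)" for n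
    using alpha_pos
    by (intro integrable_const_bound[where B="exp (\<alpha> * real n)"]) (auto simp: indicator_def)
  have mono: "mono (\<lambda>n. integral\<^sup>L F (?f n))"
    using alpha_pos by (intro monoI integral_mono int) (auto simp: indicator_def)
  obtain l where l: "(\<lambda>n. integral\<^sup>L F (?f n)) \<longlonglongrightarrow> l"
    using incseq_convergent[OF mono, of "c / 2"] truncated_moment_le by blast
  show ?thesis
  proof (rule integrable_monotone_convergence[OF int _ _ l])
    show "AE x in F. (\<lambda>n. ?f n x) \<longlonglongrightarrow> exp (\<alpha> * x)"
    proof (rule AE_I2, rule tendsto_eventually)
      fix x :: real
      show "\<forall>\<^sub>F n in sequentially. ?f n x = exp (\<alpha> * x)"
        using eventually_ge_at_top[of "nat \<lceil>x\<rceil>"] by eventually_elim (auto simp: indicator_def nat_le_iff ceiling_le_iff)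
    qed
    show "AE x in F. mono (\<lambda>n. ?f n x)"
      by (intro AE_I2 monoI) (auto simp: indicator_def)
  qed measurable
qed

definition mgf :: real where "mgf = (\<integral>x. exp (\<alpha> * x) \<partial>F)"

lemma truncated_moment_tendsto:
  "((\<lambda>A. \<integral>y. indicator {..A} y * exp (\<alpha> * y) \<partial>F) \<longlongrightarrow> mgf) at_top"
  unfolding mgf_def by (rule tendsto_truncated_integral[OF _ integrable_exp]) unfold_locales

lemma mgf_le: "mgf \<le> c / 2"
  by (rule tendsto_upperbound[OF truncated_moment_tendsto]) (use truncated_moment_le in \<open>auto intro!: always_eventually\<close>)

lemma mgf_ge_1: "1 \<le> mgf"
proof -
  have "(\<integral>x. 1 \<partial>F) \<le> mgf"
    unfolding mgf_def using nonneg alpha_pos integrable_exp by (intro integral_mono_AE) auto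
  then show ?thesis using prob_space by simp
qed

text \<open>
  If \<open>c > 2 * mgf\<close>, integrating the tails of \<open>F \<star> F\<close> and \<open>F\<close> against the derivative of
  \<open>exp (b * u) - exp (\<alpha> * u)\<close> over \<open>{0..A}\<close>, with \<open>b > \<alpha>\<close> and \<open>A\<close> tuned so that \<open>\<integral> exp (b * min x A) dF\<close>
  slightly exceeds \<open>mgf\<close>, gives a contradiction as \<open>b \<rightarrow> \<alpha>\<close>.
\<close>
lemma tail_convolution_constant: "c = 2 * mgf"
proof (rule ccontr)
  assume "c \<noteq> 2 * mgf"
  \<comment> \<open>Half of the supposed gap: \<open>2 * mgf + d\<close> lies strictly below c, so
    the tail of \<open>F \<star> F\<close> eventually exceeds that multiple of the tail of
    F.\<close>
  define d where "d = (c - 2 * mgf) / 2"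
  have d: "d > 0" using mgf_le \<open>c \<noteq> 2 * mgf\<close> by (simp add: d_def)
  have rd: "real_distribution F" ..
  have rd2: "real_distribution (F \<star> F)" by (rule real_distribution_convolution[OF rd rd])
  interpret F2: real_distribution "F \<star> F" by (rule rd2)
  have "\<forall>\<^sub>F u in at_top. tail (F \<star> F) u / tail F u > 2 * mgf + d"
    by (rule order_tendstoD[OF tail_conv]) (use d in \<open>simp add: d_def field_simps\<close>)
  then obtain u0' where "\<And>u. u \<ge> u0' \<Longrightarrow> tail (F \<star> F) u / tail F u > 2 * mgf + d"
    by (auto simp: eventually_at_top_linorder)
  then have u0': "\<And>u. u \<ge> u0' \<Longrightarrow> tail (F \<star> F) u \<ge> (2 * mgf + d) * tail F u"
    using tail_pos by (simp add: field_simps less_imp_le)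
  define u0 where "u0 = max 0 u0'"
  have u0: "\<And>u. u \<ge> u0 \<Longrightarrow> tail (F \<star> F) u \<ge> (2 * mgf + d) * tail F u" "u0 \<ge> 0"
    using u0' by (auto simp: u0_def)
  have md: "2 * mgf + d > 0" using mgf_ge_1 d by simp
  have "((\<lambda>b. (2 * mgf + d) * (exp (b * u0) - exp (\<alpha> * u0))) \<longlongrightarrow> (2 * mgf + d) * (exp (\<alpha> * u0) - exp (\<alpha> * u0))) (at_right \<alpha>)"
    by (intro tendsto_intros)
  then have "\<forall>\<^sub>F b in at_right \<alpha>. (2 * mgf + d) * (exp (b * u0) - exp (\<alpha> * u0)) < d\<^sup>2 / 4"
    by (rule order_tendstoD) (use d in simp)
  then have "\<forall>\<^sub>F b in at_right \<alpha>. b > \<alpha> \<and> (2 * mgf + d) * (exp (b * u0) - exp (\<alpha> * u0)) < d\<^sup>2 / 4"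
    using eventually_at_right_less[of \<alpha>] by eventually_elim auto
  then obtain b where b: "b > \<alpha>" "(2 * mgf + d) * (exp (b * u0) - exp (\<alpha> * u0)) < d\<^sup>2 / 4"
    using eventually_happens'[OF trivial_limit_at_right_real] by blast
  have b0: "b > 0" using b alpha_pos by simp
  define \<phi> where "\<phi> = (\<lambda>A b. \<integral>x. exp (b * min x A) \<partial>F)"
  have int_bd: "integrable F (\<lambda>x. exp (b * min x A))" if "b > 0" for b A
    by (rule integrable_const_bound[where B="exp (b * A)"]) (use that in auto)
  have \<phi>_diff: "\<bar>\<phi> A' b - \<phi> A b\<bar> \<le> exp (b * A') - exp (b * A)" if "A \<le> A'" "0 \<le> A" for A A'
  proof -
    have "\<phi> A' b - \<phi> A b = (\<integral>x. exp (b * min x A') - exp (b * min x A) \<partial>F)"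
      unfolding \<phi>_def using int_bd[OF b0] by simp
    also have "\<bar>\<dots>\<bar> \<le> (\<integral>x. \<bar>exp (b * min x A') - exp (b * min x A)\<bar> \<partial>F)"
      by (rule integral_abs_bound)
    also have "\<dots> \<le> (\<integral>x. exp (b * A') - exp (b * A) \<partial>F)"
    proof (rule integral_mono)
      show "\<bar>exp (b * min x A') - exp (b * min x A)\<bar> \<le> exp (b * A') - exp (b * A)" for x
        using that b0 by (auto simp: min_def)
    qed (use int_bd[OF b0] in auto)
    finally show ?thesis by simp
  qed
  have cont: "continuous_on {0..} (\<lambda>A. \<phi> A b)"
  proof (rule continuous_on_eq_continuous_within[THEN iffD2], rule ballI)
    fix A :: real assume "A \<in> {0..}"
    have "((\<lambda>A'. \<bar>exp (b * A') - exp (b * A)\<bar>) \<longlongrightarrow> \<bar>exp (b * A) - exp (b * A)\<bar>) (at A within {0..})"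
      by (intro tendsto_intros)
    then have "((\<lambda>A'. \<bar>exp (b * A') - exp (b * A)\<bar>) \<longlongrightarrow> 0) (at A within {0..})" by simp
    then have "((\<lambda>A'. \<phi> A' b - \<phi> A b) \<longlongrightarrow> 0) (at A within {0..})"
    proof (rule Lim_null_comparison[rotated])
      show "\<forall>\<^sub>F A' in at A within {0..}. norm (\<phi> A' b - \<phi> A b) \<le> \<bar>exp (b * A') - exp (b * A)\<bar>"
        unfolding eventually_at_filter
      proof (intro always_eventually allI impI)
        fix A' :: real assume "A' \<in> {0..}"
        then show "norm (\<phi> A' b - \<phi> A b) \<le> \<bar>exp (b * A') - exp (b * A)\<bar>"
          using \<phi>_diff[of A A'] \<phi>_diff[of A' A] \<open>A \<in> {0..}\<close> b0
          by (cases "A \<le> A'") (auto simp: abs_minus_commute)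
      qed
    qed
    then show "continuous (at A within {0..}) (\<lambda>A. \<phi> A b)"
      unfolding continuous_within by (rule LIM_zero_cancel)
  qed
  have "AE x in F. exp (b * min x 0) = 1"
    using nonneg by eventually_elim (simp add: min_def)
  then have "\<phi> 0 b = (\<integral>x. 1 \<partial>F)"
    unfolding \<phi>_def by (intro integral_cong_AE) auto
  then have \<phi>0: "\<phi> 0 b = 1" by simp
  \<comment> \<open>Capped moments of order b are unbounded in A: the tail of F is eventually at
    least a multiple of \<open>exp (- b' * u)\<close> with b' < b, so
    \<open>exp (b * A) * tail F A\<close> tends to infinity.\<close>
  have "\<exists>A\<ge>0. \<phi> A b \<ge> mgf + d / 2"
  proof -
    define b' where "b' = (\<alpha> + b) / 2"
    have b': "\<alpha> < b'" "b' < b" using b by (auto simp: b'_def)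
    obtain \<kappa> u1 where \<kappa>: "\<kappa> > 0" "\<And>u. u \<ge> u1 \<Longrightarrow> tail F u \<ge> \<kappa> * exp (- b' * u)"
      using exp_tail_lower[OF b'(1)] by blast
    have "filterlim (\<lambda>u. \<kappa> * exp ((b - b') * u)) at_top at_top"
      using \<kappa>(1) b' by real_asymp
    then have "\<forall>\<^sub>F u in at_top. \<kappa> * exp ((b - b') * u) \<ge> mgf + d / 2"
      unfolding filterlim_at_top by blast
    then have "\<forall>\<^sub>F u in at_top. \<kappa> * exp ((b - b') * u) \<ge> mgf + d / 2 \<and> u \<ge> u1 \<and> u \<ge> 0"
      using eventually_ge_at_top[of u1] eventually_ge_at_top[of 0] by eventually_elim auto
    then obtain A where A: "\<kappa> * exp ((b - b') * A) \<ge> mgf + d / 2" "A \<ge> u1" "A \<ge> 0"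
      by (auto simp: eventually_at_top_linorder)
    have "\<kappa> * exp ((b - b') * A) = exp (b * A) * (\<kappa> * exp (- b' * A))"
      by (simp add: mult_exp_exp algebra_simps)
    also have "\<dots> \<le> exp (b * A) * tail F A" using \<kappa>(2)[OF A(2)] by simp
    also have "\<dots> = (\<integral>x. exp (b * A) * indicator {A<..} x \<partial>F)" by simp
    also have "\<dots> \<le> \<phi> A b"
      unfolding \<phi>_def
      by (intro integral_mono int_bd b0 integrable_mult_right integrable_const_bound[where B=1]) (auto simp: indicator_def)
    finally show ?thesis using A by auto
  qed
  then obtain A1 where A1: "A1 \<ge> 0" "\<phi> A1 b \<ge> mgf + d / 2" by blast
  \<comment> \<open>Intermediate value theorem between \<open>\<phi> 0 b = 1\<close>, which is at
    most \<open>mgf\<close>, and the value at A1. The target exceeds \<open>mgf\<close>, whereas the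
    capped moment of order \<alpha> never does.\<close>
  obtain A where A: "0 \<le> A" "\<phi> A b = mgf + d / 2"
    using IVT'[of "\<lambda>A. \<phi> A b" 0 "mgf + d / 2" A1] \<phi>0 A1 mgf_ge_1 d continuous_on_subset[OF cont, of "{0..A1}"]
    by auto
  define p where "p = \<phi> A b"
  define q where "q = \<phi> A \<alpha>"
  have q: "q \<le> mgf" unfolding q_def \<phi>_def mgf_def
    using alpha_pos by (intro integral_mono int_bd integrable_exp) auto
  let ?W = "\<lambda>x. exp (b * min x A) - exp (\<alpha> * min x A)"
  let ?w' = "\<lambda>u. b * exp (b * u) - \<alpha> * exp (\<alpha> * u)"
  have W_nonneg: "0 \<le> ?W x" if "0 \<le> x" for x using that A(1) b by (simp add: mult_right_mono)
  have w'_nonneg: "0 \<le> ?w' u" if "0 \<le> u" for u using that b alpha_pos by (auto intro!: mult_mono)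
  interpret FF: pair_prob_space F F ..
  have nonneg_pair: "AE xy in F \<Otimes>\<^sub>M F. 0 \<le> fst xy \<and> 0 \<le> snd xy"
  proof (rule FF.AE_pair_measure)
    show "AE x in F. AE y in F. 0 \<le> fst (x, y) \<and> 0 \<le> snd (x, y)"
      using nonneg by auto
  qed measurable
  have nonneg2: "AE z in F \<star> F. 0 \<le> z"
    unfolding convolution_def using nonneg_pair
    by (subst AE_distr_iff) (auto simp: case_prod_beta')
  have intW: "integrable D ?W" if "real_distribution D" for D
  proof -
    interpret D: real_distribution D by fact
    show ?thesis
      by (intro Bochner_Integration.integrable_diff D.integrable_const_bound[where B="exp (b * A)"] D.integrable_const_bound[where B="exp (\<alpha> * A)"])
        (use b0 alpha_pos in auto)
  qed
  \<comment> \<open>For nonnegative x and y the capped sum is at most the sum of the capped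
    variables, and \<open>exp (b * t) - exp (\<alpha> * t)\<close> increases on the positive axis.
    The resulting bound factorises by independence.\<close>
  have upper: "(\<integral>z. ?W z \<partial>(F \<star> F)) \<le> p\<^sup>2 - q\<^sup>2"
  proof -
    note pair_mult = integrable_pair_mult[OF prob_space_axioms prob_space_axioms]
    have E: "integrable (F \<Otimes>\<^sub>M F) (\<lambda>(x, y). exp (\<beta> * min x A) * exp (\<beta> * min y A))"
      "(\<integral>(x, y). exp (\<beta> * min x A) * exp (\<beta> * min y A) \<partial>(F \<Otimes>\<^sub>M F)) = (\<phi> A \<beta>)\<^sup>2" if "\<beta> > 0" for \<beta>
      using pair_mult[OF int_bd[OF that, of A] int_bd[OF that, of A]] by (auto simp: \<phi>_def power2_eq_square)
    have "(\<integral>z. ?W z \<partial>(F \<star> F)) = (\<integral>(x, y). ?W (x + y) \<partial>(F \<Otimes>\<^sub>M F))"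
      unfolding convolution_def by (subst integral_distr) (auto simp: case_prod_beta')
    also have "\<dots> \<le> (\<integral>z. (case z of (x, y) \<Rightarrow> exp (b * min x A) * exp (b * min y A)) -
      (case z of (x, y) \<Rightarrow> exp (\<alpha> * min x A) * exp (\<alpha> * min y A)) \<partial>(F \<Otimes>\<^sub>M F))"
    proof (rule integral_mono_AE)
      show "integrable (F \<Otimes>\<^sub>M F) (\<lambda>(x, y). ?W (x + y))"
        using intW[OF rd2] unfolding convolution_def
        by (subst (asm) integrable_distr_eq) (auto simp: case_prod_beta')
      show "integrable (F \<Otimes>\<^sub>M F) (\<lambda>z. (case z of (x, y) \<Rightarrow> exp (b * min x A) * exp (b * min y A)) -
        (case z of (x, y) \<Rightarrow> exp (\<alpha> * min x A) * exp (\<alpha> * min y A)))"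
        by (intro Bochner_Integration.integrable_diff E b0 alpha_pos)
      show "AE z in F \<Otimes>\<^sub>M F. (case z of (x, y) \<Rightarrow> ?W (x + y)) \<le>
        (case z of (x, y) \<Rightarrow> exp (b * min x A) * exp (b * min y A)) -
        (case z of (x, y) \<Rightarrow> exp (\<alpha> * min x A) * exp (\<alpha> * min y A))"
        using nonneg_pair
      proof eventually_elim
        case (elim z)
        obtain x y where z: "z = (x, y)" by force
        have xy: "0 \<le> x" "0 \<le> y" using elim z by auto
        have mono: "exp (b * s) - exp (\<alpha> * s) \<le> exp (b * t) - exp (\<alpha> * t)" if "0 \<le> s" "s \<le> t" for s t
        proof (rule DERIV_nonneg_imp_nondecreasing[OF that(2)])
          fix r assume "s \<le> r" "r \<le> t"
          then show "\<exists>y. ((\<lambda>x. exp (b * x) - exp (\<alpha> * x)) has_real_derivative y) (at r) \<and> 0 \<le> y"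
            using w'_nonneg[of r] that by (intro exI[of _ "?w' r"]) (auto intro!: derivative_eq_intros)
        qed
        have "?W (x + y) \<le> exp (b * (min x A + min y A)) - exp (\<alpha> * (min x A + min y A))"
          using xy A(1) by (intro mono) auto
        then show ?case by (simp add: z exp_add[symmetric] distrib_left)
      qed
    qed
    also have "\<dots> = (\<phi> A b)\<^sup>2 - (\<phi> A \<alpha>)\<^sup>2"
      by (subst Bochner_Integration.integral_diff) (simp_all add: E b0 alpha_pos)
    finally show ?thesis by (simp add: p_def q_def)
  qed
  have EW: "(\<integral>z. ?W z \<partial>F) = p - q"
    unfolding p_def q_def \<phi>_def using int_bd b0 alpha_pos by simp
  \<comment> \<open>Layer cake on both sides. Beyond u0 the tails compare by the choice of u0; on
    [0, u0] the tail of F is replaced by 1, which produces the extra term.\<close>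
  have lower: "(2 * mgf + d) * (p - q) \<le> (\<integral>z. ?W z \<partial>(F \<star> F)) + (2 * mgf + d) * (exp (b * u0) - exp (\<alpha> * u0))"
  proof -
    let ?K = "2 * mgf + d"
    let ?u = "min u0 A"
    have nn: "ennreal (\<integral>z. ?W z \<partial>D) = (\<integral>\<^sup>+u. ennreal (?w' u) * indicator {0..A} u * tail D u \<partial>lborel)"
      and W0: "0 \<le> (\<integral>z. ?W z \<partial>D)"
      if D: "real_distribution D" and D0: "AE z in D. 0 \<le> z" for D
    proof -
      have AE: "AE z in D. 0 \<le> ?W z" using D0 by eventually_elim (rule W_nonneg)
      then show "0 \<le> (\<integral>z. ?W z \<partial>D)" by (rule integral_nonneg_AE)
      show "ennreal (\<integral>z. ?W z \<partial>D) = (\<integral>\<^sup>+u. ennreal (?w' u) * indicator {0..A} u * tail D u \<partial>lborel)"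
        using nn_integral_eq_integral[OF intW[OF D] AE] nn_integral_exp_difference[OF D A(1) alpha_pos less_imp_le[OF b(1)] D0]
        by simp
    qed
    have FTC: "(\<integral>\<^sup>+u. ennreal (?w' u) * indicator {0..?u} u \<partial>lborel) = ennreal (exp (b * ?u) - exp (\<alpha> * ?u) - (exp (b * 0) - exp (\<alpha> * 0)))"
      using u0(2) A(1) w'_nonneg by (intro nn_integral_FTC_Icc) (auto intro!: derivative_eq_intros)
    have "ennreal ?K * ennreal (\<integral>z. ?W z \<partial>F) = (\<integral>\<^sup>+u. ennreal ?K * (ennreal (?w' u) * indicator {0..A} u * tail F u) \<partial>lborel)"
      unfolding nn[OF rd nonneg] by (rule nn_integral_cmult[symmetric]) measurable
    also have "\<dots> \<le> (\<integral>\<^sup>+u. ennreal (?w' u) * indicator {0..A} u * tail (F \<star> F) u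
        + ennreal ?K * (ennreal (?w' u) * indicator {0..?u} u) \<partial>lborel)"
    proof (rule nn_integral_mono)
      fix u :: real
      show "ennreal ?K * (ennreal (?w' u) * indicator {0..A} u * tail F u) \<le>
        ennreal (?w' u) * indicator {0..A} u * tail (F \<star> F) u + ennreal ?K * (ennreal (?w' u) * indicator {0..?u} u)"
      proof (cases "u \<in> {0..A}")
        case True
        have w: "0 \<le> ?w' u" using w'_nonneg True by simp
        have "?K * (?w' u * tail F u) \<le> ?w' u * tail (F \<star> F) u + ?K * (?w' u * indicator {0..?u} u)"
        proof (cases "u \<le> u0")
          case True
          have "?K * (?w' u * tail F u) \<le> ?K * (?w' u * 1)"
            using md w by (intro mult_left_mono) auto
          moreover have "0 \<le> ?w' u * tail (F \<star> F) u" using w by simp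
          ultimately show ?thesis using True \<open>u \<in> {0..A}\<close> by simp
        next
          case False
          have "?w' u * (?K * tail F u) \<le> ?w' u * tail (F \<star> F) u"
            using w u0(1)[of u] False by (intro mult_left_mono) auto
          then show ?thesis using False by (simp add: algebra_simps)
        qed
        then show ?thesis using True w md
          by (simp add: ennreal_mult[symmetric] ennreal_plus[symmetric] ennreal_indicator[symmetric] del: ennreal_plus)
      qed simp
    qed
    also have "\<dots> = ennreal (\<integral>z. ?W z \<partial>(F \<star> F)) + ennreal ?K * ennreal (exp (b * ?u) - exp (\<alpha> * ?u))"
      unfolding nn[OF rd2 nonneg2] using FTC
      by (subst nn_integral_add) (auto simp: nn_integral_cmult)
    also have "\<dots> = ennreal ((\<integral>z. ?W z \<partial>(F \<star> F)) + ?K * (exp (b * ?u) - exp (\<alpha> * ?u)))"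
      using md W_nonneg[of u0] u0(2) W0[OF rd2 nonneg2] by (simp add: ennreal_mult ennreal_plus)
    finally have le: "ennreal ?K * ennreal (\<integral>z. ?W z \<partial>F) \<le> ennreal ((\<integral>z. ?W z \<partial>(F \<star> F)) + ?K * (exp (b * ?u) - exp (\<alpha> * ?u)))" .
    have W_u: "0 \<le> ?K * (exp (b * ?u) - exp (\<alpha> * ?u))"
      using md b(1) u0(2) A(1) by (intro mult_nonneg_nonneg) (auto intro!: mult_right_mono)
    have "?K * (\<integral>z. ?W z \<partial>F) \<le> (\<integral>z. ?W z \<partial>(F \<star> F)) + ?K * (exp (b * ?u) - exp (\<alpha> * ?u))"
      using le md W0[OF rd nonneg] add_nonneg_nonneg[OF W0[OF rd2 nonneg2] W_u]
      by (simp only: ennreal_mult[symmetric] less_imp_le ennreal_le_iff)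
    also have "exp (b * ?u) - exp (\<alpha> * ?u) \<le> exp (b * u0) - exp (\<alpha> * u0)"
    proof (rule DERIV_nonneg_imp_nondecreasing[of ?u u0])
      fix r assume "?u \<le> r" "r \<le> u0"
      then show "\<exists>y. ((\<lambda>x. exp (b * x) - exp (\<alpha> * x)) has_real_derivative y) (at r) \<and> 0 \<le> y"
        using w'_nonneg[of r] u0(2) A(1) by (intro exI[of _ "?w' r"]) (auto intro!: derivative_eq_intros)
    qed simp
    finally show ?thesis using md by (simp add: EW)
  qed
  \<comment> \<open>Since \<open>p = mgf + d / 2\<close> and \<open>q \<le> mgf\<close>, both
    factors are at least d / 2; but \<open>lower\<close> and \<open>upper\<close> put their product
    strictly below \<open>d\<^sup>2 / 4\<close>.\<close>
  have "(d / 2) * (d / 2) \<le> (p - q) * (2 * mgf + d - (p + q))"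
    using A q d by (intro mult_mono) (auto simp: p_def)
  also have "\<dots> = (2 * mgf + d) * (p - q) - (p\<^sup>2 - q\<^sup>2)" by (simp add: power2_eq_square algebra_simps)
  also have "\<dots> < d\<^sup>2 / 4" using lower upper b by linarith
  finally show False by (simp add: power2_eq_square)
qed


text \<open>Below u1 the tail of F is at least \<open>tail F u1\<close>, so the constant
  \<open>1 / tail F u1\<close> suffices there; this makes the bound valid for every real u.\<close>

lemma tail_bounded:
  assumes "real_distribution H" "((\<lambda>u. tail H u / tail F u) \<longlongrightarrow> k) at_top"
  obtains K where "K \<ge> 0" "\<And>u. tail H u \<le> K * tail F u"
proof -
  interpret H: real_distribution H by fact
  have "\<forall>\<^sub>F u in at_top. tail H u / tail F u < k + 1"
    by (rule order_tendstoD[OF assms(2)]) simp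
  then obtain u1 where u1: "\<And>u. u \<ge> u1 \<Longrightarrow> tail H u / tail F u < k + 1"
    by (auto simp: eventually_at_top_linorder)
  define K where "K = max (k + 1) (1 / tail F u1)"
  have K: "K \<ge> 0" using tail_pos[of u1] by (simp add: K_def max.coboundedI2)
  have "tail H u \<le> K * tail F u" for u
  proof (cases "u \<ge> u1")
    case True
    have "tail H u \<le> (k + 1) * tail F u" using u1[OF True] tail_pos[of u] by (simp add: field_simps)
    also have "\<dots> \<le> K * tail F u" by (intro mult_right_mono) (auto simp: K_def)
    finally show ?thesis .
  next
    case False
    have "tail H u \<le> 1 / tail F u1 * tail F u1" using tail_pos[of u1] by simp
    also have "\<dots> \<le> K * tail F u"
      using False by (intro mult_mono tail_mono K) (auto simp: K_def)
    finally show ?thesis .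
  qed
  with K show ?thesis by (rule that)
qed

text \<open>Domination of tails carries over to the moment of order \<alpha> by the layer cake
  formula.\<close>

lemma integrable_exp_of_tail:
  assumes "real_distribution H" "((\<lambda>u. tail H u / tail F u) \<longlongrightarrow> k) at_top"
  shows "integrable H (\<lambda>x. exp (\<alpha> * x))"
proof -
  interpret H: real_distribution H by fact
  have rd: "real_distribution F" ..
  obtain K where K: "K \<ge> 0" "\<And>u. tail H u \<le> K * tail F u"
    using tail_bounded[OF assms] by blast
  have "(\<integral>\<^sup>+x. exp (\<alpha> * x) \<partial>H) = (\<integral>\<^sup>+u. ennreal (\<alpha> * exp (\<alpha> * u)) * tail H u \<partial>lborel)"
    by (rule nn_integral_exp_tail[OF assms(1) alpha_pos])
  also have "\<dots> \<le> (\<integral>\<^sup>+u. ennreal K * (ennreal (\<alpha> * exp (\<alpha> * u)) * tail F u) \<partial>lborel)"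
    using K alpha_pos
    by (intro nn_integral_mono) (auto simp: ennreal_mult[symmetric] mult.left_commute intro!: ennreal_leI mult_left_mono)
  also have "\<dots> = ennreal K * (\<integral>\<^sup>+x. exp (\<alpha> * x) \<partial>F)"
    unfolding nn_integral_exp_tail[OF rd alpha_pos] by (rule nn_integral_cmult) measurable
  also have "\<dots> < \<infinity>"
    using nn_integral_eq_integral[OF integrable_exp] by (simp add: ennreal_mult_less_top)
  finally show ?thesis
    by (intro integrableI_nonneg) auto
qed

text \<open>Each truncated piece has its limit by dominated convergence. The part with both summands
  large is at most \<open>K\<^sup>2\<close> times the one for \<open>F \<star> F\<close>, whose
  limit in u tends to \<open>c - 2 * mgf = 0\<close> as A grows: here the value of the constant
  enters.\<close>

lemma tail_convolution_limit:
  assumes "real_distribution H1" "real_distribution H2"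
    and 1: "((\<lambda>u. tail H1 u / tail F u) \<longlongrightarrow> k1) at_top"
    and 2: "((\<lambda>u. tail H2 u / tail F u) \<longlongrightarrow> k2) at_top"
  shows "((\<lambda>u. tail (H1 \<star> H2) u / tail F u) \<longlongrightarrow>
    k1 * (\<integral>x. exp (\<alpha> * x) \<partial>H2) + k2 * (\<integral>x. exp (\<alpha> * x) \<partial>H1)) at_top"
proof -
  have rd: "real_distribution F" ..
  obtain K1 where K1: "K1 \<ge> 0" "\<And>u. tail H1 u \<le> K1 * tail F u"
    using tail_bounded[OF assms(1) 1] by blast
  obtain K2 where K2: "K2 \<ge> 0" "\<And>u. tail H2 u \<le> K2 * tail F u"
    using tail_bounded[OF assms(2) 2] by blast
  define K where "K = max K1 K2"
  have K: "K \<ge> 0" "tail H1 u \<le> K * tail F u" "tail H2 u \<le> K * tail F u" for u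
    using K1(1) order_trans[OF K1(2)[of u] mult_right_mono[of K1 K "tail F u"]]
      order_trans[OF K2(2)[of u] mult_right_mono[of K2 K "tail F u"]]
    by (auto simp: K_def)
  let ?M = "\<lambda>H A. \<integral>y. indicator {..A} y * exp (\<alpha> * y) \<partial>H"
  show ?thesis
  proof (rule tendsto_approx)
    fix A
    show "((\<lambda>u. (\<integral>y. indicator {..A} y * tail H1 (u - y) \<partial>H2) / tail F u +
      (\<integral>y. indicator {..A} y * tail H2 (u - y) \<partial>H1) / tail F u) \<longlongrightarrow> k1 * ?M H2 A + k2 * ?M H1 A) at_top"
      by (intro tendsto_add truncated_tail_convolution assms)
    show "((\<lambda>u. K\<^sup>2 * (both_large A F F u / tail F u)) \<longlongrightarrow> K\<^sup>2 * (c - 2 * ?M F A)) at_top"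
      by (intro tendsto_mult tendsto_const truncated_moment_self)
    show "\<forall>\<^sub>F u in at_top. (\<integral>y. indicator {..A} y * tail H1 (u - y) \<partial>H2) / tail F u +
      (\<integral>y. indicator {..A} y * tail H2 (u - y) \<partial>H1) / tail F u \<le> tail (H1 \<star> H2) u / tail F u \<and>
      tail (H1 \<star> H2) u / tail F u \<le> ((\<integral>y. indicator {..A} y * tail H1 (u - y) \<partial>H2) / tail F u +
      (\<integral>y. indicator {..A} y * tail H2 (u - y) \<partial>H1) / tail F u) + K\<^sup>2 * (both_large A F F u / tail F u)"
      using eventually_ge_at_top[of "2 * A"]
    proof eventually_elim
      case (elim u)
      have "both_large A H1 H2 u \<ge> 0" by (simp add: both_large_def)
      moreover have "both_large A H1 H2 u \<le> K\<^sup>2 * both_large A F F u"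
        by (rule both_large_mono[OF assms(1,2) rd]) (use K in auto)
      ultimately show ?case
        using tail_pos[of u] unfolding tail_convolution_split[OF assms(1,2) elim]
        by (simp add: field_simps)
    qed
  next
    show "((\<lambda>A. k1 * ?M H2 A + k2 * ?M H1 A) \<longlongrightarrow> k1 * (\<integral>x. exp (\<alpha> * x) \<partial>H2) + k2 * (\<integral>x. exp (\<alpha> * x) \<partial>H1)) at_top"
      by (intro tendsto_intros tendsto_truncated_integral assms integrable_exp_of_tail[OF assms(1) 1] integrable_exp_of_tail[OF assms(2) 2])
    have "((\<lambda>A. K\<^sup>2 * (c - 2 * ?M F A)) \<longlongrightarrow> K\<^sup>2 * (c - 2 * mgf)) at_top"
      by (intro tendsto_intros truncated_moment_tendsto)
    then show "((\<lambda>A. K\<^sup>2 * (c - 2 * ?M F A)) \<longlongrightarrow> 0) at_top"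
      by (simp add: tail_convolution_constant)
  qed
qed

end

section \<open>Compound Poisson laws\<close>

primrec conv_pow :: "real measure \<Rightarrow> nat \<Rightarrow> real measure" where
  "conv_pow F 0 = return borel 0"
| "conv_pow F (Suc k) = (conv_pow F k \<star> F)"

definition compound_poisson :: "real \<Rightarrow> real measure \<Rightarrow> real measure" where
  "compound_poisson l F = measure_pmf (poisson_pmf l) \<bind> conv_pow F"

lemma real_distribution_return: "real_distribution (return borel (x::real))"
  by (intro real_distribution.intro prob_space_return) (auto simp: real_distribution_axioms_def)

context
  fixes F :: "real measure"
  assumes F: "real_distribution F"
begin

lemma real_distribution_conv_pow: "real_distribution (conv_pow F k)"
  by (induction k) (auto intro: real_distribution_return real_distribution_convolution F)

lemma char_conv_pow: "char (conv_pow F k) \<theta> = char F \<theta> ^ k"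
proof (induction k)
  case 0
  show ?case unfolding char_def by (simp add: integral_return)
next
  case (Suc k)
  then show ?case by (simp add: char_convolution[OF real_distribution_conv_pow F])
qed

lemma exp_moment_conv_pow:
  fixes a :: real
  assumes "integrable F (\<lambda>x. exp (a * x))"
  shows "integrable (conv_pow F k) (\<lambda>x. exp (a * x))"
    and "(\<integral>x. exp (a * x) \<partial>conv_pow F k) = (\<integral>x. exp (a * x) \<partial>F) ^ k"
proof (induction k)
  case 0
  interpret real_distribution "return borel (0::real)" by (rule real_distribution_return)
  have "AE x in return borel 0. exp (a * x) = 1"
    by (subst AE_return) auto
  case 1 then show ?case
    by (simp add: integrable_iff_bounded nn_integral_return)
  case 2 then show ?case by (simp add: integral_return)
next
  case (Suc k)
  case 1 show ?case using exp_moment_convolution(1)[OF real_distribution_conv_pow F Suc(1) assms] by simp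
  case 2 show ?case using exp_moment_convolution(2)[OF real_distribution_conv_pow F Suc(1) assms] Suc(2) by simp
qed

lemma measurable_conv_pow [measurable]: "conv_pow F \<in> measurable (measure_pmf p) (subprob_algebra borel)"
proof -
  have "conv_pow F k \<in> space (subprob_algebra borel)" for k
  proof -
    interpret real_distribution "conv_pow F k" by (rule real_distribution_conv_pow)
    show ?thesis by (simp add: space_subprob_algebra prob_space_imp_subprob_space prob_space_axioms)
  qed
  then show ?thesis by simp
qed

end

lemma poisson_integral:
  fixes f :: "nat \<Rightarrow> 'b::{banach, second_countable_topology}"
  assumes "l > 0" and sums: "summable (\<lambda>k. l ^ k / fact k * exp (- l) * norm (f k))"
  shows "integrable (poisson_pmf l) f"
    and "(\<integral>k. f k \<partial>poisson_pmf l) = (\<Sum>k. (l ^ k / fact k * exp (- l)) *\<^sub>R f k)"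
proof -
  have *: "measure_pmf (poisson_pmf l) = density (count_space UNIV) (\<lambda>k. ennreal (l ^ k / fact k * exp (- l)))"
    using assms(1) by (subst measure_pmf_eq_density) (simp add: pmf_poisson)
  have int: "integrable (count_space UNIV) (\<lambda>k. (l ^ k / fact k * exp (- l)) *\<^sub>R f k)"
    using sums assms(1) by (simp add: integrable_count_space_nat_iff)
  then show "integrable (poisson_pmf l) f"
    unfolding * using assms(1) by (subst integrable_density) auto
  show "(\<integral>k. f k \<partial>poisson_pmf l) = (\<Sum>k. (l ^ k / fact k * exp (- l)) *\<^sub>R f k)"
    unfolding * using assms(1) int by (subst integral_density) (auto simp: integral_count_space_nat)
qed

text \<open>Valid in a general normed field: complex z yields the characteristic function of a
  compound Poisson law, real z its exponential moments.\<close>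

lemma poisson_power:
  fixes z :: "'b::{real_normed_field, banach, second_countable_topology}"
  assumes "l > 0"
  shows "integrable (poisson_pmf l) (\<lambda>k. z ^ k)"
    and "(\<integral>k. z ^ k \<partial>poisson_pmf l) = exp (of_real l * (z - 1))"
proof -
  have sums: "(\<lambda>k. (l ^ k / fact k * exp (- l)) *\<^sub>R z ^ k) sums (exp (of_real l * (z - 1)))"
  proof -
    have "(\<lambda>k. of_real (exp (-l)) * ((of_real l * z) ^ k /\<^sub>R fact k)) sums (of_real (exp (-l)) * exp (of_real l * z))"
      by (intro sums_mult exp_converges)
    also have "(\<lambda>k. of_real (exp (-l)) * ((of_real l * z) ^ k /\<^sub>R fact k)) = (\<lambda>k. (l ^ k / fact k * exp (- l)) *\<^sub>R z ^ k)"
      by (auto simp: scaleR_conv_of_real power_mult_distrib field_simps)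
    also have "of_real (exp (-l)) * exp (of_real l * z) = exp (of_real l * (z - 1))"
      by (simp add: exp_of_real[symmetric] exp_add[symmetric] algebra_simps exp_diff exp_minus field_simps)
    finally show ?thesis .
  qed
  have "summable (\<lambda>k. exp (-l) * ((l * norm z) ^ k /\<^sub>R fact k))"
    by (intro summable_mult summable_exp_generic)
  also have "(\<lambda>k. exp (-l) * ((l * norm z) ^ k /\<^sub>R fact k)) = (\<lambda>k. l ^ k / fact k * exp (- l) * norm (z ^ k))"
    by (auto simp: power_mult_distrib norm_power field_simps)
  finally have s: "summable (\<lambda>k. l ^ k / fact k * exp (- l) * norm (z ^ k))" .
  show "integrable (poisson_pmf l) (\<lambda>k. z ^ k)" by (rule poisson_integral(1)[OF assms s])
  show "(\<integral>k. z ^ k \<partial>poisson_pmf l) = exp (of_real l * (z - 1))"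
    unfolding poisson_integral(2)[OF assms s] using sums by (rule sums_unique[symmetric])
qed

text \<open>Index shift: k times the weight at k is l times the weight at k - 1. The truncated
  exponent \<open>k - 1\<close> at k = 0 is harmless because of the factor k.\<close>

lemma poisson_weighted_power:
  fixes z :: real
  assumes "l > 0"
  shows "(\<integral>k. real k * z ^ (k - 1) \<partial>poisson_pmf l) = l * exp (l * (z - 1))"
proof -
  let ?p = "\<lambda>k. l ^ k / fact k * exp (- l)"
  have eq: "?p (Suc k) * (real (Suc k) * z ^ (Suc k - 1)) = l * (?p k * z ^ k)" for k z
    by (simp add: field_simps flip: of_nat_Suc)
  have sums: "(\<lambda>k. ?p k * z ^ k) sums exp (l * (z - 1))" for z :: real
  proof -
    have "(\<lambda>k. exp (-l) * ((l * z) ^ k /\<^sub>R fact k)) sums (exp (-l) * exp (l * z))"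
      by (intro sums_mult exp_converges)
    then show ?thesis
      by (simp add: power_mult_distrib field_simps exp_diff exp_minus)
  qed
  have S: "(\<lambda>k. ?p k * (real k * z ^ (k - 1))) sums (l * exp (l * (z - 1)))" for z :: real
    using sums_mult[OF sums[of z], of l] unfolding eq[symmetric]
    by (subst (asm) sums_Suc_iff) simp
  have abs: "(\<lambda>k. ?p k * norm (real k * z ^ (k - 1))) = (\<lambda>k. ?p k * (real k * \<bar>z\<bar> ^ (k - 1)))"
    by (simp add: abs_mult power_abs)
  have "summable (\<lambda>k. ?p k * norm (real k * z ^ (k - 1)))"
    unfolding abs using S[of "\<bar>z\<bar>"] by (rule sums_summable)
  from poisson_integral(2)[OF assms this] show ?thesis
    using S[of z] by (simp add: sums_iff)
qed

context
  fixes F :: "real measure" and l :: real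
  assumes F: "real_distribution F" and l: "l > 0"
begin

interpretation F: real_distribution F by (rule F)

lemma sets_compound_poisson [simp]: "sets (compound_poisson l F) = sets borel"
proof -
  have "sets (conv_pow F k) = sets borel" for k
    by (rule real_distribution.events_eq_borel[OF real_distribution_conv_pow[OF F]])
  then show ?thesis
    unfolding compound_poisson_def by (intro sets_bind) auto
qed

lemma nn_integral_compound_poisson:
  assumes [measurable]: "f \<in> borel_measurable borel"
  shows "(\<integral>\<^sup>+x. f x \<partial>compound_poisson l F) = (\<integral>\<^sup>+k. (\<integral>\<^sup>+x. f x \<partial>conv_pow F k) \<partial>poisson_pmf l)"
  unfolding compound_poisson_def
  by (rule nn_integral_bind[OF assms measurable_conv_pow[OF F]])

lemma real_distribution_compound_poisson: "real_distribution (compound_poisson l F)"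
proof -
  have "emeasure (conv_pow F k) UNIV = 1" for k
    using prob_space.emeasure_space_1[of "conv_pow F k"] real_distribution_conv_pow[OF F, of k]
    by (simp add: real_distribution_def real_distribution.space_eq_univ)
  then have "(\<integral>\<^sup>+x. 1 \<partial>compound_poisson l F) = 1"
    by (subst nn_integral_compound_poisson)
       (auto simp: real_distribution.space_eq_univ[OF real_distribution_conv_pow[OF F]] measure_pmf.emeasure_space_1[simplified])
  then have "prob_space (compound_poisson l F)"
    by (intro prob_spaceI) simp
  then show ?thesis
    by (simp add: real_distribution_def real_distribution_axioms_def)
qed

lemma measure_compound_poisson:
  assumes [measurable]: "A \<in> sets borel"
  shows "measure (compound_poisson l F) A = (\<integral>k. measure (conv_pow F k) A \<partial>poisson_pmf l)"
proof -
  have fin: "emeasure (conv_pow F k) A = ennreal (measure (conv_pow F k) A)" for k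
    using real_distribution_conv_pow[OF F, of k]
    by (simp add: finite_measure.emeasure_eq_measure prob_space_def real_distribution_def)
  have "sets (conv_pow F k) = sets borel" for k
    by (rule real_distribution.events_eq_borel[OF real_distribution_conv_pow[OF F]])
  then have "(\<integral>\<^sup>+x. indicator A x \<partial>compound_poisson l F) = (\<integral>\<^sup>+k. ennreal (measure (conv_pow F k) A) \<partial>poisson_pmf l)"
    by (subst nn_integral_compound_poisson) (auto simp: fin)
  then show ?thesis
    by (subst integral_eq_nn_integral) (auto simp: measure_def)
qed

text \<open>Bounded real f are enough for the real and imaginary parts of a character; the unbounded
  exponentials go through the nonnegative integral instead.\<close>

lemma integral_compound_poisson:
  fixes f :: "real \<Rightarrow> real"
  assumes [measurable]: "f \<in> borel_measurable borel" and bd: "\<And>x. \<bar>f x\<bar> \<le> 1"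
  shows "(\<integral>x. f x \<partial>compound_poisson l F) = (\<integral>k. (\<integral>x. f x \<partial>conv_pow F k) \<partial>poisson_pmf l)"
proof -
  have 1: "emeasure (conv_pow F k) (space (conv_pow F k)) = 1" for k
    using real_distribution_conv_pow[OF F, of k] by (simp add: prob_space.emeasure_space_1 real_distribution_def)
  show ?thesis
    unfolding compound_poisson_def
    by (rule integral_bind[where K=borel and B=1 and B'=1, OF _ _ measurable_conv_pow[OF F]])
       (auto intro!: measure_pmf.finite_measure_axioms bd simp: 1)
qed

lemma char_compound_poisson: "char (compound_poisson l F) \<theta> = exp (of_real l * (char F \<theta> - 1))"
proof -
  interpret C: real_distribution "compound_poisson l F" by (rule real_distribution_compound_poisson)
  have ck: "integrable (conv_pow F k) (\<lambda>x. iexp (\<theta> * x))" for k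
  proof -
    interpret P: real_distribution "conv_pow F k" by (rule real_distribution_conv_pow[OF F])
    show ?thesis by (rule P.integrable_iexp) auto
  qed
  have ic: "integrable (compound_poisson l F) (\<lambda>x. iexp (\<theta> * x))"
    by (rule C.integrable_iexp) auto
  have ip: "integrable (poisson_pmf l) (\<lambda>k. char (conv_pow F k) \<theta>)"
    by (simp add: char_conv_pow[OF F] poisson_power[OF l])
  have "char (compound_poisson l F) \<theta> = (\<integral>k. char (conv_pow F k) \<theta> \<partial>poisson_pmf l)"
  proof (rule complex_eqI)
    have "Re (char (compound_poisson l F) \<theta>) = (\<integral>x. Re (iexp (\<theta> * x)) \<partial>compound_poisson l F)"
      unfolding char_def using ic by (rule integral_Re[symmetric])
    also have "\<dots> = (\<integral>k. (\<integral>x. Re (iexp (\<theta> * x)) \<partial>conv_pow F k) \<partial>poisson_pmf l)"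
      by (rule integral_compound_poisson) (auto intro: order_trans[OF abs_Re_le_cmod])
    also have "\<dots> = (\<integral>k. Re (char (conv_pow F k) \<theta>) \<partial>poisson_pmf l)"
      unfolding char_def using ck by (subst integral_Re) auto
    finally show "Re (char (compound_poisson l F) \<theta>) = Re (\<integral>k. char (conv_pow F k) \<theta> \<partial>poisson_pmf l)"
      using ip by (simp add: integral_Re)
    have "Im (char (compound_poisson l F) \<theta>) = (\<integral>x. Im (iexp (\<theta> * x)) \<partial>compound_poisson l F)"
      unfolding char_def using ic by (rule integral_Im[symmetric])
    also have "\<dots> = (\<integral>k. (\<integral>x. Im (iexp (\<theta> * x)) \<partial>conv_pow F k) \<partial>poisson_pmf l)"
      by (rule integral_compound_poisson) (auto intro: order_trans[OF abs_Im_le_cmod])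
    also have "\<dots> = (\<integral>k. Im (char (conv_pow F k) \<theta>) \<partial>poisson_pmf l)"
      unfolding char_def using ck by (subst integral_Im) auto
    finally show "Im (char (compound_poisson l F) \<theta>) = Im (\<integral>k. char (conv_pow F k) \<theta> \<partial>poisson_pmf l)"
      using ip by (simp add: integral_Im)
  qed
  then show ?thesis
    by (simp add: char_conv_pow[OF F] poisson_power[OF l])
qed

lemma exp_moment_compound_poisson:
  fixes a :: real
  assumes "integrable F (\<lambda>x. exp (a * x))"
  shows "integrable (compound_poisson l F) (\<lambda>x. exp (a * x))"
    and "(\<integral>x. exp (a * x) \<partial>compound_poisson l F) = exp (l * ((\<integral>x. exp (a * x) \<partial>F) - 1))"
proof -
  let ?c = "\<integral>x. exp (a * x) \<partial>F"
  interpret C: real_distribution "compound_poisson l F" by (rule real_distribution_compound_poisson)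
  have c: "0 \<le> ?c" by simp
  have "(\<integral>\<^sup>+x. ennreal (exp (a * x)) \<partial>conv_pow F k) = ennreal (?c ^ k)" for k
    using exp_moment_conv_pow[OF F assms, of k] by (subst nn_integral_eq_integral) auto
  then have "(\<integral>\<^sup>+x. ennreal (exp (a * x)) \<partial>compound_poisson l F) = (\<integral>\<^sup>+k. ennreal (?c ^ k) \<partial>poisson_pmf l)"
    by (subst nn_integral_compound_poisson) auto
  also have "\<dots> = ennreal (exp (l * (?c - 1)))"
    using poisson_power[OF l, of ?c] c by (subst nn_integral_eq_integral) auto
  finally have *: "(\<integral>\<^sup>+x. ennreal (exp (a * x)) \<partial>compound_poisson l F) = ennreal (exp (l * (?c - 1)))" .
  show "integrable (compound_poisson l F) (\<lambda>x. exp (a * x))"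
    by (rule integrableI_nonneg) (auto simp: *)
  show "(\<integral>x. exp (a * x) \<partial>compound_poisson l F) = exp (l * (?c - 1))"
    by (subst integral_eq_nn_integral) (auto simp: *)
qed

end

section \<open>Tails of compound Poisson laws\<close>

context conv_equiv
begin

lemma rd_F: "real_distribution F" ..

text \<open>Any one of the k summands may be the large one, and each of the others contributes a
  factor \<open>mgf\<close>.\<close>

lemma tail_conv_pow_limit:
  "((\<lambda>u. tail (conv_pow F k) u / tail F u) \<longlongrightarrow> real k * mgf ^ (k - 1)) at_top"
proof (induction k)
  case 0
  have "\<forall>\<^sub>F u in at_top. 0 = tail (conv_pow F 0) u / tail F u"
    using eventually_ge_at_top[of 0] by eventually_elim (simp add: measure_return)
  then show ?case by (intro tendsto_eventually) (auto elim: eventually_mono)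
next
  case (Suc k)
  have "((\<lambda>u. tail (conv_pow F k \<star> F) u / tail F u) \<longlongrightarrow>
    real k * mgf ^ (k - 1) * mgf + 1 * mgf ^ k) at_top"
    using tail_convolution_limit[OF real_distribution_conv_pow[OF rd_F] rd_F Suc tail_self]
    by (simp add: exp_moment_conv_pow[OF rd_F integrable_exp] mgf_def)
  also have "real k * mgf ^ (k - 1) * mgf + 1 * mgf ^ k = real (Suc k) * mgf ^ (Suc k - 1)"
    by (cases k) (auto simp: algebra_simps)
  finally show ?case by simp
qed

text \<open>A bound of Kesten type, serving as majorant for the Poisson mixture. D is the crude
  constant for \<open>F \<star> F\<close> and need not be close to \<open>mgf\<close>, since Poisson
  weights absorb any geometric growth.\<close>

lemma tail_conv_pow_bounded:
  obtains C D where "\<And>k u. tail (conv_pow F k) u \<le> C * D ^ k * tail F u" "D \<ge> 0" "C \<ge> 0"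
proof -
  obtain D where D: "D \<ge> 0" "\<And>u. tail (F \<star> F) u \<le> D * tail F u"
    using tail_bounded[OF real_distribution_convolution[OF rd_F rd_F] tail_conv] by blast
  \<comment> \<open>The point mass at 0 has tail 1 for u < 0, and there \<open>C * tail F u\<close>
    is at least 1.\<close>
  define C where "C = 1 / tail F 0"
  have C: "C \<ge> 0" by (simp add: C_def)
  have "tail (conv_pow F k) u \<le> C * D ^ k * tail F u" for k u
  proof (induction k arbitrary: u)
    case 0
    show ?case
    proof (cases "u < 0")
      case True
      then show ?thesis
        using tail_mono[of u 0] tail_pos[of 0] by (simp add: C_def measure_return field_simps)
    qed (use tail_pos[of u] C in \<open>auto simp: measure_return\<close>)
  next
    case (Suc k)
    interpret P: real_distribution "conv_pow F k" by (rule real_distribution_conv_pow[OF rd_F])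
    have "tail (conv_pow F (Suc k)) u = (\<integral>y. tail (conv_pow F k) (u - y) \<partial>F)"
      by (simp add: tail_convolution[OF P.real_distribution_axioms rd_F])
    also have "\<dots> \<le> (\<integral>y. C * D ^ k * tail F (u - y) \<partial>F)"
      by (intro integral_mono Suc integrable_mult_right integrable_const_bound[where B=1]) auto
    also have "\<dots> = C * D ^ k * tail (F \<star> F) u"
      by (simp add: tail_convolution[OF rd_F rd_F])
    also have "\<dots> \<le> C * D ^ k * (D * tail F u)"
      using C D by (intro mult_left_mono) auto
    finally show ?case by (simp add: algebra_simps)
  qed
  then show ?thesis using D(1) C by (rule that)
qed

text \<open>Dominated convergence over the number of summands turns the termwise limits into the
  Poisson mean of \<open>real k * mgf ^ (k - 1)\<close>.\<close>

lemma tail_compound_poisson_limit: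
  assumes l: "l > 0"
  shows "((\<lambda>u. tail (compound_poisson l F) u / tail F u) \<longlongrightarrow> l * exp (l * (mgf - 1))) at_top"
proof -
  obtain C D where CD: "\<And>k u. tail (conv_pow F k) u \<le> C * D ^ k * tail F u" "D \<ge> 0" "C \<ge> 0"
    using tail_conv_pow_bounded by blast
  have "((\<lambda>u. \<integral>k. tail (conv_pow F k) u / tail F u \<partial>poisson_pmf l) \<longlongrightarrow>
    (\<integral>k. real k * mgf ^ (k - 1) \<partial>poisson_pmf l)) at_top"
  proof (rule integral_dominated_convergence_at_top[where w="\<lambda>k. C * D ^ k"])
    show "integrable (poisson_pmf l) (\<lambda>k. C * D ^ k)"
      by (intro integrable_mult_right poisson_power l)
    show "\<forall>\<^sub>F u in at_top. AE k in poisson_pmf l. norm (tail (conv_pow F k) u / tail F u) \<le> C * D ^ k"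
      using CD(1) tail_pos by (intro always_eventually allI AE_I2) (auto simp: field_simps)
  qed (use tail_conv_pow_limit in auto)
  then show ?thesis
    unfolding poisson_weighted_power[OF l] by (simp add: measure_compound_poisson[OF rd_F l])
qed

text \<open>The tail of R is negligible against that of F, so R enters only through its moment,
  which recombines with \<open>exp (l * (mgf - 1))\<close> into the moment of the whole
  convolution.\<close>

lemma tail_compound_poisson_convolution_limit:
  assumes l: "l > 0" and R: "real_distribution R" "\<beta> > \<alpha>" "integrable R (\<lambda>x. exp (\<beta> * x))"
    and Ra: "integrable R (\<lambda>x. exp (\<alpha> * x))"
  shows "((\<lambda>u. tail (compound_poisson l F \<star> R) u / tail F u) \<longlongrightarrow>
      l * (\<integral>x. exp (\<alpha> * x) \<partial>(compound_poisson l F \<star> R))) at_top"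
    and "integrable (compound_poisson l F \<star> R) (\<lambda>x. exp (\<alpha> * x))"
proof -
  note cp = real_distribution_compound_poisson[OF rd_F l]
  note ecp = exp_moment_compound_poisson[OF rd_F l integrable_exp]
  show "integrable (compound_poisson l F \<star> R) (\<lambda>x. exp (\<alpha> * x))"
    by (rule exp_moment_convolution[OF cp R(1) ecp(1) Ra])
  have "((\<lambda>u. tail (compound_poisson l F \<star> R) u / tail F u) \<longlongrightarrow>
    l * exp (l * (mgf - 1)) * (\<integral>x. exp (\<alpha> * x) \<partial>R) + 0 * (\<integral>x. exp (\<alpha> * x) \<partial>compound_poisson l F)) at_top"
    by (intro tail_convolution_limit cp R tail_compound_poisson_limit l tail_negligible[OF R])
  then show "((\<lambda>u. tail (compound_poisson l F \<star> R) u / tail F u) \<longlongrightarrow>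
      l * (\<integral>x. exp (\<alpha> * x) \<partial>(compound_poisson l F \<star> R))) at_top"
    by (simp add: exp_moment_convolution[OF cp R(1) ecp(1) Ra] ecp(2) mgf_def mult.assoc)
qed

end

section \<open>Laws with a given Levy exponent\<close>

text \<open>Both signs of y follow from \<open>exp z - 1 \<le> z * exp z\<close>. The quadratic
  factor is what a measure with finite second moment can absorb.\<close>

lemma exp_minus_linear_le: "exp y - 1 - y \<le> y\<^sup>2 * exp \<bar>y\<bar>" for y :: real
proof -
  have *: "exp z - 1 \<le> z * exp z" for z :: real
  proof -
    have "exp z * (1 - z) \<le> exp z * exp (- z)"
      using exp_ge_add_one_self[of "- z"] by (intro mult_left_mono) auto
    then show ?thesis by (simp add: mult_exp_exp algebra_simps)
  qed
  have 1: "exp y - 1 - y \<le> y * (exp y - 1)" using *[of y] by (simp add: algebra_simps)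
  show ?thesis
  proof (cases "y \<ge> 0")
    case True
    have "y * (exp y - 1) \<le> y * (y * exp y)" using * True by (intro mult_left_mono)
    with 1 True show ?thesis by (simp add: power2_eq_square mult.assoc)
  next
    case False
    have "(- y) * (1 - exp y) \<le> (- y) * (- y)"
      using exp_ge_add_one_self[of y] False by (intro mult_left_mono) linarith+
    also have "\<dots> \<le> y\<^sup>2 * exp \<bar>y\<bar>" by (simp add: power2_eq_square mult_le_cancel_left1)
    finally show ?thesis using 1 by (simp add: algebra_simps)
  qed
qed

lemma norm_iexp_minus_1: "norm (iexp y - 1) \<le> 2"
  using norm_triangle_ineq4[of "iexp y" 1] by simp

lemma norm_iexp_minus_linear: "norm (iexp y - 1 - \<i> * complex_of_real y) \<le> y\<^sup>2"
proof -
  have "norm (iexp y - 1 - \<i> * complex_of_real y) * 2 \<le> y\<^sup>2"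
    using iexp_approx1[of y 1] by (simp add: algebra_simps fact_numeral power2_eq_square)
  then show ?thesis
    using norm_ge_zero[of "iexp y - 1 - \<i> * complex_of_real y"] by linarith
qed

lemma real_distribution_affine:
  assumes "real_distribution D"
  shows "real_distribution (distr D borel (\<lambda>x. s * x + b))"
proof -
  interpret D: real_distribution D by fact
  show ?thesis
    by (intro real_distribution.intro D.prob_space_distr) (auto simp: real_distribution_axioms_def)
qed

lemma char_affine:
  assumes "real_distribution D"
  shows "char (distr D borel (\<lambda>x. s * x + b)) \<theta> = iexp (\<theta> * b) * char D (s * \<theta>)"
proof -
  interpret D: real_distribution D by fact
  have "char (distr D borel (\<lambda>x. s * x + b)) \<theta> = (CLINT x|D. iexp (\<theta> * (s * x + b)))"
    unfolding char_def by (subst integral_distr) auto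
  also have "\<dots> = (CLINT x|D. iexp (\<theta> * b) * iexp (s * \<theta> * x))"
    by (intro Bochner_Integration.integral_cong) (auto simp: exp_add[symmetric] algebra_simps)
  finally show ?thesis by (simp add: char_def)
qed

lemma exp_moment_affine:
  fixes a :: real
  assumes "real_distribution D" "integrable D (\<lambda>x. exp (a * s * x))"
  shows "integrable (distr D borel (\<lambda>x. s * x + b)) (\<lambda>x. exp (a * x))"
    and "(\<integral>x. exp (a * x) \<partial>distr D borel (\<lambda>x. s * x + b)) = exp (a * b) * (\<integral>x. exp (a * s * x) \<partial>D)"
proof -
  interpret D: real_distribution D by fact
  have eq: "exp (a * (s * x + b)) = exp (a * b) * exp (a * s * x)" for x
    by (simp add: exp_add[symmetric] algebra_simps)
  show "integrable (distr D borel (\<lambda>x. s * x + b)) (\<lambda>x. exp (a * x))"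
    using assms(2) by (subst integrable_distr_eq) (auto simp: eq)
  show "(\<integral>x. exp (a * x) \<partial>distr D borel (\<lambda>x. s * x + b)) = exp (a * b) * (\<integral>x. exp (a * s * x) \<partial>D)"
    by (subst integral_distr) (auto simp: eq)
qed

lemma exp_moment_std_normal: "integrable std_normal_distribution (\<lambda>x. exp (a * x))"
proof -
  \<comment> \<open>Completing the square: the tilted density is a multiple of a shifted normal
    density.\<close>
  have "std_normal_density x * exp (a * x) = exp (a\<^sup>2 / 2) * normal_density a 1 x" for x
    by (simp add: normal_density_def mult_exp_exp power2_diff field_simps)
  then show ?thesis
    by (subst integrable_density) (auto intro!: integrable_mult_right)
qed

text \<open>The compound Poisson law whose intensity is the total mass of N and whose jump law is N
  normalised. Total mass zero is treated apart, since there is nothing to normalise; the point mass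
  at 0 serves.\<close>

lemma finite_jump_law:
  assumes "finite_measure N" and sN: "sets N = sets borel"
  obtains D where "real_distribution D"
    "\<And>\<theta>. char D \<theta> = exp (CLINT x|N. iexp (\<theta> * x) - 1)"
    "\<And>a. integrable N (\<lambda>x. exp (a * x)) \<Longrightarrow> integrable D (\<lambda>x. exp (a * x))"
    "\<And>a. integrable N (\<lambda>x. exp (a * x)) \<Longrightarrow> (\<integral>x. exp (a * x) \<partial>D) = exp (\<integral>x. exp (a * x) - 1 \<partial>N)"
proof (cases "measure N UNIV = 0")
  case True
  interpret N: finite_measure N by fact
  have [simp]: "space N = UNIV" using sets_eq_imp_space_eq[OF sN] by simp
  note [measurable_cong] = sN
  have em: "emeasure N (space N) = 0" using True by (simp add: N.emeasure_eq_measure)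
  then have AE0: "AE x in N. P x" for P
    by (intro AE_I'[of UNIV]) (auto simp: null_sets_def sN)
  have i0: "(\<integral>x. f x \<partial>N) = 0" for f :: "real \<Rightarrow> 'c::{banach, second_countable_topology}"
    by (rule integral_eq_zero_AE) (rule AE0)
  show ?thesis
  proof (rule that[OF real_distribution_return[of 0]])
    show "char (return borel 0) \<theta> = exp (CLINT x|N. iexp (\<theta> * x) - 1)" for \<theta>
      unfolding char_def by (simp add: integral_return i0)
    show "integrable (return borel 0) (\<lambda>x. exp (a * x))" for a :: real
      by (simp add: integrable_iff_bounded nn_integral_return)
    show "(\<integral>x. exp (a * x) \<partial>return borel 0) = exp (\<integral>x. exp (a * x) - 1 \<partial>N)" for a :: real
      by (simp add: integral_return i0)
  qed
next
  case False
  interpret N: finite_measure N by fact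
  have [simp]: "space N = UNIV" using sets_eq_imp_space_eq[OF sN] by simp
  note [measurable_cong] = sN
  define c where "c = measure N UNIV"
  have c: "c > 0" using False by (simp add: c_def less_le)
  define F where "F = density N (\<lambda>_. ennreal (1 / c))"
  have F_int: "integrable F f \<longleftrightarrow> integrable N f" "(\<integral>x. f x \<partial>F) = (\<integral>x. f x \<partial>N) /\<^sub>R c"
    if [measurable]: "f \<in> borel_measurable borel" for f :: "real \<Rightarrow> 'c::{banach, second_countable_topology}"
  proof -
    have "integrable F f \<longleftrightarrow> integrable N (\<lambda>x. (1 / c) *\<^sub>R f x)"
      unfolding F_def using c by (subst integrable_density) auto
    also have "\<dots> \<longleftrightarrow> integrable N f"
      using integrable_scaleR_right[of c N "\<lambda>x. (1 / c) *\<^sub>R f x"] c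
      by (auto intro: integrable_scaleR_right)
    finally show "integrable F f \<longleftrightarrow> integrable N f" .
    show "(\<integral>x. f x \<partial>F) = (\<integral>x. f x \<partial>N) /\<^sub>R c"
      unfolding F_def using c by (subst integral_density) (auto simp: divide_inverse)
  qed
  have "emeasure F (space F) = 1"
    unfolding F_def using c by (simp add: emeasure_density N.emeasure_eq_measure c_def[symmetric] ennreal_mult[symmetric])
  then have F: "real_distribution F"
    by (auto simp: real_distribution_def real_distribution_axioms_def F_def sN intro: prob_spaceI)
  interpret F: real_distribution F by fact
  show ?thesis
  proof (rule that[OF real_distribution_compound_poisson[OF F c]])
    fix \<theta>
    have int: "integrable N (\<lambda>x. iexp (\<theta> * x))"
      by (rule N.integrable_const_bound[where B=1]) auto
    have "of_real c * (char F \<theta> - 1) = (CLINT x|N. iexp (\<theta> * x)) - of_real c"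
      unfolding char_def using c by (simp add: F_int scaleR_conv_of_real algebra_simps)
    also have "\<dots> = (CLINT x|N. iexp (\<theta> * x) - 1)"
      using int by (simp add: c_def scaleR_conv_of_real)
    finally show "char (compound_poisson c F) \<theta> = exp (CLINT x|N. iexp (\<theta> * x) - 1)"
      by (simp add: char_compound_poisson[OF F c])
  next
    fix a :: real assume a: "integrable N (\<lambda>x. exp (a * x))"
    then have Fa: "integrable F (\<lambda>x. exp (a * x))" by (simp add: F_int)
    show "integrable (compound_poisson c F) (\<lambda>x. exp (a * x))"
      by (rule exp_moment_compound_poisson[OF F c Fa])
    have "c * ((\<integral>x. exp (a * x) \<partial>F) - 1) = (\<integral>x. exp (a * x) - 1 \<partial>N)"
      using a c by (simp add: F_int c_def[symmetric] algebra_simps)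
    then show "(\<integral>x. exp (a * x) \<partial>compound_poisson c F) = exp (\<integral>x. exp (a * x) - 1 \<partial>N)"
      by (simp add: exp_moment_compound_poisson[OF F c Fa])
  qed
qed

text \<open>
  A weak limit of compensated compound Poisson laws: exponential moments of both signs are bounded
  uniformly, which yields tightness and survives in the limit.
\<close>
lemma small_jump_law:
  fixes N :: "real measure"
  assumes sN: "sets N = sets borel" and sq: "integrable N (\<lambda>x. x\<^sup>2)" and bd: "AE x in N. \<bar>x\<bar> \<le> B"
  obtains Z where "real_distribution Z"
    "\<And>\<theta>. char Z \<theta> = exp (CLINT x|N. iexp (\<theta> * x) - 1 - \<i> * complex_of_real (\<theta> * x))"
    "\<And>a. integrable Z (\<lambda>x. exp (a * x))"
proof -
  note [measurable_cong] = sN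
  have [simp]: "space N = UNIV" using sets_eq_imp_space_eq[OF sN] by simp
  \<comment> \<open>Jumps larger than 1 / (n + 1) have finite total mass because N integrates the
    square of x.\<close>
  define E where "E n = {x::real. 1 / real (Suc n) < \<bar>x\<bar>}" for n
  have [measurable]: "E n \<in> sets borel" for n unfolding E_def by measurable
  define Nn where "Nn n = density N (indicator (E n))" for n
  have sNn [measurable_cong, simp]: "sets (Nn n) = sets borel" for n by (simp add: Nn_def sN)
  have Nn_int: "integrable (Nn n) f \<longleftrightarrow> integrable N (\<lambda>x. indicator (E n) x *\<^sub>R f x)"
    "(\<integral>x. f x \<partial>Nn n) = (\<integral>x. indicator (E n) x *\<^sub>R f x \<partial>N)"
    if [measurable]: "f \<in> borel_measurable borel" for n and f :: "real \<Rightarrow> 'c::{banach, second_countable_topology}"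
  proof -
    have *: "Nn n = density N (\<lambda>x. ennreal (indicator (E n) x))" unfolding Nn_def by (simp add: ennreal_indicator)
    show "integrable (Nn n) f \<longleftrightarrow> integrable N (\<lambda>x. indicator (E n) x *\<^sub>R f x)"
      unfolding * by (subst integrable_density) auto
    show "(\<integral>x. f x \<partial>Nn n) = (\<integral>x. indicator (E n) x *\<^sub>R f x \<partial>N)"
      unfolding * by (subst integral_density) auto
  qed
  have fin: "finite_measure (Nn n)" for n
  proof (rule finite_measureI)
    have "integrable N (\<lambda>x. indicator (E n) x *\<^sub>R (1::real))"
    proof (rule Bochner_Integration.integrable_bound[OF integrable_mult_right[OF sq, of "(real (Suc n))\<^sup>2"]])
      show "AE x in N. norm (indicator (E n) x *\<^sub>R (1::real)) \<le> norm ((real (Suc n))\<^sup>2 * x\<^sup>2)"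
      proof (rule AE_I2)
        fix x :: real
        have "1 \<le> (real (Suc n))\<^sup>2 * x\<^sup>2" if "x \<in> E n"
        proof -
          have "1 \<le> real (Suc n) * \<bar>x\<bar>" using that by (simp add: E_def field_simps)
          then have "1\<^sup>2 \<le> (real (Suc n) * \<bar>x\<bar>)\<^sup>2" by (intro power_mono) auto
          then show ?thesis by (simp add: power_mult_distrib)
        qed
        then show "norm (indicator (E n) x *\<^sub>R (1::real)) \<le> norm ((real (Suc n))\<^sup>2 * x\<^sup>2)"
          by (simp add: indicator_def)
      qed
    qed measurable
    then have "integrable (Nn n) (\<lambda>_. 1::real)" by (simp add: Nn_int)
    then show "emeasure (Nn n) (space (Nn n)) \<noteq> \<infinity>"
      by (simp add: integrable_iff_bounded)
  qed
  have AE_Nn: "AE x in Nn n. P x" if "AE x in N. P x" for n P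
    unfolding Nn_def using that by (subst AE_density) auto
  have intb: "integrable (Nn n) f" if [measurable]: "f \<in> borel_measurable borel"
    and "\<And>x. \<bar>x\<bar> \<le> B \<Longrightarrow> norm (f x) \<le> C" for n C and f :: "real \<Rightarrow> 'c::{banach, second_countable_topology}"
  proof (rule finite_measure.integrable_const_bound[OF fin, where B=C])
    show "AE x in Nn n. norm (f x) \<le> C" using AE_Nn[OF bd] by eventually_elim (rule that(2))
  qed measurable
  have "\<exists>D. \<forall>n. real_distribution (D n) \<and>
    (\<forall>\<theta>. char (D n) \<theta> = exp (CLINT x|Nn n. iexp (\<theta> * x) - 1)) \<and>
    (\<forall>a. integrable (Nn n) (\<lambda>x. exp (a * x)) \<longrightarrow> integrable (D n) (\<lambda>x. exp (a * x)) \<and>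
      (\<integral>x. exp (a * x) \<partial>D n) = exp (\<integral>x. exp (a * x) - 1 \<partial>Nn n))"
    by (rule choice, rule allI, rule finite_jump_law[OF fin sNn]) blast
  then obtain D where D: "\<And>n. real_distribution (D n)"
    "\<And>n \<theta>. char (D n) \<theta> = exp (CLINT x|Nn n. iexp (\<theta> * x) - 1)"
    "\<And>n a. integrable (Nn n) (\<lambda>x. exp (a * x)) \<Longrightarrow> integrable (D n) (\<lambda>x. exp (a * x))"
    "\<And>n a. integrable (Nn n) (\<lambda>x. exp (a * x)) \<Longrightarrow> (\<integral>x. exp (a * x) \<partial>D n) = exp (\<integral>x. exp (a * x) - 1 \<partial>Nn n)"
    by blast
  \<comment> \<open>Subtracting the mean is the compensation: it moves the linear term into the
    integral in the exponent, whose integrand is then bounded by a quadratic, so that the limit in n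
    exists.\<close>
  define Z where "Z n = distr (D n) borel (\<lambda>x. 1 * x + (- (\<integral>x. x \<partial>Nn n)))" for n
  have Z: "real_distribution (Z n)" for n unfolding Z_def by (rule real_distribution_affine[OF D(1)])
  have int_id: "integrable (Nn n) (\<lambda>x. x)" for n by (rule intb[of _ B]) auto
  have charZ: "char (Z n) \<theta> = exp (CLINT x|N. indicator (E n) x *\<^sub>R (iexp (\<theta> * x) - 1 - \<i> * complex_of_real (\<theta> * x)))" for n \<theta>
  proof -
    have "integrable (Nn n) (\<lambda>x. iexp (\<theta> * x) - 1)"
      by (rule intb[of _ 2], measurable) (rule norm_iexp_minus_1)
    moreover have "integrable (Nn n) (\<lambda>x. \<i> * complex_of_real (\<theta> * x))"
      using int_id by (intro integrable_mult_right integrable_of_real) auto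
    ultimately have eq: "(CLINT x|Nn n. iexp (\<theta> * x) - 1 - \<i> * complex_of_real (\<theta> * x)) =
      (CLINT x|Nn n. iexp (\<theta> * x) - 1) - \<i> * complex_of_real (\<theta> * (\<integral>x. x \<partial>Nn n))"
      by (subst Bochner_Integration.integral_diff) auto
    have "char (Z n) \<theta> = exp (\<i> * complex_of_real (\<theta> * - (\<integral>x. x \<partial>Nn n)) + (CLINT x|Nn n. iexp (\<theta> * x) - 1))"
      unfolding Z_def char_affine[OF D(1)] D(2) exp_add by simp
    also have "\<dots> = exp (CLINT x|Nn n. iexp (\<theta> * x) - 1 - \<i> * complex_of_real (\<theta> * x))"
      unfolding eq by (rule arg_cong[where f=exp]) simp
    also have "\<dots> = exp (CLINT x|N. indicator (E n) x *\<^sub>R (iexp (\<theta> * x) - 1 - \<i> * complex_of_real (\<theta> * x)))"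
      by (subst Nn_int(2)) auto
    finally show ?thesis .
  qed
  have lim: "(\<lambda>n. char (Z n) \<theta>) \<longlonglongrightarrow> exp (CLINT x|N. iexp (\<theta> * x) - 1 - \<i> * complex_of_real (\<theta> * x))" for \<theta>
    unfolding charZ
  proof (intro tendsto_exp integral_dominated_convergence[where w="\<lambda>x. (\<theta> * x)\<^sup>2"])
    show "integrable N (\<lambda>x. (\<theta> * x)\<^sup>2)" using sq by (simp add: power_mult_distrib)
    show "AE x in N. (\<lambda>n. indicator (E n) x *\<^sub>R (iexp (\<theta> * x) - 1 - \<i> * complex_of_real (\<theta> * x))) \<longlonglongrightarrow>
      iexp (\<theta> * x) - 1 - \<i> * complex_of_real (\<theta> * x)"
    proof (rule AE_I2)
      fix x
      show "(\<lambda>n. indicator (E n) x *\<^sub>R (iexp (\<theta> * x) - 1 - \<i> * complex_of_real (\<theta> * x))) \<longlonglongrightarrow>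
        iexp (\<theta> * x) - 1 - \<i> * complex_of_real (\<theta> * x)"
      proof (cases "x = 0")
        case False
        then have "\<forall>\<^sub>F n in sequentially. 1 / real (Suc n) < \<bar>x\<bar>"
          using order_tendstoD(2)[OF LIMSEQ_inverse_real_of_nat, of "\<bar>x\<bar>"] by (simp add: inverse_eq_divide)
        then show ?thesis
          by (intro tendsto_eventually) (auto elim!: eventually_mono simp: E_def)
      qed simp
    qed
    show "AE x in N. norm (indicator (E n) x *\<^sub>R (iexp (\<theta> * x) - 1 - \<i> * complex_of_real (\<theta> * x))) \<le> (\<theta> * x)\<^sup>2" for n
    proof (rule AE_I2)
      fix x
      show "norm (indicator (E n) x *\<^sub>R (iexp (\<theta> * x) - 1 - \<i> * complex_of_real (\<theta> * x))) \<le> (\<theta> * x)\<^sup>2"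
        using norm_iexp_minus_linear[of "\<theta> * x"] by (cases "x \<in> E n") simp_all
    qed
  qed measurable
  define V where "V = (\<integral>x. x\<^sup>2 \<partial>N)"
  \<comment> \<open>A bound for the moment of order a that does not depend on n:
    \<open>exp_minus_linear_le\<close> at \<open>a * x\<close>, with
    \<open>\<bar>x\<bar> \<le> B\<close> in the exponential factor.\<close>
  define K where "K a = exp (a\<^sup>2 * exp (\<bar>a\<bar> * B) * V)" for a
  have moment: "integrable (Z n) (\<lambda>x. exp (a * x))" "(\<integral>x. exp (a * x) \<partial>Z n) \<le> K a" for n a
  proof -
    have ie: "integrable (Nn n) (\<lambda>x. exp (a * x))"
    proof (rule intb[of _ "exp (\<bar>a\<bar> * B)"])
      fix x :: real assume "\<bar>x\<bar> \<le> B"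
      then have "\<bar>a\<bar> * \<bar>x\<bar> \<le> \<bar>a\<bar> * B" by (intro mult_left_mono) auto
      then have "a * x \<le> \<bar>a\<bar> * B" by (metis abs_mult abs_ge_self order_trans)
      then show "norm (exp (a * x)) \<le> exp (\<bar>a\<bar> * B)" by simp
    qed measurable
    show "integrable (Z n) (\<lambda>x. exp (a * x))"
      unfolding Z_def using D(3)[OF ie] by (intro exp_moment_affine D(1)) simp
    have i1: "integrable (Nn n) (\<lambda>x. 1::real)" by (rule intb[of _ 1]) auto
    have i2: "integrable (Nn n) (\<lambda>x. a * x)" using int_id by simp
    note iall = Bochner_Integration.integrable_diff[OF Bochner_Integration.integrable_diff[OF ie i1] i2]
    have eq: "(\<integral>x. exp (a * x) - 1 - a * x \<partial>Nn n) = (\<integral>x. exp (a * x) - 1 \<partial>Nn n) - a * (\<integral>x. x \<partial>Nn n)"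
      by (subst Bochner_Integration.integral_diff[OF Bochner_Integration.integrable_diff[OF ie i1] i2]) simp
    have ie': "integrable (Nn n) (\<lambda>x. exp (a * 1 * x))" using ie by simp
    have "(\<integral>x. exp (a * x) \<partial>Z n) = exp (a * - (\<integral>x. x \<partial>Nn n)) * exp (\<integral>x. exp (a * x) - 1 \<partial>Nn n)"
      unfolding Z_def exp_moment_affine(2)[OF D(1) D(3)[OF ie']] using D(4)[OF ie] by simp
    also have "\<dots> = exp (\<integral>x. exp (a * x) - 1 - a * x \<partial>Nn n)"
      unfolding eq exp_add[symmetric] by (rule arg_cong[where f=exp]) simp
    also have "(\<integral>x. exp (a * x) - 1 - a * x \<partial>Nn n) \<le> (\<integral>x. a\<^sup>2 * exp (\<bar>a\<bar> * B) * x\<^sup>2 \<partial>N)"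
      unfolding Nn_int(2)[of "\<lambda>x. exp (a * x) - 1 - a * x", simplified]
    proof (rule integral_mono_AE)
      show "integrable N (\<lambda>x. indicator (E n) x * (exp (a * x) - 1 - a * x))"
        using iall by (subst (asm) Nn_int(1)) auto
      show "integrable N (\<lambda>x. a\<^sup>2 * exp (\<bar>a\<bar> * B) * x\<^sup>2)" using sq by simp
      show "AE x in N. indicator (E n) x * (exp (a * x) - 1 - a * x) \<le> a\<^sup>2 * exp (\<bar>a\<bar> * B) * x\<^sup>2"
        using bd
      proof eventually_elim
        case (elim x)
        have "exp (a * x) - 1 - a * x \<le> (a * x)\<^sup>2 * exp \<bar>a * x\<bar>" by (rule exp_minus_linear_le)
        also have "\<dots> \<le> (a * x)\<^sup>2 * exp (\<bar>a\<bar> * B)"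
          using elim by (intro mult_left_mono) (auto simp: abs_mult intro: mult_left_mono)
        finally have "exp (a * x) - 1 - a * x \<le> a\<^sup>2 * exp (\<bar>a\<bar> * B) * x\<^sup>2" by (simp add: power_mult_distrib algebra_simps)
        then show ?case by (auto simp: indicator_def)
      qed
    qed
    also have "\<dots> = a\<^sup>2 * exp (\<bar>a\<bar> * B) * V" by (simp add: V_def)
    finally show "(\<integral>x. exp (a * x) \<partial>Z n) \<le> K a" by (simp add: K_def)
  qed
  have "tight Z"
    unfolding tight_def
  proof (intro conjI allI impI Z)
    fix \<epsilon> :: real assume "\<epsilon> > 0"
    \<comment> \<open>Two-sided Chernoff bound: outside the interval,
      \<open>exp x + exp (- x)\<close> is at least \<open>exp b\<close>.\<close>
    have "((\<lambda>b. exp (- b) * (K 1 + K (-1))) \<longlongrightarrow> 0 * (K 1 + K (-1))) at_top"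
      by (intro tendsto_mult tendsto_const filterlim_compose[OF exp_at_bot filterlim_uminus_at_bot_at_top])
    then have "\<forall>\<^sub>F b in at_top. exp (- b) * (K 1 + K (-1)) < \<epsilon>"
      using \<open>\<epsilon> > 0\<close> by (intro order_tendstoD) auto
    then have "\<forall>\<^sub>F b in at_top. exp (- b) * (K 1 + K (-1)) < \<epsilon> \<and> b > 0"
      using eventually_gt_at_top[of 0] by eventually_elim auto
    then obtain b :: real where b: "exp (- b) * (K 1 + K (-1)) < \<epsilon>" "b > 0"
      by (auto simp: eventually_at_top_linorder)
    have "measure (Z n) {-b<..b} > 1 - \<epsilon>" for n
    proof -
      interpret Zn: real_distribution "Z n" by (rule Z)
      have "measure (Z n) (UNIV - {-b<..b}) = (\<integral>x. indicator (UNIV - {-b<..b}) x \<partial>Z n)" by simp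
      also have "\<dots> \<le> (\<integral>x. exp (- b) * (exp (1 * x) + exp ((-1) * x)) \<partial>Z n)"
      proof (rule integral_mono)
        show "integrable (Z n) (\<lambda>x. exp (- b) * (exp (1 * x) + exp ((-1) * x)))"
          by (intro integrable_mult_right Bochner_Integration.integrable_add moment)
        show "integrable (Z n) (indicat_real (UNIV - {-b<..b}))"
          by (rule Zn.integrable_const_bound[where B=1]) (auto simp: indicator_def)
        fix x :: real
        show "indicat_real (UNIV - {-b<..b}) x \<le> exp (- b) * (exp (1 * x) + exp ((-1) * x))"
        proof (cases "x \<in> {-b<..b}")
          case False
          then have "1 \<le> exp (x - b) \<or> 1 \<le> exp (- x - b)" by auto
          then have "1 \<le> exp (x - b) + exp (- x - b)" by (smt (verit) exp_gt_zero)
          moreover have "- b + 1 * x = x - b" "- b + (-1) * x = - x - b" by auto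
          ultimately show ?thesis using False by (simp only: distrib_left mult_exp_exp) simp
        qed simp
      qed
      also have "\<dots> = exp (- b) * ((\<integral>x. exp (1 * x) \<partial>Z n) + (\<integral>x. exp ((-1) * x) \<partial>Z n))"
        using moment(1)[of n 1] moment(1)[of n "-1"] by simp
      also have "\<dots> \<le> exp (- b) * (K 1 + K (-1))"
        by (intro mult_left_mono add_mono moment) auto
      also note b(1)
      finally show ?thesis
        using Zn.prob_compl[of "{-b<..b}"] by simp
    qed
    then show "\<exists>a b. a < b \<and> (\<forall>n. 1 - \<epsilon> < measure (Z n) {a<..b})"
      using b(2) by (intro exI[of _ "-b"] exI[of _ b]) auto
  qed
  from tight_imp_convergent_subsubsequence[OF this strict_mono_id]
  obtain r Y where r: "strict_mono r" and Y: "real_distribution Y" and conv: "weak_conv_m (Z \<circ> id \<circ> r) Y"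
    by blast
  have conv': "weak_conv_m (\<lambda>n. Z (r n)) Y" using conv by (simp add: o_def)
  show ?thesis
  proof (rule that[OF Y])
    fix \<theta>
    have "(\<lambda>n. char (Z (r n)) \<theta>) \<longlonglongrightarrow> char Y \<theta>"
      by (rule levy_continuity1[OF Z Y conv'])
    moreover have "(\<lambda>n. char (Z (r n)) \<theta>) \<longlonglongrightarrow> exp (CLINT x|N. iexp (\<theta> * x) - 1 - \<i> * complex_of_real (\<theta> * x))"
      using LIMSEQ_subseq_LIMSEQ[OF lim r] by (simp add: o_def)
    ultimately show "char Y \<theta> = exp (CLINT x|N. iexp (\<theta> * x) - 1 - \<i> * complex_of_real (\<theta> * x))"
      by (rule LIMSEQ_unique)
  next
    fix a :: real
    interpret Y: real_distribution Y by (rule Y)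
    \<comment> \<open>Weak convergence passes only bounded continuous functions, hence the cap at k;
      monotone convergence under the bound \<open>K a\<close> removes it.\<close>
    let ?f = "\<lambda>(k::nat) x. min (exp (a * x)) (real k)"
    have int: "integrable Y (?f k)" for k
      by (rule Y.integrable_const_bound[where B="real k"]) auto
    have le: "(\<integral>x. ?f k x \<partial>Y) \<le> K a" for k
    proof (rule LIMSEQ_le_const2)
      show "(\<lambda>n. \<integral>x. ?f k x \<partial>Z (r n)) \<longlonglongrightarrow> (\<integral>x. ?f k x \<partial>Y)"
        by (rule weak_conv_imp_integral_bdd_continuous_conv[OF Z Y conv', where B="real k"])
           (auto intro!: continuous_intros)
      show "\<exists>M. \<forall>n\<ge>M. (\<integral>x. ?f k x \<partial>Z (r n)) \<le> K a"
      proof (intro exI allI impI)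
        fix n
        interpret Zn: real_distribution "Z (r n)" by (rule Z)
        have "(\<integral>x. ?f k x \<partial>Z (r n)) \<le> (\<integral>x. exp (a * x) \<partial>Z (r n))"
          by (intro integral_mono moment Zn.integrable_const_bound[where B="real k"]) auto
        then show "(\<integral>x. ?f k x \<partial>Z (r n)) \<le> K a" using moment(2)[of "r n" a] by linarith
      qed
    qed
    have mono: "mono (\<lambda>k. integral\<^sup>L Y (?f k))"
      by (intro monoI integral_mono int) auto
    obtain l where l: "(\<lambda>k. integral\<^sup>L Y (?f k)) \<longlonglongrightarrow> l"
      using incseq_convergent[OF mono, of "K a"] le by blast
    show "integrable Y (\<lambda>x. exp (a * x))"
    proof (rule integrable_monotone_convergence[OF int _ _ l])
      show "AE x in Y. (\<lambda>k. ?f k x) \<longlonglongrightarrow> exp (a * x)"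
      proof (rule AE_I2, rule tendsto_eventually)
        fix x :: real
        show "\<forall>\<^sub>F k in sequentially. ?f k x = exp (a * x)"
          using eventually_ge_at_top[of "nat \<lceil>exp (a * x)\<rceil>"]
          by eventually_elim (auto simp: min_def nat_le_iff ceiling_le_iff)
      qed
      show "AE x in Y. mono (\<lambda>k. ?f k x)" by (intro AE_I2 monoI) auto
    qed measurable
  qed
qed

section \<open>The marginals of a Levy process\<close>

locale levy_exponent =
  fixes LM :: "real measure" and \<gamma> \<sigma>2 :: real
  assumes sets_LM [measurable_cong, simp]: "sets LM = sets borel"
    and fin_LM: "(\<integral>\<^sup>+x. ennreal (min 1 (x\<^sup>2)) \<partial>LM) < \<infinity>"
    and \<sigma>2_nonneg: "0 \<le> \<sigma>2"
begin

lemma space_LM [simp]: "space LM = UNIV"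
  using sets_eq_imp_space_eq[OF sets_LM] by simp

definition eta :: "real \<Rightarrow> complex" where
  "eta \<theta> = \<i> * complex_of_real (\<gamma> * \<theta>) - complex_of_real (\<sigma>2 * \<theta>\<^sup>2 / 2) +
     (CLINT x|LM. iexp (\<theta> * x) - 1 - \<i> * complex_of_real (\<theta> * x * indicator {-1<..<1} x))"

lemma integrable_LM_bound:
  fixes f :: "real \<Rightarrow> 'b::{banach, second_countable_topology}"
  assumes [measurable]: "f \<in> borel_measurable borel" and bd: "\<And>x. norm (f x) \<le> C * min 1 (x\<^sup>2)"
  shows "integrable LM f"
proof -
  have "integrable LM (\<lambda>x. min 1 (x\<^sup>2))"
    using fin_LM by (intro integrableI_nonneg) auto
  then have int: "integrable LM (\<lambda>x. C * min 1 (x\<^sup>2))" by (rule integrable_mult_right)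
  show ?thesis
    by (rule Bochner_Integration.integrable_bound[OF int]) (use bd in \<open>auto intro: order_trans[OF _ abs_ge_self]\<close>)
qed

text \<open>The factor t is time in \<open>remainder_law\<close>; with \<open>t = 1 / l\<close> the
  same object later serves as the normalised law of the large jumps.\<close>

definition jumps :: "real \<Rightarrow> real set \<Rightarrow> real measure" where
  "jumps t A = density LM (\<lambda>x. ennreal (t * indicator A x))"

lemma sets_jumps [measurable_cong, simp]: "sets (jumps t A) = sets borel"
  by (simp add: jumps_def)

lemma integral_jumps:
  fixes f :: "real \<Rightarrow> 'b::{banach, second_countable_topology}"
  assumes [measurable]: "A \<in> sets borel" "f \<in> borel_measurable borel" and t: "t \<ge> 0"
  shows "integrable LM (\<lambda>x. indicator A x *\<^sub>R f x) \<Longrightarrow> integrable (jumps t A) f"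
    and "(\<integral>x. f x \<partial>jumps t A) = t *\<^sub>R (\<integral>x. indicator A x *\<^sub>R f x \<partial>LM)"
proof -
  assume "integrable LM (\<lambda>x. indicator A x *\<^sub>R f x)"
  then have "integrable LM (\<lambda>x. t *\<^sub>R (indicator A x *\<^sub>R f x))" by (rule integrable_scaleR_right)
  then show "integrable (jumps t A) f"
    unfolding jumps_def using t by (subst integrable_density) auto
next
  have "(\<integral>x. f x \<partial>jumps t A) = (\<integral>x. (t * indicator A x) *\<^sub>R f x \<partial>LM)"
    unfolding jumps_def using t by (subst integral_density) auto
  then show "(\<integral>x. f x \<partial>jumps t A) = t *\<^sub>R (\<integral>x. indicator A x *\<^sub>R f x \<partial>LM)"
    by (simp flip: scaleR_scaleR)
qed

lemma min_away_from_0: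
  fixes x C \<delta> :: real
  assumes "0 < \<delta>" "\<delta> \<le> \<bar>x\<bar>"
  shows "C \<le> \<bar>C\<bar> / min 1 (\<delta>\<^sup>2) * min 1 (x\<^sup>2)"
proof -
  have "\<delta>\<^sup>2 \<le> \<bar>x\<bar>\<^sup>2" using assms by (intro power_mono) auto
  then have "min 1 (\<delta>\<^sup>2) \<le> min 1 (x\<^sup>2)" by auto
  then have "\<bar>C\<bar> / min 1 (\<delta>\<^sup>2) * min 1 (\<delta>\<^sup>2) \<le> \<bar>C\<bar> / min 1 (\<delta>\<^sup>2) * min 1 (x\<^sup>2)"
    by (intro mult_left_mono) auto
  moreover have "\<bar>C\<bar> / min 1 (\<delta>\<^sup>2) * min 1 (\<delta>\<^sup>2) = \<bar>C\<bar>" using assms by (simp add: min_def)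
  ultimately show ?thesis by linarith
qed

lemma integrable_LM_away_from_0:
  fixes f :: "real \<Rightarrow> 'b::{banach, second_countable_topology}"
  assumes [measurable]: "A \<in> sets borel" "f \<in> borel_measurable borel"
    and \<delta>: "0 < \<delta>" "\<And>x. x \<in> A \<Longrightarrow> \<delta> \<le> \<bar>x\<bar>" and bd: "\<And>x. x \<in> A \<Longrightarrow> norm (f x) \<le> C"
  shows "integrable LM (\<lambda>x. indicator A x *\<^sub>R f x)"
proof (rule integrable_LM_bound[where C="\<bar>C\<bar> / min 1 (\<delta>\<^sup>2)"])
  fix x
  show "norm (indicator A x *\<^sub>R f x) \<le> \<bar>C\<bar> / min 1 (\<delta>\<^sup>2) * min 1 (x\<^sup>2)"
    using bd[of x] \<delta>(2)[of x] min_away_from_0[OF \<delta>(1), of x C] by (cases "x \<in> A") auto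
qed measurable

lemma integrable_LM_near_0:
  fixes f :: "real \<Rightarrow> 'b::{banach, second_countable_topology}"
  assumes [measurable]: "A \<in> sets borel" "f \<in> borel_measurable borel"
    and B: "\<And>x. x \<in> A \<Longrightarrow> \<bar>x\<bar> \<le> B" and C: "0 \<le> C" and bd: "\<And>x. x \<in> A \<Longrightarrow> norm (f x) \<le> C * x\<^sup>2"
  shows "integrable LM (\<lambda>x. indicator A x *\<^sub>R f x)"
proof (rule integrable_LM_bound[where C="C * max 1 (B\<^sup>2)"])
  fix x
  show "norm (indicator A x *\<^sub>R f x) \<le> C * max 1 (B\<^sup>2) * min 1 (x\<^sup>2)"
  proof (cases "x \<in> A")
    case True
    have "\<bar>x\<bar>\<^sup>2 \<le> B\<^sup>2" using B[OF True] by (intro power_mono) auto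
    then have "x\<^sup>2 \<le> max 1 (B\<^sup>2) * min 1 (x\<^sup>2)" 
      by (cases "x\<^sup>2 \<le> 1") (auto simp: min_def max_def mult_le_cancel_right1)
    then have "C * x\<^sup>2 \<le> C * (max 1 (B\<^sup>2) * min 1 (x\<^sup>2))" using C by (intro mult_left_mono)
    with bd[OF True] True show ?thesis by (simp add: mult.assoc)
  qed (use C in \<open>simp add: min_def max_def\<close>)
qed measurable

lemma finite_jumps:
  assumes [measurable]: "A \<in> sets borel" and \<delta>: "0 < \<delta>" "\<And>x. x \<in> A \<Longrightarrow> \<delta> \<le> \<bar>x\<bar>" and t: "t \<ge> 0"
  shows "finite_measure (jumps t A)"
proof (rule finite_measureI)
  have "integrable (jumps t A) (\<lambda>_. 1::real)"
    by (rule integral_jumps(1)[OF _ _ t], measurable)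
       (rule integrable_LM_away_from_0[OF _ _ \<delta>, where C=1], auto)
  then show "emeasure (jumps t A) (space (jumps t A)) \<noteq> \<infinity>"
    by (simp add: integrable_iff_bounded)
qed

text \<open>R is the convolution of a Gaussian law with drift, a compound Poisson law of the jumps
  at most -1, and the compensated law of the jumps in (-1, x0]. Unbounded downward jumps restrict
  the exponential moments to \<open>0 \<le> a\<close>. The product form avoids dividing
  characteristic functions.\<close>

lemma remainder_law:
  assumes x0: "0 < x0" and t: "0 \<le> t"
  obtains R where "real_distribution R" "\<And>a. 0 \<le> a \<Longrightarrow> integrable R (\<lambda>x. exp (a * x))"
    "\<And>\<theta>. exp (complex_of_real t * (CLINT x|LM. indicator {x0<..} x *\<^sub>R (iexp (\<theta> * x) - 1))) * char R \<theta>
      = exp (complex_of_real t * eta \<theta>)"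
proof -
  let ?A = "{..-1::real}" and ?S = "{-1<..x0}" and ?B = "{x0<..}"
  let ?i = "\<lambda>x. indicator {-1<..<1::real} x :: real"
  have finA: "finite_measure (jumps t ?A)"
    by (rule finite_jumps[where \<delta>=1]) (use t in auto)
  obtain D where D: "real_distribution D"
    "\<And>\<theta>. char D \<theta> = exp (CLINT x|jumps t ?A. iexp (\<theta> * x) - 1)"
    "\<And>a. integrable (jumps t ?A) (\<lambda>x. exp (a * x)) \<Longrightarrow> integrable D (\<lambda>x. exp (a * x))"
    by (rule finite_jump_law[OF finA sets_jumps]) blast
  have sq: "integrable (jumps t ?S) (\<lambda>x. x\<^sup>2)"
    by (rule integral_jumps(1)[OF _ _ t], measurable)
       (rule integrable_LM_near_0[where B="max 1 x0" and C=1], auto)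
  have bd: "AE x in jumps t ?S. \<bar>x\<bar> \<le> max 1 x0"
    unfolding jumps_def by (subst AE_density) (auto simp: indicator_def)
  obtain Z where Z: "real_distribution Z"
    "\<And>\<theta>. char Z \<theta> = exp (CLINT x|jumps t ?S. iexp (\<theta> * x) - 1 - \<i> * complex_of_real (\<theta> * x))"
    "\<And>a. integrable Z (\<lambda>x. exp (a * x))"
    by (rule small_jump_law[OF sets_jumps sq bd]) blast
  \<comment> \<open>Corrections for different compensation ranges: \<open>eta\<close> compensates
    jumps in (-1, 1), \<open>Z\<close> those in (-1, x0]. The term \<open>b1\<close> concerns jumps
    in [1, x0] and \<open>b2\<close> jumps in (x0, 1), so at most one of them is nonzero.\<close>
  define b1 where "b1 = (\<integral>x. indicator ?S x *\<^sub>R (x * (1 - ?i x)) \<partial>LM)"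
  define b2 where "b2 = (\<integral>x. indicator ?B x *\<^sub>R (x * ?i x) \<partial>LM)"
  define b where "b = t * (\<gamma> + b1 - b2)"
  define W where "W = distr std_normal_distribution borel (\<lambda>x. sqrt (t * \<sigma>2) * x + b)"
  have W: "real_distribution W" unfolding W_def by (rule real_distribution_affine[OF real_dist_normal_dist])
  have WD: "real_distribution (W \<star> D)" by (rule real_distribution_convolution[OF W D(1)])
  show ?thesis
  proof (rule that)
    show R: "real_distribution ((W \<star> D) \<star> Z)"
      by (rule real_distribution_convolution[OF WD Z(1)])
    show "integrable ((W \<star> D) \<star> Z) (\<lambda>x. exp (a * x))" if "0 \<le> a" for a
    proof (intro exp_moment_convolution WD W D(1) Z(1) Z(3) D(3))
      show "integrable W (\<lambda>x. exp (a * x))"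
        unfolding W_def by (intro exp_moment_affine real_dist_normal_dist exp_moment_std_normal)
      show "integrable (jumps t ?A) (\<lambda>x. exp (a * x))"
      proof (rule integral_jumps(1)[OF _ _ t])
        show "integrable LM (\<lambda>x. indicator ?A x *\<^sub>R exp (a * x))"
          by (rule integrable_LM_away_from_0[where \<delta>=1 and C=1])
             (use that in \<open>auto simp: mult_nonneg_nonpos\<close>)
      qed auto
    qed
    fix \<theta>
    let ?e = "\<lambda>x. iexp (\<theta> * x) - 1" and ?l = "\<lambda>x. \<i> * complex_of_real (\<theta> * x)"
    let ?J = "\<lambda>x. ?e x - \<i> * complex_of_real (\<theta> * x * ?i x)"
    have iA: "integrable LM (\<lambda>x. indicator ?A x *\<^sub>R ?e x)"
    proof (rule integrable_LM_away_from_0[where \<delta>=1 and C=2])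
      show "norm (?e x) \<le> 2" for x by (rule norm_iexp_minus_1)
    qed auto
    have iB: "integrable LM (\<lambda>x. indicator ?B x *\<^sub>R ?e x)"
    proof (rule integrable_LM_away_from_0[where \<delta>=x0 and C=2])
      show "norm (?e x) \<le> 2" for x by (rule norm_iexp_minus_1)
    qed (use x0 in auto)
    have iS: "integrable LM (\<lambda>x. indicator ?S x *\<^sub>R (?e x - ?l x))"
    proof (rule integrable_LM_near_0[where B="max 1 x0" and C="\<theta>\<^sup>2"])
      show "norm (?e x - ?l x) \<le> \<theta>\<^sup>2 * x\<^sup>2" for x
        using norm_iexp_minus_linear[of "\<theta> * x"] by (simp only: power_mult_distrib)
    qed auto
    have i1: "integrable LM (\<lambda>x. indicator ?S x *\<^sub>R (x * (1 - ?i x)))"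
      by (rule integrable_LM_near_0[where B="max 1 x0" and C=1], measurable)
         (auto simp: indicator_def power2_eq_square)
    have i2: "integrable LM (\<lambda>x. indicator ?B x *\<^sub>R (x * ?i x))"
      by (rule integrable_LM_away_from_0[where \<delta>=x0 and C=1]) (use x0 in \<open>auto simp: indicator_def\<close>)
    have "(CLINT x|LM. ?J x) = (CLINT x|LM. indicator ?A x *\<^sub>R ?e x + indicator ?B x *\<^sub>R ?e x
      + indicator ?S x *\<^sub>R (?e x - ?l x) + \<i> * complex_of_real \<theta> * complex_of_real (indicator ?S x *\<^sub>R (x * (1 - ?i x)))
      - \<i> * complex_of_real \<theta> * complex_of_real (indicator ?B x *\<^sub>R (x * ?i x)))"
    proof (intro Bochner_Integration.integral_cong refl)
      fix x
      consider "x \<in> ?A" | "x \<in> ?S" | "x \<in> ?B" by fastforce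
      then show "?J x = indicator ?A x *\<^sub>R ?e x + indicator ?B x *\<^sub>R ?e x
        + indicator ?S x *\<^sub>R (?e x - ?l x) + \<i> * complex_of_real \<theta> * complex_of_real (indicator ?S x *\<^sub>R (x * (1 - ?i x)))
        - \<i> * complex_of_real \<theta> * complex_of_real (indicator ?B x *\<^sub>R (x * ?i x))"
        using x0 by cases (auto simp: algebra_simps indicator_def)
    qed
    also have "\<dots> = (CLINT x|LM. indicator ?A x *\<^sub>R ?e x) + (CLINT x|LM. indicator ?B x *\<^sub>R ?e x)
      + (CLINT x|LM. indicator ?S x *\<^sub>R (?e x - ?l x)) + \<i> * complex_of_real \<theta> * complex_of_real b1
      - \<i> * complex_of_real \<theta> * complex_of_real b2"
      unfolding b1_def b2_def integral_complex_of_real[symmetric] integral_mult_right_zero[symmetric]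
      by (intro has_bochner_integral_integral_eq has_bochner_integral_add has_bochner_integral_diff
        has_bochner_integral_integrable iA iB iS integrable_mult_right integrable_of_real i1 i2)
    finally have J: "(CLINT x|LM. ?J x) = (CLINT x|LM. indicator ?A x *\<^sub>R ?e x) + (CLINT x|LM. indicator ?B x *\<^sub>R ?e x)
      + (CLINT x|LM. indicator ?S x *\<^sub>R (?e x - ?l x)) + \<i> * complex_of_real \<theta> * complex_of_real b1
      - \<i> * complex_of_real \<theta> * complex_of_real b2" .
    have cD: "char D \<theta> = exp (complex_of_real t * (CLINT x|LM. indicator ?A x *\<^sub>R ?e x))"
      unfolding D(2) by (subst integral_jumps(2)[OF _ _ t]) (auto simp: scaleR_conv_of_real)
    have cZ: "char Z \<theta> = exp (complex_of_real t * (CLINT x|LM. indicator ?S x *\<^sub>R (?e x - ?l x)))"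
      unfolding Z(2) by (subst integral_jumps(2)[OF _ _ t]) (auto simp: scaleR_conv_of_real)
    have "(sqrt (t * \<sigma>2) * \<theta>)\<^sup>2 = t * \<sigma>2 * \<theta>\<^sup>2"
      using t \<sigma>2_nonneg by (simp add: power_mult_distrib)
    then have cW: "char W \<theta> = exp (\<i> * complex_of_real (\<theta> * b) + complex_of_real (- (t * \<sigma>2 * \<theta>\<^sup>2) / 2))"
      unfolding W_def char_affine[OF real_dist_normal_dist] char_std_normal_distribution exp_add exp_of_real
      by (simp only:)
    have "exp (complex_of_real t * (CLINT x|LM. indicator {x0<..} x *\<^sub>R ?e x)) * char ((W \<star> D) \<star> Z) \<theta> =
      exp (complex_of_real t * (CLINT x|LM. indicator {x0<..} x *\<^sub>R ?e x) +
        ((\<i> * complex_of_real (\<theta> * b) + complex_of_real (- (t * \<sigma>2 * \<theta>\<^sup>2) / 2)) +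
         complex_of_real t * (CLINT x|LM. indicator ?A x *\<^sub>R ?e x) +
         complex_of_real t * (CLINT x|LM. indicator ?S x *\<^sub>R (?e x - ?l x))))"
      unfolding char_convolution[OF WD Z(1)] char_convolution[OF W D(1)] cD cZ cW exp_add ..
    also have "\<dots> = exp (complex_of_real t * eta \<theta>)"
      unfolding eta_def J by (rule arg_cong[where f=exp]) (simp add: b_def algebra_simps)
    finally show "exp (complex_of_real t * (CLINT x|LM. indicator {x0<..} x *\<^sub>R ?e x)) * char ((W \<star> D) \<star> Z) \<theta> =
      exp (complex_of_real t * eta \<theta>)" .
  qed
qed

end

section \<open>Characteristic functions at all times\<close>

locale levy = prob_space M for M :: "'a measure" +
  fixes X :: "real \<Rightarrow> 'a \<Rightarrow> real"
  assumes levy_process: "levy_process M X"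
begin

lemma X_measurable [measurable]: "t \<ge> 0 \<Longrightarrow> X t \<in> borel_measurable M"
  using levy_process by (auto simp: levy_process_def)

lemma X_0: "\<omega> \<in> space M \<Longrightarrow> X 0 \<omega> = 0"
  using levy_process by (auto simp: levy_process_def)

lemma X_right_continuous: "\<omega> \<in> space M \<Longrightarrow> t \<ge> 0 \<Longrightarrow> continuous (at_right t) (\<lambda>s. X s \<omega>)"
  using levy_process by (auto simp: levy_process_def)

lemma X_left_limit: "\<omega> \<in> space M \<Longrightarrow> t > 0 \<Longrightarrow> \<exists>l. ((\<lambda>s. X s \<omega>) \<longlongrightarrow> l) (at_left t)"
  using levy_process by (auto simp: levy_process_def)

lemma indep_increments:
  "0 \<le> t 0 \<Longrightarrow> (\<And>i. i < n \<Longrightarrow> t i \<le> t (Suc i)) \<Longrightarrow>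
    indep_vars (\<lambda>_. borel) (\<lambda>i \<omega>. X (t (Suc i)) \<omega> - X (t i) \<omega>) {..<n::nat}"
  using levy_process unfolding levy_process_def by blast

lemma stationary_increments:
  "0 \<le> s \<Longrightarrow> s \<le> t \<Longrightarrow> distr M borel (\<lambda>\<omega>. X t \<omega> - X s \<omega>) = distr M borel (X (t - s))"
  using levy_process by (auto simp: levy_process_def)

abbreviation law :: "real \<Rightarrow> real measure" where
  "law t \<equiv> distr M borel (X t)"

lemma real_distribution_law: "t \<ge> 0 \<Longrightarrow> real_distribution (law t)"
  by (intro real_distribution.intro prob_space_distr X_measurable) (auto simp: real_distribution_axioms_def)

lemma indep_increment:
  assumes "0 \<le> s" "s \<le> t"
  shows "indep_var borel (\<lambda>\<omega>. X s \<omega> - X 0 \<omega>) borel (\<lambda>\<omega>. X t \<omega> - X s \<omega>)"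
proof -
  \<comment> \<open>Independence is given for chains of times; the chain 0, s, t yields the two
    increments.\<close>
  define \<tau> where "\<tau> = (\<lambda>i::nat. if i = 0 then 0 else if i = 1 then s else t)"
  have "indep_vars (\<lambda>_. borel) (\<lambda>i \<omega>. X (\<tau> (Suc i)) \<omega> - X (\<tau> i) \<omega>) {..<2}"
    by (rule indep_increments) (use assms in \<open>auto simp: \<tau>_def\<close>)
  also have "{..<2::nat} = insert 0 {1}" by auto
  finally have "indep_var borel (\<lambda>\<omega>. X (\<tau> (Suc 0)) \<omega> - X (\<tau> 0) \<omega>) borel
    (\<lambda>\<omega>. \<Sum>i\<in>{1::nat}. X (\<tau> (Suc i)) \<omega> - X (\<tau> i) \<omega>)"
    by (intro indep_vars_sum) auto
  then show ?thesis by (simp add: \<tau>_def)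
qed

lemma law_add:
  assumes "0 \<le> s" "0 \<le> t"
  shows "law (s + t) = (law s \<star> law t)"
proof -
  have "law (s + t) = distr M borel (\<lambda>\<omega>. (X s \<omega> - X 0 \<omega>) + (X (s + t) \<omega> - X s \<omega>))"
    by (intro distr_cong) (auto simp: X_0)
  also have "\<dots> = (distr M borel (\<lambda>\<omega>. X s \<omega> - X 0 \<omega>) \<star> distr M borel (\<lambda>\<omega>. X (s + t) \<omega> - X s \<omega>))"
    using assms by (intro sum_indep_random_variable indep_increment) auto
  also have "distr M borel (\<lambda>\<omega>. X (s + t) \<omega> - X s \<omega>) = law t"
    using assms by (subst stationary_increments) auto
  also have "distr M borel (\<lambda>\<omega>. X s \<omega> - X 0 \<omega>) = law s"
    using assms by (subst stationary_increments) auto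
  finally show ?thesis .
qed

lemma char_law_add:
  "0 \<le> s \<Longrightarrow> 0 \<le> t \<Longrightarrow> char (law (s + t)) \<theta> = char (law s) \<theta> * char (law t) \<theta>"
  by (simp add: law_add char_convolution real_distribution_law)

lemma char_law_0: "char (law 0) \<theta> = 1"
proof -
  have "char (law 0) \<theta> = (CLINT \<omega>|M. iexp (\<theta> * X 0 \<omega>))"
    unfolding char_def by (subst integral_distr) auto
  also have "\<dots> = (CLINT \<omega>|M. 1)" by (intro Bochner_Integration.integral_cong) (auto simp: X_0)
  finally show ?thesis using prob_space by simp
qed

lemma char_law_mult:
  assumes "0 \<le> s"
  shows "char (law (real k * s)) \<theta> = char (law s) \<theta> ^ k"
proof (induction k)
  case (Suc k)
  have "char (law (real (Suc k) * s)) \<theta> = char (law (s + real k * s)) \<theta>" by (simp add: algebra_simps)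
  also have "\<dots> = char (law s) \<theta> * char (law (real k * s)) \<theta>"
    by (rule char_law_add) (use assms in auto)
  finally show ?case using Suc by simp
qed (simp add: char_law_0)

text \<open>Floor plus one keeps the approximation strictly above t, where right continuity of the
  paths applies. The result is a multiple of 1 / (n + 1), so the characteristic function there is a
  power of the one at 1 / (n + 1).\<close>

definition rat_above :: "real \<Rightarrow> nat \<Rightarrow> real" where
  "rat_above t n = (of_int \<lfloor>t * real (Suc n)\<rfloor> + 1) / real (Suc n)"

lemma rat_above: "t < rat_above t n" "rat_above t n \<le> t + 1 / real (Suc n)"
proof -
  have N: "0 < real (Suc n)" by simp
  show "t < rat_above t n"
    unfolding rat_above_def pos_less_divide_eq[OF N] by linarith
  have "rat_above t n \<le> (t * real (Suc n) + 1) / real (Suc n)"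
    unfolding rat_above_def by (rule divide_right_mono) (linarith, simp)
  then show "rat_above t n \<le> t + 1 / real (Suc n)"
    using N by (simp add: add_divide_distrib del: of_nat_Suc)
qed

lemma rat_above_tendsto: "rat_above t \<longlonglongrightarrow> t"
proof (rule tendsto_sandwich[OF _ _ tendsto_const])
  show "\<forall>\<^sub>F n in sequentially. t \<le> rat_above t n" by (intro always_eventually allI less_imp_le rat_above)
  show "\<forall>\<^sub>F n in sequentially. rat_above t n \<le> t + inverse (real (Suc n))"
    using rat_above(2) by (intro always_eventually allI) (simp add: inverse_eq_divide)
  show "(\<lambda>n. t + inverse (real (Suc n))) \<longlonglongrightarrow> t"
    using tendsto_add[OF tendsto_const LIMSEQ_inverse_real_of_nat, of t] by simp
qed

lemma rat_above_form:
  assumes "t \<ge> 0" obtains k where "rat_above t n = real k * (1 / real (Suc n))"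
proof -
  have "0 \<le> \<lfloor>t * real (Suc n)\<rfloor>" using assms by simp
  then obtain k where "\<lfloor>t * real (Suc n)\<rfloor> = int k" using zero_le_imp_eq_int by blast
  then show ?thesis by (intro that[of "Suc k"]) (simp add: rat_above_def)
qed

lemma X_rat_above:
  assumes "\<omega> \<in> space M" "t \<ge> 0"
  shows "(\<lambda>n. X (rat_above t n) \<omega>) \<longlonglongrightarrow> X t \<omega>"
proof -
  have "((\<lambda>s. X s \<omega>) \<longlongrightarrow> X t \<omega>) (at_right t)"
    using X_right_continuous[OF assms] by (simp add: continuous_within)
  moreover have "filterlim (rat_above t) (at_right t) sequentially"
    unfolding filterlim_at using rat_above(1) rat_above_tendsto
    by (auto intro!: always_eventually simp: less_imp_neq[THEN not_sym] )
  ultimately show ?thesis by (rule filterlim_compose)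
qed

lemma char_law_rat_above:
  assumes "t \<ge> 0"
  shows "(\<lambda>n. char (law (rat_above t n)) \<theta>) \<longlonglongrightarrow> char (law t) \<theta>"
proof -
  have nn: "0 \<le> rat_above t n" for n using rat_above(1)[of t n] assms by linarith
  have eq: "char (law s) \<theta> = (CLINT \<omega>|M. iexp (\<theta> * X s \<omega>))" if "s \<ge> 0" for s
    unfolding char_def using that by (subst integral_distr) auto
  have "(\<lambda>n. CLINT \<omega>|M. iexp (\<theta> * X (rat_above t n) \<omega>)) \<longlonglongrightarrow> (CLINT \<omega>|M. iexp (\<theta> * X t \<omega>))"
  proof (rule integral_dominated_convergence[where w="\<lambda>_. 1"])
    show "AE \<omega> in M. (\<lambda>n. iexp (\<theta> * X (rat_above t n) \<omega>)) \<longlonglongrightarrow> iexp (\<theta> * X t \<omega>)"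
      by (intro AE_I2 tendsto_intros X_rat_above assms)
  qed (use assms nn in auto)
  then show ?thesis using eq assms nn by simp
qed

text \<open>The \<open>n\<close>-th roots of the characteristic function of \<open>X 1\<close> are identified by continuity in \<open>\<theta>\<close>.\<close>
lemma char_law:
  assumes 1: "\<And>\<theta>. char (law 1) \<theta> = exp (\<eta> \<theta>)"
    and D: "\<And>t. t > 0 \<Longrightarrow> real_distribution (D t)"
      "\<And>t \<theta>. t > 0 \<Longrightarrow> char (D t) \<theta> = exp (complex_of_real t * \<eta> \<theta>)"
    and t: "t \<ge> 0"
  shows "char (law t) \<theta> = exp (complex_of_real t * \<eta> \<theta>)"
proof -
  have root: "char (law (1 / real (Suc n))) \<theta> = exp (complex_of_real (1 / real (Suc n)) * \<eta> \<theta>)" for n \<theta>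
  proof -
    let ?h = "1 / real (Suc n)"
    have h: "?h > 0" by simp
    interpret L: real_distribution "law ?h" by (rule real_distribution_law) simp
    interpret Dh: real_distribution "D ?h" by (rule D(1)[OF h])
    \<comment> \<open>Both characteristic functions are roots of order n + 1 of the same
      nonvanishing function. Their ratio is continuous with values in a finite set of roots of
      unity, hence constant, and it equals 1 at 0.\<close>
    define r where "r \<theta> = char (law ?h) \<theta> / char (D ?h) \<theta>" for \<theta>
    have nz: "char (D ?h) \<theta> \<noteq> 0" for \<theta> by (simp only: D(2)[OF h] exp_not_eq_zero not_False_eq_True)
    have cont: "continuous_on UNIV r"
      unfolding r_def using L.isCont_char Dh.isCont_char nz
      by (intro continuous_on_divide) (auto simp: continuous_at_imp_continuous_on)
    have "char (law ?h) \<theta> ^ Suc n = exp (\<eta> \<theta>)" for \<theta>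
      using char_law_mult[of ?h "Suc n" \<theta>] 1 by simp
    moreover have "char (D ?h) \<theta> ^ Suc n = exp (\<eta> \<theta>)" for \<theta>
      unfolding D(2)[OF h] exp_of_nat_mult[symmetric] by (simp del: of_nat_Suc)
    ultimately have "r \<theta> ^ Suc n = 1" for \<theta>
      unfolding r_def power_divide by simp
    then have "range r \<subseteq> {z. z ^ Suc n = 1}" by auto
    then have "finite (range r)"
      by (rule finite_subset) (rule finite_roots_unity, simp)
    then have "r constant_on UNIV"
      by (intro continuous_finite_range_constant cont) auto
    then have "r \<theta> = r 0" by (auto simp: constant_on_def)
    also have "r 0 = 1" unfolding r_def L.char_zero Dh.char_zero by simp
    finally have "char (law ?h) \<theta> = char (D ?h) \<theta>" using nz[of \<theta>] by (simp add: r_def)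
    then show ?thesis by (simp only: D(2)[OF h])
  qed
  \<comment> \<open>Multiples of 1 / (n + 1) follow by taking powers; t itself is then approached
    from the right.\<close>
  have rat: "char (law (rat_above t n)) \<theta> = exp (complex_of_real (rat_above t n) * \<eta> \<theta>)" for n
  proof -
    obtain k where k: "rat_above t n = real k * (1 / real (Suc n))"
      using rat_above_form[OF t] by blast
    have "char (law (rat_above t n)) \<theta> = exp (complex_of_real (1 / real (Suc n)) * \<eta> \<theta>) ^ k"
      unfolding k by (subst char_law_mult) (simp_all only: root, simp)
    also have "\<dots> = exp (complex_of_real (rat_above t n) * \<eta> \<theta>)"
      unfolding k exp_of_nat_mult[symmetric] by (simp add: mult.assoc)
    finally show ?thesis .
  qed
  have "(\<lambda>n. exp (complex_of_real (rat_above t n) * \<eta> \<theta>)) \<longlonglongrightarrow> exp (complex_of_real t * \<eta> \<theta>)"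
    by (intro tendsto_intros rat_above_tendsto)
  with char_law_rat_above[OF t, of \<theta>] show ?thesis
    unfolding rat by (rule LIMSEQ_unique)
qed

end

section \<open>Suprema over grids and intervals\<close>

context levy
begin

abbreviation crosses :: "real \<Rightarrow> real \<Rightarrow> 'a set" where
  "crosses u T \<equiv> {\<omega> \<in> space M. \<exists>t\<in>{0..T}. u < X t \<omega>}"

abbreviation crosses_before :: "real \<Rightarrow> real \<Rightarrow> 'a set" where
  "crosses_before u T \<equiv> {\<omega> \<in> space M. \<exists>t\<in>{0<..<T}. u < X t \<omega>}"

abbreviation stays_above :: "real \<Rightarrow> real \<Rightarrow> 'a set" where
  "stays_above \<epsilon> s \<equiv> {\<omega> \<in> space M. - \<epsilon> \<le> X s \<omega>}"

text \<open>Measured relative to the value at s, so that its law does not depend on s and the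
  recursion can restart at s + h.\<close>

definition grid_max :: "real \<Rightarrow> real \<Rightarrow> nat \<Rightarrow> 'a \<Rightarrow> real" where
  "grid_max s h k \<omega> = Max ((\<lambda>i. X (s + real i * h) \<omega> - X s \<omega>) ` {..k})"

text \<open>The recursion for grid maxima written for laws, so that limits of convolution tails
  apply to it directly.\<close>

primrec max_law :: "real \<Rightarrow> nat \<Rightarrow> real measure" where
  "max_law h 0 = return borel 0"
| "max_law h (Suc k) = distr (law h \<star> max_law h k) borel (max 0)"

lemma grid_max_measurable [measurable]:
  "0 \<le> s \<Longrightarrow> 0 \<le> h \<Longrightarrow> grid_max s h k \<in> borel_measurable M"
  unfolding grid_max_def by (intro borel_measurable_Max) auto

text \<open>Lindley's recursion: the point i = 0 contributes the 0, and all later points share the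
  first increment.\<close>

lemma grid_max_Suc:
  "grid_max s h (Suc k) \<omega> = max 0 ((X (s + h) \<omega> - X s \<omega>) + grid_max (s + h) h k \<omega>)"
proof -
  let ?f = "\<lambda>i. X (s + real i * h) \<omega> - X s \<omega>"
  let ?g = "\<lambda>i. X (s + h + real i * h) \<omega> - X (s + h) \<omega>"
  have "?f ` {..Suc k} = insert 0 ((\<lambda>i. ?f (Suc i)) ` {..k})"
    by (subst atMost_Suc_eq_insert_0) (simp add: image_image)
  also have "(\<lambda>i. ?f (Suc i)) ` {..k} = (\<lambda>y. (X (s + h) \<omega> - X s \<omega>) + y) ` (?g ` {..k})"
    by (auto simp: image_image algebra_simps)
  finally have "grid_max s h (Suc k) \<omega> = Max (insert 0 ((\<lambda>y. (X (s + h) \<omega> - X s \<omega>) + y) ` (?g ` {..k})))"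
    by (simp add: grid_max_def)
  also have "\<dots> = max 0 (Max ((\<lambda>y. (X (s + h) \<omega> - X s \<omega>) + y) ` (?g ` {..k})))"
    by (rule Max_insert) auto
  also have "Max ((\<lambda>y. (X (s + h) \<omega> - X s \<omega>) + y) ` (?g ` {..k})) = (X (s + h) \<omega> - X s \<omega>) + Max (?g ` {..k})"
    by (rule mono_Max_commute[symmetric]) (auto intro: monoI)
  finally show ?thesis by (simp add: grid_max_def)
qed

lemma sum_increments: "(\<Sum>j<i. X (f (Suc j)) \<omega> - X (f j) \<omega>) = X (f i) \<omega> - X (f 0) \<omega>"
  by (rule sum_lessThan_telescope)

text \<open>The remaining maximum is the maximum of partial sums of increments 1 to k only;
  increment 0 is the one split off.\<close>

lemma indep_grid_max:
  assumes "0 \<le> s" "0 \<le> h"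
  shows "indep_var borel (\<lambda>\<omega>. X (s + h) \<omega> - X s \<omega>) borel (grid_max (s + h) h k)"
proof -
  let ?\<tau> = "\<lambda>i. s + real i * h"
  let ?\<Delta> = "\<lambda>i \<omega>. X (?\<tau> (Suc i)) \<omega> - X (?\<tau> i) \<omega>"
  let ?F = "\<lambda>f::nat \<Rightarrow> real. Max ((\<lambda>i. \<Sum>j\<in>{1..i}. f j) ` {..k})"
  have "indep_vars (\<lambda>_. borel) ?\<Delta> {..<Suc k}"
    by (rule indep_increments[where t="?\<tau>"]) (use assms in \<open>auto simp: algebra_simps\<close>)
  then have A: "indep_var (Pi\<^sub>M {0} (\<lambda>_. borel)) (\<lambda>\<omega>. restrict (\<lambda>i. ?\<Delta> i \<omega>) {0})
    (Pi\<^sub>M {1..k} (\<lambda>_. borel)) (\<lambda>\<omega>. restrict (\<lambda>i. ?\<Delta> i \<omega>) {1..k})"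
    by (rule indep_var_restrict) auto
  have B: "?F \<in> borel_measurable (Pi\<^sub>M {1..k} (\<lambda>_. borel))"
    by (intro borel_measurable_Max borel_measurable_sum measurable_component_singleton) auto
  have "indep_var borel ((\<lambda>f. f 0) \<circ> (\<lambda>\<omega>. restrict (\<lambda>i. ?\<Delta> i \<omega>) {0}))
    borel (?F \<circ> (\<lambda>\<omega>. restrict (\<lambda>i. ?\<Delta> i \<omega>) {1..k}))"
    by (rule indep_var_compose[OF A _ B]) simp
  also have "(\<lambda>f. f 0) \<circ> (\<lambda>\<omega>. restrict (\<lambda>i. ?\<Delta> i \<omega>) {0}) = (\<lambda>\<omega>. X (s + h) \<omega> - X s \<omega>)"
    by auto
  also have "?F \<circ> (\<lambda>\<omega>. restrict (\<lambda>i. ?\<Delta> i \<omega>) {1..k}) = grid_max (s + h) h k"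
  proof
    fix \<omega>
    have "(\<Sum>j\<in>{1..i}. restrict (\<lambda>i. ?\<Delta> i \<omega>) {1..k} j) = X (s + h + real i * h) \<omega> - X (s + h) \<omega>" if "i \<le> k" for i
    proof -
      have "(\<Sum>j\<in>{1..i}. restrict (\<lambda>i. ?\<Delta> i \<omega>) {1..k} j) = (\<Sum>j\<in>{1..i}. ?\<Delta> j \<omega>)"
        using that by (intro sum.cong) auto
      also have "\<dots> = (\<Sum>j<i. ?\<Delta> (Suc j) \<omega>)"
        using sum.atLeast1_atMost_eq[of "\<lambda>j. ?\<Delta> j \<omega>" i] by simp
      also have "\<dots> = X (?\<tau> (Suc i)) \<omega> - X (?\<tau> 1) \<omega>"
        using sum_increments[where f="\<lambda>j. ?\<tau> (Suc j)"] by simp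
      finally show ?thesis by (simp add: algebra_simps)
    qed
    then show "(?F \<circ> (\<lambda>\<omega>. restrict (\<lambda>i. ?\<Delta> i \<omega>) {1..k})) \<omega> = grid_max (s + h) h k \<omega>"
      by (simp add: grid_max_def cong: image_cong_simp)
  qed
  finally show ?thesis .
qed

lemma distr_grid_max:
  assumes "0 \<le> s" "0 \<le> h"
  shows "distr M borel (grid_max s h k) = max_law h k"
  using assms(1)
proof (induction k arbitrary: s)
  case 0
  have "distr M borel (grid_max s h 0) = distr M borel (\<lambda>_. 0)"
    by (rule distr_cong) (auto simp: grid_max_def)
  then show ?case by (simp add: distr_const)
next
  case (Suc k)
  let ?Y = "\<lambda>\<omega>. X (s + h) \<omega> - X s \<omega>"
  have "distr M borel (grid_max s h (Suc k)) = distr M borel (\<lambda>\<omega>. max 0 (?Y \<omega> + grid_max (s + h) h k \<omega>))"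
    by (rule distr_cong) (auto simp: grid_max_Suc)
  also have "\<dots> = distr (distr M borel (\<lambda>\<omega>. ?Y \<omega> + grid_max (s + h) h k \<omega>)) borel (max 0)"
    using Suc.prems assms(2) by (subst distr_distr) (auto simp: comp_def)
  also have "distr M borel (\<lambda>\<omega>. ?Y \<omega> + grid_max (s + h) h k \<omega>) = (distr M borel ?Y \<star> distr M borel (grid_max (s + h) h k))"
    using Suc.prems assms(2) by (intro sum_indep_random_variable indep_grid_max) auto
  also have "distr M borel ?Y = law h"
    using Suc.prems assms(2) by (subst stationary_increments) auto
  also have "distr M borel (grid_max (s + h) h k) = max_law h k"
    using Suc.prems assms(2) by (intro Suc.IH) auto
  finally show ?case by simp
qed

lemma real_distribution_max_law: "0 \<le> h \<Longrightarrow> real_distribution (max_law h k)"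
  using distr_grid_max[of 0 h k, symmetric]
  by (auto simp: real_distribution_def real_distribution_axioms_def intro!: prob_space_distr)

lemma tail_max_law:
  assumes "0 \<le> h"
  shows "tail (max_law h k) u = prob {\<omega> \<in> space M. \<exists>i\<le>k. u < X (real i * h) \<omega>}"
proof -
  have "tail (max_law h k) u = prob (grid_max 0 h k -` {u<..} \<inter> space M)"
    unfolding distr_grid_max[of 0 h k, OF order_refl assms, symmetric] using assms by (subst measure_distr) auto
  also have "grid_max 0 h k -` {u<..} \<inter> space M = {\<omega> \<in> space M. \<exists>i\<le>k. u < X (real i * h) \<omega>}"
    by (auto simp: grid_max_def X_0 Max_gr_iff)
  finally show ?thesis .
qed

lemma integral_max_law:
  fixes f :: "real \<Rightarrow> real"
  assumes "0 \<le> h" and [measurable]: "f \<in> borel_measurable borel"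
  shows "(\<integral>x. f x \<partial>max_law h k) = (\<integral>\<omega>. f (grid_max 0 h k \<omega>) \<partial>M)"
  unfolding distr_grid_max[of 0 h k, OF order_refl assms(1), symmetric] using assms
  by (subst integral_distr) auto

text \<open>First passage at index j is determined by the increments up to j, and the later move is
  one further increment, whose law depends only on its length.\<close>

lemma first_passage_indep:
  assumes "0 < d"
  shows "prob {\<omega> \<in> space M. (u < X (real j * d) \<omega> \<and> (\<forall>i<j. X (real i * d) \<omega> \<le> u)) \<and> - \<epsilon> \<le> X (real (j + r) * d) \<omega> - X (real j * d) \<omega>}
    = prob {\<omega> \<in> space M. u < X (real j * d) \<omega> \<and> (\<forall>i<j. X (real i * d) \<omega> \<le> u)}
      * prob (stays_above \<epsilon> (real r * d))"
proof -
  \<comment> \<open>A chain that follows the grid up to j and then covers r grid steps at once,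
    which makes the later move a single increment.\<close>
  let ?\<tau> = "\<lambda>i. if i \<le> j then real i * d else real (j + r) * d"
  let ?\<Delta> = "\<lambda>i \<omega>. X (?\<tau> (Suc i)) \<omega> - X (?\<tau> i) \<omega>"
  let ?F = "\<lambda>f::nat \<Rightarrow> real. (if u < (\<Sum>l<j. f l) \<and> (\<forall>i\<in>{..<j}. (\<Sum>l<i. f l) \<le> u) then 1 else 0 :: real)"
  have "indep_vars (\<lambda>_. borel) ?\<Delta> {..<Suc j}"
    by (rule indep_increments[where t="?\<tau>"]) (use assms in \<open>auto simp: not_le less_Suc_eq\<close>)
  then have A: "indep_var (Pi\<^sub>M {..<j} (\<lambda>_. borel)) (\<lambda>\<omega>. restrict (\<lambda>i. ?\<Delta> i \<omega>) {..<j})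
    (Pi\<^sub>M {j} (\<lambda>_. borel)) (\<lambda>\<omega>. restrict (\<lambda>i. ?\<Delta> i \<omega>) {j})"
    by (rule indep_var_restrict) auto
  have B: "?F \<in> borel_measurable (Pi\<^sub>M {..<j} (\<lambda>_. borel))"
  proof -
    have [measurable]: "(\<lambda>f. \<Sum>l<i. f l) \<in> borel_measurable (Pi\<^sub>M {..<j} (\<lambda>_. borel::real measure))" if "i \<le> j" for i
      using that by (intro borel_measurable_sum measurable_component_singleton) auto
    have [measurable]: "(\<lambda>f. \<Sum>l<i. f l) \<in> borel_measurable (Pi\<^sub>M {..<j} (\<lambda>_. borel::real measure))" if "i \<in> {..<j}" for i
      using that by (intro borel_measurable_sum measurable_component_singleton) auto
    show ?thesis by measurable
  qed
  have "indep_var borel (?F \<circ> (\<lambda>\<omega>. restrict (\<lambda>i. ?\<Delta> i \<omega>) {..<j}))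
    borel ((\<lambda>f. f j) \<circ> (\<lambda>\<omega>. restrict (\<lambda>i. ?\<Delta> i \<omega>) {j}))"
    by (rule indep_var_compose[OF A B]) simp
  from indep_varD[OF this, of "{1}" "{- \<epsilon>..}"]
  have *: "prob ((\<lambda>x. ((?F \<circ> (\<lambda>\<omega>. restrict (\<lambda>i. ?\<Delta> i \<omega>) {..<j})) x, ((\<lambda>f. f j) \<circ> (\<lambda>\<omega>. restrict (\<lambda>i. ?\<Delta> i \<omega>) {j})) x)) -` ({1} \<times> {- \<epsilon>..}) \<inter> space M) =
    prob ((?F \<circ> (\<lambda>\<omega>. restrict (\<lambda>i. ?\<Delta> i \<omega>) {..<j})) -` {1} \<inter> space M) *
    prob (((\<lambda>f. f j) \<circ> (\<lambda>\<omega>. restrict (\<lambda>i. ?\<Delta> i \<omega>) {j})) -` {- \<epsilon>..} \<inter> space M)"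
    by simp
  have S: "(\<Sum>l<i. restrict (\<lambda>i. ?\<Delta> i \<omega>) {..<j} l) = X (real i * d) \<omega>" if "i \<le> j" "\<omega> \<in> space M" for i \<omega>
  proof -
    have "(\<Sum>l<i. restrict (\<lambda>i. ?\<Delta> i \<omega>) {..<j} l) = (\<Sum>l<i. ?\<Delta> l \<omega>)"
      using that by (intro sum.cong) auto
    also have "\<dots> = X (?\<tau> i) \<omega> - X (?\<tau> 0) \<omega>"
      by (rule sum_increments)
    finally show ?thesis using that X_0 by simp
  qed
  have F: "(?F \<circ> (\<lambda>\<omega>. restrict (\<lambda>i. ?\<Delta> i \<omega>) {..<j})) \<omega> = 1 \<longleftrightarrow> u < X (real j * d) \<omega> \<and> (\<forall>i<j. X (real i * d) \<omega> \<le> u)"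
    if "\<omega> \<in> space M" for \<omega>
    using that S by auto
  have r: "((\<lambda>f. f j) \<circ> (\<lambda>\<omega>. restrict (\<lambda>i. ?\<Delta> i \<omega>) {j})) \<omega> = X (real (j + r) * d) \<omega> - X (real j * d) \<omega>" for \<omega>
    by simp
  have "prob {\<omega> \<in> space M. - \<epsilon> \<le> X (real (j + r) * d) \<omega> - X (real j * d) \<omega>} = measure (distr M borel (\<lambda>\<omega>. X (real (j + r) * d) \<omega> - X (real j * d) \<omega>)) {- \<epsilon>..}"
    using assms by (subst measure_distr) (auto intro!: arg_cong[where f=prob])
  also have "\<dots> = measure (law (real (j + r) * d - real j * d)) {- \<epsilon>..}"
    using assms by (subst stationary_increments) auto
  also have "real (j + r) * d - real j * d = real r * d" by (simp add: algebra_simps)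
  also have "measure (law (real r * d)) {- \<epsilon>..} = prob (stays_above \<epsilon> (real r * d))"
    using assms by (subst measure_distr) (auto intro!: arg_cong[where f=prob])
  finally have R: "prob {\<omega> \<in> space M. - \<epsilon> \<le> X (real (j + r) * d) \<omega> - X (real j * d) \<omega>} = prob (stays_above \<epsilon> (real r * d))" .
  have s1: "(\<lambda>x. ((?F \<circ> (\<lambda>\<omega>. restrict (\<lambda>i. ?\<Delta> i \<omega>) {..<j})) x, ((\<lambda>f. f j) \<circ> (\<lambda>\<omega>. restrict (\<lambda>i. ?\<Delta> i \<omega>) {j})) x)) -` ({1} \<times> {- \<epsilon>..}) \<inter> space M
    = {\<omega> \<in> space M. (u < X (real j * d) \<omega> \<and> (\<forall>i<j. X (real i * d) \<omega> \<le> u)) \<and> - \<epsilon> \<le> X (real (j + r) * d) \<omega> - X (real j * d) \<omega>}"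
    using F r by (auto simp del: comp_apply)
  have s2: "(?F \<circ> (\<lambda>\<omega>. restrict (\<lambda>i. ?\<Delta> i \<omega>) {..<j})) -` {1} \<inter> space M
    = {\<omega> \<in> space M. u < X (real j * d) \<omega> \<and> (\<forall>i<j. X (real i * d) \<omega> \<le> u)}"
    using F by (auto simp del: comp_apply)
  have s3: "((\<lambda>f. f j) \<circ> (\<lambda>\<omega>. restrict (\<lambda>i. ?\<Delta> i \<omega>) {j})) -` {- \<epsilon>..} \<inter> space M
    = {\<omega> \<in> space M. - \<epsilon> \<le> X (real (j + r) * d) \<omega> - X (real j * d) \<omega>}"
    using r by (auto simp del: comp_apply)
  show ?thesis using * unfolding s1 s2 s3 R .
qed

text \<open>Ottaviani's argument: after passing \<open>u\<close> on the fine grid, the process is unlikely to drop by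
  \<open>\<epsilon>\<close> before the next point of the coarse grid.\<close>
lemma grid_maximal_inequality:
  assumes d: "0 < d" and N: "0 < N"
    and small: "\<And>r. r \<le> N \<Longrightarrow> 1 - \<delta> \<le> prob (stays_above \<epsilon> (real r * d))"
  shows "prob {\<omega> \<in> space M. \<exists>i\<le>n * N. u < X (real i * d) \<omega>} * (1 - \<delta>) \<le>
    prob {\<omega> \<in> space M. \<exists>k\<le>n. u - \<epsilon> < X (real k * (real N * d)) \<omega>}"
proof -
  \<comment> \<open>\<open>k j\<close> is the index of the first coarse grid point not before the
    fine point j, and \<open>r j\<close>, at most N, counts the fine steps to it.\<close>
  define k where "k j = (j + N - 1) div N" for j
  define r where "r j = k j * N - j" for j
  have k: "j \<le> k j * N" "k j * N < j + N" for j
  proof -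
    have "(j + N - 1) mod N < N" using N by simp
    moreover have "j + N - 1 = k j * N + (j + N - 1) mod N" unfolding k_def by simp
    ultimately show "j \<le> k j * N" "k j * N < j + N" using N by linarith+
  qed
  have r: "j + r j = k j * N" "r j \<le> N" for j using k[of j] by (auto simp: r_def)
  have kn: "k j \<le> n" if "j \<le> n * N" for j
  proof (rule ccontr)
    assume "\<not> k j \<le> n"
    then have "Suc n * N \<le> k j * N" by (intro mult_right_mono) auto
    then show False using k(2)[of j] that by simp
  qed
  define E where "E j = {\<omega> \<in> space M. u < X (real j * d) \<omega> \<and> (\<forall>i<j. X (real i * d) \<omega> \<le> u)}" for j
  define G where "G j = {\<omega> \<in> space M. (u < X (real j * d) \<omega> \<and> (\<forall>i<j. X (real i * d) \<omega> \<le> u)) \<and> - \<epsilon> \<le> X (real (j + r j) * d) \<omega> - X (real j * d) \<omega>}" for j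
  have [measurable]: "X (real i * d) \<in> borel_measurable M" "X (real i * (real N * d)) \<in> borel_measurable M" for i
    using d by auto
  have [measurable]: "E j \<in> events" "G j \<in> events" for j
    unfolding E_def G_def by measurable
  have disjE: "disjoint_family_on E {..n * N}"
    unfolding disjoint_family_on_def E_def by (auto, metis linorder_neqE_nat not_less)
  have disjG: "disjoint_family_on G {..n * N}"
    unfolding disjoint_family_on_def G_def by (auto, metis linorder_neqE_nat not_less)
  have UE: "{\<omega> \<in> space M. \<exists>i\<le>n * N. u < X (real i * d) \<omega>} = (\<Union>j\<le>n * N. E j)"
  proof (intro set_eqI iffI)
    fix \<omega> assume "\<omega> \<in> {\<omega> \<in> space M. \<exists>i\<le>n * N. u < X (real i * d) \<omega>}"
    then have \<omega>: "\<omega> \<in> space M" and ex: "\<exists>i. i \<le> n * N \<and> u < X (real i * d) \<omega>" by auto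
    define j where "j = (LEAST i. i \<le> n * N \<and> u < X (real i * d) \<omega>)"
    have j: "j \<le> n * N" "u < X (real j * d) \<omega>" using LeastI_ex[OF ex] by (auto simp: j_def)
    have "X (real i * d) \<omega> \<le> u" if "i < j" for i
      using not_less_Least[of i "\<lambda>i. i \<le> n * N \<and> u < X (real i * d) \<omega>"] that j(1) by (auto simp: j_def[symmetric])
    with j \<omega> show "\<omega> \<in> (\<Union>j\<le>n * N. E j)" by (auto simp: E_def)
  qed (auto simp: E_def)
  have "prob {\<omega> \<in> space M. \<exists>i\<le>n * N. u < X (real i * d) \<omega>} * (1 - \<delta>) = (\<Sum>j\<le>n * N. prob (E j) * (1 - \<delta>))"
    unfolding UE by (subst finite_measure_finite_Union[OF _ _ disjE]) (auto simp: sum_distrib_right)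
  also have "\<dots> \<le> (\<Sum>j\<le>n * N. prob (G j))"
  proof (rule sum_mono)
    fix j
    have "prob (G j) = prob (E j) * prob (stays_above \<epsilon> (real (r j) * d))"
      unfolding G_def E_def by (rule first_passage_indep[OF d])
    then show "prob (E j) * (1 - \<delta>) \<le> prob (G j)"
      using small[OF r(2)[of j]] by (simp add: mult_left_mono)
  qed
  also have "\<dots> = prob (\<Union>j\<le>n * N. G j)"
    by (subst finite_measure_finite_Union[OF _ _ disjG]) auto
  also have "\<dots> \<le> prob {\<omega> \<in> space M. \<exists>k\<le>n. u - \<epsilon> < X (real k * (real N * d)) \<omega>}"
  proof (rule finite_measure_mono)
    show "(\<Union>j\<le>n * N. G j) \<subseteq> {\<omega> \<in> space M. \<exists>k\<le>n. u - \<epsilon> < X (real k * (real N * d)) \<omega>}"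
    proof clarify
      fix \<omega> j assume j: "j \<le> n * N" "\<omega> \<in> G j"
      then have "u - \<epsilon> < X (real (j + r j) * d) \<omega>" by (auto simp: G_def)
      then have "u - \<epsilon> < X (real (k j) * (real N * d)) \<omega>" by (simp add: r(1) mult.assoc)
      then show "\<omega> \<in> space M \<and> (\<exists>k\<le>n. u - \<epsilon> < X (real k * (real N * d)) \<omega>)"
        using j kn by (auto simp: G_def)
    qed
    show "{\<omega> \<in> space M. \<exists>k\<le>n. u - \<epsilon> < X (real k * (real N * d)) \<omega>} \<in> events"
      by measurable
  qed
  finally show ?thesis .
qed

section \<open>Passage from grids to continuous time\<close>

lemma X_greater_right:
  assumes "\<omega> \<in> space M" "0 \<le> t" "u < X t \<omega>" "t < b"
  obtains c where "t < c" "c \<le> b" "\<And>s. t \<le> s \<Longrightarrow> s < c \<Longrightarrow> u < X s \<omega>"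
proof -
  have "((\<lambda>s. X s \<omega>) \<longlongrightarrow> X t \<omega>) (at_right t)"
    using X_right_continuous[OF assms(1,2)] by (simp add: continuous_within)
  from order_tendstoD(1)[OF this assms(3)] obtain c where c: "c > t" "\<And>s. t < s \<Longrightarrow> s < c \<Longrightarrow> u < X s \<omega>"
    unfolding eventually_at_right_field by blast
  show ?thesis
    using c assms(3,4) by (intro that[of "min b c"]) (auto simp: le_less)
qed

lemma dyadic_between:
  fixes a b h :: real
  assumes "0 \<le> a" "a < b" "0 < h"
  obtains i m where "a \<le> real i * (h / 2 ^ m)" "real i * (h / 2 ^ m) < b"
proof -
  obtain m where "h / (b - a) < 2 ^ m" using real_arch_pow[of 2 "h / (b - a)"] by auto
  then have m: "h / 2 ^ m < b - a" using assms by (simp add: field_simps)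
  define d where "d = h / 2 ^ m"
  have d: "0 < d" "d < b - a" using assms m by (auto simp: d_def)
  define i where "i = nat \<lceil>a / d\<rceil>"
  have i: "a / d \<le> real i" "real i < a / d + 1"
    unfolding i_def using assms(1) d by (auto simp: of_nat_nat) linarith+
  have "a \<le> real i * d" using i(1) d by (simp add: field_simps)
  moreover have "real i * d < (a / d + 1) * d" using i(2) d by (intro mult_strict_right_mono)
  moreover have "(a / d + 1) * d = a + d" using d by (simp add: field_simps)
  ultimately show ?thesis using d by (intro that[of i m]) (auto simp: d_def[symmetric])
qed

text \<open>Right continuity keeps the path above u on some interval [t, c), which contains a dyadic
  point. At the right endpoint no room is left, but that endpoint lies on every grid.\<close>

lemma passage_as_dyadic_Union:
  assumes h: "0 < h" and n: "0 < n"
  shows "crosses u (real n * h) =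
    (\<Union>m. {\<omega> \<in> space M. \<exists>i\<le>n * 2 ^ m. u < X (real i * (h / 2 ^ m)) \<omega>})"
proof (intro set_eqI iffI)
  fix \<omega> assume "\<omega> \<in> crosses u (real n * h)"
  then obtain t where \<omega>: "\<omega> \<in> space M" and t: "0 \<le> t" "t \<le> real n * h" "u < X t \<omega>" by auto
  have "\<exists>m i. i \<le> n * 2 ^ m \<and> u < X (real i * (h / 2 ^ m)) \<omega>"
  proof (cases "t = real n * h")
    case True
    with t show ?thesis by (intro exI[of _ 0] exI[of _ n]) auto
  next
    case False
    then have "t < real n * h" using t by simp
    then obtain c where c: "t < c" "c \<le> real n * h" "\<And>s. t \<le> s \<Longrightarrow> s < c \<Longrightarrow> u < X s \<omega>"
      using X_greater_right[OF \<omega> t(1,3)] by blast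
    obtain i m where im: "t \<le> real i * (h / 2 ^ m)" "real i * (h / 2 ^ m) < c"
      using dyadic_between[OF t(1) c(1) h] by blast
    have "real i * (h / 2 ^ m) < real n * h" using im c(2) by simp
    then have "real i < real (n * 2 ^ m)" using h by (simp add: field_simps)
    then have "i \<le> n * 2 ^ m" by linarith
    with im c(3) show ?thesis by auto
  qed
  with \<omega> show "\<omega> \<in> (\<Union>m. {\<omega> \<in> space M. \<exists>i\<le>n * 2 ^ m. u < X (real i * (h / 2 ^ m)) \<omega>})" by auto
next
  fix \<omega> assume "\<omega> \<in> (\<Union>m. {\<omega> \<in> space M. \<exists>i\<le>n * 2 ^ m. u < X (real i * (h / 2 ^ m)) \<omega>})"
  then obtain m i where *: "\<omega> \<in> space M" "i \<le> n * 2 ^ m" "u < X (real i * (h / 2 ^ m)) \<omega>" by auto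
  have "real i \<le> real (n * 2 ^ m)" using *(2) by (simp only: of_nat_le_iff)
  then have "real i * (h / 2 ^ m) \<le> real n * h" using h by (simp add: field_simps)
  with * h show "\<omega> \<in> crosses u (real n * h)"
    by (auto intro!: bexI[of _ "real i * (h / 2 ^ m)"])
qed

lemma passage_measurable [measurable]:
  assumes "0 < T"
  shows "crosses u T \<in> events"
proof -
  have [measurable]: "X (real i * (T / 2 ^ m)) \<in> borel_measurable M" for i m
    using assms by auto
  have "crosses u (real 1 * T) \<in> events"
    unfolding passage_as_dyadic_Union[OF assms zero_less_one] by measurable
  then show ?thesis by simp
qed

text \<open>The grid inequality does not depend on the fine mesh, so it survives the increasing
  limit over dyadic refinements, while the coarse grid of mesh h stays fixed.\<close>

lemma maximal_inequality:
  assumes h: "0 < h" and n: "0 < n"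
    and small: "\<And>s. 0 \<le> s \<Longrightarrow> s \<le> h \<Longrightarrow> 1 - \<delta> \<le> prob (stays_above \<epsilon> s)"
  shows "prob (crosses u (real n * h)) * (1 - \<delta>) \<le> tail (max_law h n) (u - \<epsilon>)"
proof -
  define U where "U m = {\<omega> \<in> space M. \<exists>i\<le>n * 2 ^ m. u < X (real i * (h / 2 ^ m)) \<omega>}" for m :: nat
  have [measurable]: "X (real i * (h / 2 ^ m)) \<in> borel_measurable M" for i m
    using h by auto
  have [measurable]: "U m \<in> events" for m unfolding U_def by measurable
  have inc: "incseq U"
  proof (rule incseq_SucI, rule subsetI)
    fix m \<omega> assume "\<omega> \<in> U m"
    then obtain i where i: "\<omega> \<in> space M" "i \<le> n * 2 ^ m" "u < X (real i * (h / 2 ^ m)) \<omega>" by (auto simp: U_def)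
    then show "\<omega> \<in> U (Suc m)"
      unfolding U_def by (auto intro!: exI[of _ "2 * i"] simp: field_simps)
  qed
  have le: "prob (U m) * (1 - \<delta>) \<le> tail (max_law h n) (u - \<epsilon>)" for m
  proof -
    have "prob (U m) * (1 - \<delta>) \<le> prob {\<omega> \<in> space M. \<exists>k\<le>n. u - \<epsilon> < X (real k * (real (2 ^ m) * (h / 2 ^ m))) \<omega>}"
      unfolding U_def
    proof (rule grid_maximal_inequality)
      fix r :: nat assume "r \<le> 2 ^ m"
      then have "real r \<le> 2 ^ m" by (metis of_nat_le_iff of_nat_numeral of_nat_power)
      then show "1 - \<delta> \<le> prob (stays_above \<epsilon> (real r * (h / 2 ^ m)))"
        using h by (intro small) (auto simp: field_simps)
    qed (use h in auto)
    also have "real (2 ^ m) * (h / 2 ^ m) = h" by simp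
    finally show ?thesis using h by (simp add: tail_max_law)
  qed
  have "(\<lambda>m. prob (U m) * (1 - \<delta>)) \<longlonglongrightarrow> prob (\<Union>m. U m) * (1 - \<delta>)"
    by (intro tendsto_mult tendsto_const finite_Lim_measure_incseq inc) auto
  then have "prob (\<Union>m. U m) * (1 - \<delta>) \<le> tail (max_law h n) (u - \<epsilon>)"
    using le by (intro LIMSEQ_le_const2) auto
  then show ?thesis
    unfolding passage_as_dyadic_Union[OF h n] U_def by simp
qed

text \<open>Right continuity of the paths at 0, turned into convergence of probabilities by
  dominated convergence along sequences. Time 0 is added by hand, and halving b gives a closed
  range.\<close>

lemma small_time:
  assumes "0 < \<epsilon>" "0 < \<delta>"
  obtains h0 where "0 < h0" "\<And>s. 0 \<le> s \<Longrightarrow> s \<le> h0 \<Longrightarrow> 1 - \<delta> \<le> prob (stays_above \<epsilon> s)"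
proof -
  have "((\<lambda>s. prob (stays_above \<epsilon> s)) \<longlongrightarrow> 1) (at_right 0)"
  proof (rule tendsto_at_right_sequentially[of 0 1])
    fix S :: "nat \<Rightarrow> real"
    assume S: "\<And>n. 0 < S n" "\<And>n. S n < 1" "decseq S" "S \<longlonglongrightarrow> 0"
    have fl: "filterlim S (at_right 0) sequentially"
      unfolding filterlim_at using S by (auto intro!: always_eventually simp: less_imp_neq[THEN not_sym])
    have S0: "0 \<le> S n" for n using S(1)[of n] by simp
      have [measurable]: "X (S n) \<in> borel_measurable M" for n using S0[of n] by simp
    have [measurable]: "stays_above \<epsilon> (S n) \<in> events" for n by measurable
    have "(\<lambda>n. \<integral>\<omega>. indicat_real (stays_above \<epsilon> (S n)) \<omega> \<partial>M) \<longlonglongrightarrow> (\<integral>\<omega>. 1 \<partial>M)"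
    proof (rule integral_dominated_convergence[where w="\<lambda>_. 1"])
      show "AE \<omega> in M. (\<lambda>n. indicator (stays_above \<epsilon> (S n)) \<omega>) \<longlonglongrightarrow> (1::real)"
      proof (rule AE_I2)
        fix \<omega> assume \<omega>: "\<omega> \<in> space M"
        have "((\<lambda>s. X s \<omega>) \<longlongrightarrow> X 0 \<omega>) (at_right 0)"
          using X_right_continuous[OF \<omega> order_refl] by (simp add: continuous_within)
        from filterlim_compose[OF this fl] have "(\<lambda>n. X (S n) \<omega>) \<longlonglongrightarrow> 0" using X_0[OF \<omega>] by simp
        then have "\<forall>\<^sub>F n in sequentially. - \<epsilon> < X (S n) \<omega>"
          using assms(1) by (intro order_tendstoD) auto
        then show "(\<lambda>n. indicator (stays_above \<epsilon> (S n)) \<omega>) \<longlonglongrightarrow> (1::real)"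
          using \<omega> by (intro tendsto_eventually) (auto elim!: eventually_mono)
      qed
    qed auto
    then show "(\<lambda>n. prob (stays_above \<epsilon> (S n))) \<longlonglongrightarrow> 1"
      using prob_space by (simp add: Int_absorb1 sets.sets_into_space)
  qed simp
  then have "\<forall>\<^sub>F s in at_right 0. 1 - \<delta> < prob (stays_above \<epsilon> s)"
    using assms(2) by (intro order_tendstoD) auto
  then obtain b where b: "b > 0" "\<And>s. 0 < s \<Longrightarrow> s < b \<Longrightarrow> 1 - \<delta> < prob (stays_above \<epsilon> s)"
    unfolding eventually_at_right_field by blast
  have "stays_above \<epsilon> 0 = space M" using X_0 assms(1) by auto
  then have "1 - \<delta> \<le> prob (stays_above \<epsilon> 0)" using assms(2) by (simp add: prob_space)
  then have "1 - \<delta> \<le> prob (stays_above \<epsilon> s)" if "0 \<le> s" "s \<le> b / 2" for s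
    using that b(2)[of s] b(1) by (cases "s = 0") (auto intro: less_imp_le)
  then show ?thesis using b(1) by (intro that[of "b / 2"]) auto
qed

text \<open>Every time has a neighbourhood on which the path is bounded above: on the right by right
  continuity, on the left by the left limit. Bisection glues these neighbourhoods over the compact
  interval.\<close>

lemma bdd_above_path:
  assumes \<omega>: "\<omega> \<in> space M" and T: "0 \<le> T"
  shows "bdd_above ((\<lambda>s. X s \<omega>) ` {0..T})"
proof -
  let ?P = "\<lambda>a b. bdd_above ((\<lambda>s. X s \<omega>) ` ({a..b} \<inter> {0..T}))"
  have "?P 0 T"
  proof (rule Bolzano[where P="?P", OF T])
    fix a b c assume "?P a b" "?P b c" "a \<le> b" "b \<le> c"
    then have "bdd_above ((\<lambda>s. X s \<omega>) ` ({a..b} \<inter> {0..T}) \<union> (\<lambda>s. X s \<omega>) ` ({b..c} \<inter> {0..T}))" by simp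
    moreover have "(\<lambda>s. X s \<omega>) ` ({a..c} \<inter> {0..T}) \<subseteq>
      (\<lambda>s. X s \<omega>) ` ({a..b} \<inter> {0..T}) \<union> (\<lambda>s. X s \<omega>) ` ({b..c} \<inter> {0..T})"
      unfolding image_Un[symmetric] by (rule image_mono) fastforce
    ultimately show "?P a c" by (rule bdd_above_mono)
  next
    fix x assume x: "0 \<le> x" "x \<le> T"
    have "((\<lambda>s. X s \<omega>) \<longlongrightarrow> X x \<omega>) (at_right x)"
      using X_right_continuous[OF \<omega> x(1)] by (simp add: continuous_within)
    then have "\<forall>\<^sub>F s in at_right x. X s \<omega> < X x \<omega> + 1" by (rule order_tendstoD) simp
    then obtain b where b: "b > x" "\<And>s. x < s \<Longrightarrow> s < b \<Longrightarrow> X s \<omega> < X x \<omega> + 1"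
      unfolding eventually_at_right_field by blast
    have "\<exists>a K. a < x \<and> (\<forall>s. a < s \<and> s < x \<and> 0 \<le> s \<longrightarrow> X s \<omega> < K)"
    proof (cases "x = 0")
      case True then show ?thesis by (intro exI[of _ "-1"]) auto
    next
      case False
      then obtain l where "((\<lambda>s. X s \<omega>) \<longlongrightarrow> l) (at_left x)" using X_left_limit[OF \<omega>, of x] x by auto
      then have "\<forall>\<^sub>F s in at_left x. X s \<omega> < l + 1" by (rule order_tendstoD) simp
      then show ?thesis unfolding eventually_at_left_field by blast
    qed
    then obtain a K where a: "a < x" "\<And>s. a < s \<Longrightarrow> s < x \<Longrightarrow> 0 \<le> s \<Longrightarrow> X s \<omega> < K" by blast
    show "\<exists>d>0. \<forall>a b. a \<le> x \<and> x \<le> b \<and> b - a < d \<longrightarrow> ?P a b"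
    proof (intro exI[of _ "min (b - x) (x - a)"] conjI allI impI)
      fix a' b' assume *: "a' \<le> x \<and> x \<le> b' \<and> b' - a' < min (b - x) (x - a)"
      show "?P a' b'"
      proof (rule bdd_aboveI2)
        fix s assume s: "s \<in> {a'..b'} \<inter> {0..T}"
        consider "s < x" | "s = x" | "x < s" by linarith
        then show "X s \<omega> \<le> max K (X x \<omega> + 1)"
        proof cases
          case 1 with a(2)[of s] * s show ?thesis by (auto simp: less_imp_le max.coboundedI1)
        next
          case 3 with b(2)[of s] * s show ?thesis by (auto simp: less_imp_le max.coboundedI2)
        qed auto
      qed
    qed (use a b in auto)
  qed
  then show ?thesis by (simp add: Int_absorb2)
qed

lemma running_sup_gr_iff:
  assumes "\<omega> \<in> space M" "0 \<le> T"
  shows "u < running_sup X T \<omega> \<longleftrightarrow> (\<exists>t\<in>{0..T}. u < X t \<omega>)"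
  unfolding running_sup_def using less_cSup_iff[OF _ bdd_above_path[OF assms]] assms(2) by auto

lemma X_le_running_sup: "\<omega> \<in> space M \<Longrightarrow> 0 \<le> t \<Longrightarrow> t \<le> T \<Longrightarrow> X t \<omega> \<le> running_sup X T \<omega>"
  unfolding running_sup_def by (intro cSup_upper bdd_above_path) auto

lemma running_sup_mono:
  "\<omega> \<in> space M \<Longrightarrow> 0 \<le> s \<Longrightarrow> s \<le> t \<Longrightarrow> running_sup X s \<omega> \<le> running_sup X t \<omega>"
  unfolding running_sup_def by (intro cSup_subset_mono bdd_above_path) auto

lemma running_sup_0: "\<omega> \<in> space M \<Longrightarrow> running_sup X 0 \<omega> = 0"
  by (simp add: running_sup_def X_0)

lemma running_sup_measurable [measurable]: "0 \<le> T \<Longrightarrow> running_sup X T \<in> borel_measurable M"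
proof (cases "T = 0")
  case True
  have "running_sup X 0 \<in> borel_measurable M \<longleftrightarrow> (\<lambda>_. 0::real) \<in> borel_measurable M"
    by (rule measurable_cong) (rule running_sup_0)
  with True show ?thesis by simp
next
  case False
  assume "0 \<le> T"
  with False have T: "0 < T" by simp
  show ?thesis
  proof (rule borel_measurableI_greater)
    fix y
    have "{\<omega> \<in> space M. y < running_sup X T \<omega>} = crosses y T"
      using T by (intro Collect_cong conj_cong refl running_sup_gr_iff) auto
    then show "{\<omega> \<in> space M. y < running_sup X T \<omega>} \<in> events"
      using passage_measurable[OF T] by simp
  qed
qed

end

section \<open>From the Levy measure to the tails of the marginals\<close>

lemma (in real_distribution) cdf_eq_tail: "cdf M x = 1 - tail M x"
proof -
  have "UNIV - {..x} = {x<..}" by auto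
  then show ?thesis using prob_compl[of "{..x}"] by (simp add: cdf_def)
qed

text \<open>Characteristic functions identify the law at time t as a compound Poisson law of
  intensity \<open>t * l\<close> convolved with a remainder. Here l is the mass of the Levy measure
  beyond x0, the factor between its tail and the tail of F.\<close>

lemma levy_marginal_tails:
  assumes "levy_process M X" and LM: "levy_measure M X LM" and \<alpha>: "\<alpha> > 0"
    and S: "tail_in_S_alpha \<alpha> (levy_tail_plus LM)"
  obtains F c l where "conv_equiv F \<alpha> c" "0 < l"
    "\<forall>\<^sub>F u in at_top. levy_tail_plus LM u = l * tail F u"
    "\<And>t. 0 < t \<Longrightarrow> integrable (distr M borel (X t)) (\<lambda>x. exp (\<alpha> * x))"
    "\<And>t. 0 < t \<Longrightarrow> ((\<lambda>u. tail (distr M borel (X t)) u / tail F u) \<longlongrightarrow>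
      t * l * (\<integral>x. exp (\<alpha> * x) \<partial>distr M borel (X t))) at_top"
proof -
  have "prob_space M" using assms(1) by (simp add: levy_process_def)
  then interpret levy M X using assms(1) by (simp add: levy_def levy_axioms_def)
  obtain \<gamma> \<sigma>2 where \<sigma>2: "\<sigma>2 \<ge> 0" and ch: "\<And>\<theta>. char (law 1) \<theta> =
           exp (\<i> * complex_of_real (\<gamma> * \<theta>) - complex_of_real (\<sigma>2 * \<theta>\<^sup>2 / 2) +
                (CLINT x|LM. iexp (\<theta> * x) - 1 - \<i> * complex_of_real (\<theta> * x * indicator {-1<..<1} x)))"
    using LM unfolding levy_measure_def by blast
  interpret L: levy_exponent LM \<gamma> \<sigma>2
    using LM \<sigma>2 unfolding levy_measure_def levy_exponent_def by blast
  have ch1: "char (law 1) \<theta> = exp (L.eta \<theta>)" for \<theta>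
    unfolding ch L.eta_def ..
  obtain x0 F where x0: "0 < x0" and pos: "\<And>u. u \<ge> x0 \<Longrightarrow> levy_tail_plus LM u > 0"
    and SF: "S_alpha \<alpha> F" and tF: "\<And>u. u \<ge> x0 \<Longrightarrow> tail F u = levy_tail_plus LM u / levy_tail_plus LM x0"
    using S unfolding tail_in_S_alpha_def by blast
  define l where "l = levy_tail_plus LM x0"
  have l: "0 < l" using pos[of x0] by (simp add: l_def)
  have F: "real_distribution F"
    using SF by (auto simp: S_alpha_def real_distribution_def real_distribution_axioms_def)
  interpret F: real_distribution F by (rule F)
  obtain c where c: "((\<lambda>u. tail (F \<star> F) u / tail F u) \<longlongrightarrow> c) at_top"
    using SF unfolding S_alpha_def by blast
  have tF_pos: "tail F u > 0" for u
  proof -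
    have "tail F (max 1 u) > 0" using SF by (auto simp: S_alpha_def)
    then show ?thesis using F.tail_mono[of u "max 1 u"] by simp
  qed
  have "emeasure F {..<0} = 0" using SF by (simp add: S_alpha_def)
  then have nonneg: "AE x in F. 0 \<le> x"
    by (intro AE_I'[of "{..<0}"]) auto
  have CE: "conv_equiv F \<alpha> c"
    using F \<alpha> tF_pos SF c nonneg
    by (auto simp: conv_equiv_def conv_equiv_axioms_def exp_tail_def exp_tail_axioms_def S_alpha_def)
  interpret CE: conv_equiv F \<alpha> c by (rule CE)
  \<comment> \<open>F is prescribed only through its tail from x0 on, but
    \<open>tail F x0 = 1\<close> leaves no mass up to x0; hence it is the restricted Levy measure,
    normalised.\<close>
  have F_eq: "F = L.jumps (1 / l) {x0<..}"
  proof -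
    have fin: "finite_measure (L.jumps (1 / l) {x0<..})"
      by (rule L.finite_jumps[where \<delta>=x0]) (use x0 l in auto)
    have int: "integrable LM (\<lambda>x. indicator {x0<..} x *\<^sub>R indicat_real {u<..} x)" for u
      by (rule L.integrable_LM_away_from_0[where \<delta>=x0 and C=1]) (use x0 in \<open>auto simp: indicator_def\<close>)
    have tail: "tail (L.jumps (1 / l) {x0<..}) u = levy_tail_plus LM (max x0 u) / l" for u
    proof -
      have "tail (L.jumps (1 / l) {x0<..}) u = (\<integral>x. indicat_real {u<..} x \<partial>L.jumps (1 / l) {x0<..})"
        using sets_eq_imp_space_eq[OF L.sets_jumps[of "1 / l" "{x0<..}"]] by simp
      also have "\<dots> = (\<integral>x. indicator {x0<..} x *\<^sub>R indicat_real {u<..} x \<partial>LM) / l"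
        using l by (subst L.integral_jumps(2)) auto
      also have "(\<lambda>x. indicator {x0<..} x *\<^sub>R indicat_real {u<..} x) = indicat_real {max x0 u<..}"
        by (auto simp: indicator_def)
      finally show ?thesis by (simp add: levy_tail_plus_def)
    qed
    have one: "measure (L.jumps (1 / l) {x0<..}) UNIV = 1"
    proof -
      have "measure (L.jumps (1 / l) {x0<..}) UNIV = (\<integral>x. 1 \<partial>L.jumps (1 / l) {x0<..})"
        using sets_eq_imp_space_eq[OF L.sets_jumps[of "1 / l" "{x0<..}"]] by simp
      also have "\<dots> = (\<integral>x. indicat_real {x0<..} x \<partial>LM) / l"
        using l by (subst L.integral_jumps(2)) auto
      finally show ?thesis using l by (simp add: l_def levy_tail_plus_def)
    qed
    have J: "real_distribution (L.jumps (1 / l) {x0<..})"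
      using one sets_eq_imp_space_eq[OF L.sets_jumps[of "1 / l" "{x0<..}"]]
      by (auto simp: real_distribution_def real_distribution_axioms_def finite_measure.emeasure_eq_measure[OF fin] intro!: prob_spaceI)
    interpret J: real_distribution "L.jumps (1 / l) {x0<..}" by (rule J)
    have "tail F u = tail (L.jumps (1 / l) {x0<..}) u" for u
    proof (cases "u \<ge> x0")
      case True
      then show ?thesis unfolding tail tF[OF True] by (simp add: l_def max_def)
    next
      case False
      have "tail F x0 = 1" using tF[of x0] l by (simp add: l_def)
      then have "tail F u = 1"
        using F.tail_mono[of u x0] False F.prob_le_1[of "{u<..}"] by simp
      then show ?thesis using False l unfolding tail by (simp add: l_def max_def)
    qed
    then show ?thesis
      by (intro cdf_unique F J ext) (simp add: F.cdf_eq_tail J.cdf_eq_tail)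
  qed
  have chF: "complex_of_real l * (char F \<theta> - 1) = (CLINT x|LM. indicator {x0<..} x *\<^sub>R (iexp (\<theta> * x) - 1))" for \<theta>
  proof -
    have "char F \<theta> - 1 = (CLINT x|F. iexp (\<theta> * x) - 1)"
      unfolding char_def by (subst Bochner_Integration.integral_diff) (auto intro!: F.integrable_iexp)
    also have "\<dots> = (1 / l) *\<^sub>R (CLINT x|LM. indicator {x0<..} x *\<^sub>R (iexp (\<theta> * x) - 1))"
      unfolding F_eq using l by (subst L.integral_jumps(2)) auto
    finally show ?thesis using l by (simp add: scaleR_conv_of_real)
  qed
  \<comment> \<open>A family of remainders over all positive times is needed, because
    \<open>char_law\<close> compares with a candidate law at every time 1 / (n + 1).\<close>
  have "\<exists>R. \<forall>t>0. real_distribution (R t) \<and> (\<forall>a\<ge>0. integrable (R t) (\<lambda>x. exp (a * x))) \<and>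
    (\<forall>\<theta>. exp (complex_of_real t * (CLINT x|LM. indicator {x0<..} x *\<^sub>R (iexp (\<theta> * x) - 1))) * char (R t) \<theta>
      = exp (complex_of_real t * L.eta \<theta>))"
  proof (rule choice, rule allI)
    fix t :: real
    show "\<exists>R. 0 < t \<longrightarrow> real_distribution R \<and> (\<forall>a\<ge>0. integrable R (\<lambda>x. exp (a * x))) \<and>
      (\<forall>\<theta>. exp (complex_of_real t * (CLINT x|LM. indicator {x0<..} x *\<^sub>R (iexp (\<theta> * x) - 1))) * char R \<theta>
      = exp (complex_of_real t * L.eta \<theta>))"
    proof (cases "0 < t")
      case True
      then show ?thesis by (rule_tac L.remainder_law[OF x0 less_imp_le]) blast+
    qed simp
  qed
  then obtain R where R: "\<And>t. 0 < t \<Longrightarrow> real_distribution (R t)"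
    "\<And>t a. 0 < t \<Longrightarrow> 0 \<le> a \<Longrightarrow> integrable (R t) (\<lambda>x. exp (a * x))"
    "\<And>t \<theta>. 0 < t \<Longrightarrow> exp (complex_of_real t * (CLINT x|LM. indicator {x0<..} x *\<^sub>R (iexp (\<theta> * x) - 1))) * char (R t) \<theta>
      = exp (complex_of_real t * L.eta \<theta>)"
    by blast
  define D where "D t = (compound_poisson (t * l) F \<star> R t)" for t
  have CP: "real_distribution (compound_poisson (t * l) F)" if "0 < t" for t
    by (rule real_distribution_compound_poisson[OF F]) (use that l in simp)
  have D: "real_distribution (D t)" if "0 < t" for t
    unfolding D_def by (rule real_distribution_convolution[OF CP R(1)]) (use that in auto)
  have chD: "char (D t) \<theta> = exp (complex_of_real t * L.eta \<theta>)" if t: "0 < t" for t \<theta>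
  proof -
    have tl: "t * l > 0" using t l by simp
    have "char (D t) \<theta> = exp (complex_of_real t * (complex_of_real l * (char F \<theta> - 1))) * char (R t) \<theta>"
      unfolding D_def char_convolution[OF CP[OF t] R(1)[OF t]] char_compound_poisson[OF F tl] by (simp add: mult.assoc)
    then show ?thesis unfolding chF R(3)[OF t] .
  qed
  have law: "law t = D t" if t: "0 < t" for t
  proof (rule Levy_uniqueness[OF real_distribution_law D[OF t]])
    show "char (law t) = char (D t)"
      using char_law[OF ch1 D chD, of t] chD[OF t] t by (intro ext) simp
  qed (use t in simp)
  show ?thesis
  proof (rule that[OF CE l])
    show "\<forall>\<^sub>F u in at_top. levy_tail_plus LM u = l * tail F u"
      using eventually_ge_at_top[of x0] by eventually_elim (use l tF in \<open>simp add: l_def\<close>)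
    fix t :: real assume t: "0 < t"
    have tl: "t * l > 0" using t l by simp
    \<comment> \<open>The remainder has exponential moments of all nonnegative orders, so
      \<open>\<alpha> + 1\<close> is just one admissible order above \<alpha>.\<close>
    note lim = CE.tail_compound_poisson_convolution_limit[OF tl R(1)[OF t], where \<beta>="\<alpha> + 1",
      OF _ R(2)[OF t] R(2)[OF t]]
    show "integrable (law t) (\<lambda>x. exp (\<alpha> * x))"
      unfolding law[OF t] D_def by (rule lim(2)) (use \<alpha> in auto)
    show "((\<lambda>u. tail (law t) u / tail F u) \<longlongrightarrow> t * l * (\<integral>x. exp (\<alpha> * x) \<partial>law t)) at_top"
      unfolding law[OF t] D_def by (rule lim(1)) (use \<alpha> in auto)
  qed
qed

section \<open>Exponential moments of grid maxima and of suprema\<close>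

locale levy_tails = levy M X + E: conv_equiv F \<alpha> c
  for M :: "'a measure" and X :: "real \<Rightarrow> 'a \<Rightarrow> real" and F :: "real measure" and \<alpha> c :: real +
  fixes l :: real
  assumes l_pos: "0 < l"
    and integrable_law: "\<And>t. 0 < t \<Longrightarrow> integrable (law t) (\<lambda>x. exp (\<alpha> * x))"
    and tail_law: "\<And>t. 0 < t \<Longrightarrow>
      ((\<lambda>u. tail (law t) u / tail F u) \<longlongrightarrow> t * l * (\<integral>x. exp (\<alpha> * x) \<partial>law t)) at_top"
begin

lemmas alpha_pos = E.alpha_pos

definition exp_moment :: "real \<Rightarrow> real" where "exp_moment t = (\<integral>\<omega>. exp (\<alpha> * X t \<omega>) \<partial>M)"

definition grid_exp_moment :: "real \<Rightarrow> nat \<Rightarrow> real" where "grid_exp_moment h k = (\<integral>x. exp (\<alpha> * x) \<partial>max_law h k)"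

definition sup_exp_moment :: "real \<Rightarrow> real" where "sup_exp_moment t = (\<integral>\<omega>. exp (\<alpha> * running_sup X t \<omega>) \<partial>M)"

lemma exp_moment_law: "0 \<le> t \<Longrightarrow> exp_moment t = (\<integral>x. exp (\<alpha> * x) \<partial>law t)"
  unfolding exp_moment_def by (subst integral_distr) auto

lemma exp_moment_0: "exp_moment 0 = 1"
proof -
  have "exp_moment 0 = (\<integral>\<omega>. 1 \<partial>M)"
    unfolding exp_moment_def by (intro Bochner_Integration.integral_cong) (auto simp: X_0)
  then show ?thesis by (simp add: prob_space)
qed

lemma exp_moment_add: "0 < s \<Longrightarrow> 0 < t \<Longrightarrow> exp_moment (s + t) = exp_moment s * exp_moment t"
  by (simp add: exp_moment_law law_add exp_moment_convolution real_distribution_law integrable_law)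

lemma exp_moment_mult:
  assumes "0 < h" shows "exp_moment (real k * h) = exp_moment h ^ k"
proof (induction k)
  case (Suc k)
  show ?case
  proof (cases "k = 0")
    case False
    have "exp_moment (real (Suc k) * h) = exp_moment (h + real k * h)" by (simp add: algebra_simps)
    also have "\<dots> = exp_moment h * exp_moment (real k * h)" using assms False by (intro exp_moment_add) auto
    finally show ?thesis using Suc by simp
  qed simp
qed (simp add: exp_moment_0)

text \<open>Reflection at 0 leaves the tail unchanged for \<open>u \<ge> 0\<close>, so the
  convolution limit applies at each step of the recursion. Term j stands for a large jump in
  increment j + 1: the moments of the first j + 1 increments multiply, and the maximum over the
  remaining \<open>k - 1 - j\<close> steps contributes its own moment.\<close>

lemma tail_max_law_limit:
  assumes h: "0 < h"
  shows "((\<lambda>u. tail (max_law h k) u / tail F u) \<longlongrightarrow> (\<Sum>j<k. h * l * exp_moment h ^ Suc j * grid_exp_moment h (k - 1 - j))) at_top"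
proof (induction k)
  case 0
  have "\<forall>\<^sub>F u in at_top. tail (max_law h 0) u / tail F u = 0"
    using eventually_ge_at_top[of 0] by eventually_elim (simp add: measure_return)
  then show ?case by (simp add: tendsto_eventually)
next
  case (Suc k)
  note rl = real_distribution_law[OF less_imp_le[OF h]]
  note rm = real_distribution_max_law[OF less_imp_le[OF h], of k]
  have ev: "\<forall>\<^sub>F u in at_top. tail (law h \<star> max_law h k) u / tail F u = tail (max_law h (Suc k)) u / tail F u"
    using eventually_ge_at_top[of 0]
  proof eventually_elim
    case (elim u)
    have "tail (max_law h (Suc k)) u = measure (law h \<star> max_law h k) (max 0 -` {u<..} \<inter> space (law h \<star> max_law h k))"
      unfolding max_law.simps by (subst measure_distr) auto
    also have "max 0 -` {u<..} \<inter> space (law h \<star> max_law h k) = {u<..}"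
      using elim by auto
    finally show ?case by simp
  qed
  have lim: "((\<lambda>u. tail (law h \<star> max_law h k) u / tail F u) \<longlongrightarrow> h * l * exp_moment h * grid_exp_moment h k +
    (\<Sum>j<k. h * l * exp_moment h ^ Suc j * grid_exp_moment h (k - 1 - j)) * exp_moment h) at_top"
    using E.tail_convolution_limit[OF rl rm tail_law[OF h] Suc] h by (simp add: grid_exp_moment_def exp_moment_law)
  have "((\<lambda>u. tail (max_law h (Suc k)) u / tail F u) \<longlongrightarrow> h * l * exp_moment h * grid_exp_moment h k +
    (\<Sum>j<k. h * l * exp_moment h ^ Suc j * grid_exp_moment h (k - 1 - j)) * exp_moment h) at_top"
    by (rule Lim_transform_eventually[OF lim ev])
  also have "h * l * exp_moment h * grid_exp_moment h k + (\<Sum>j<k. h * l * exp_moment h ^ Suc j * grid_exp_moment h (k - 1 - j)) * exp_moment h =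
    (\<Sum>j<Suc k. h * l * exp_moment h ^ Suc j * grid_exp_moment h (Suc k - 1 - j))"
    unfolding sum.lessThan_Suc_shift sum_distrib_right by (auto intro!: sum.cong)
  finally show ?case .
qed

lemma integrable_max_law: "0 < h \<Longrightarrow> integrable (max_law h k) (\<lambda>x. exp (\<alpha> * x))"
  by (rule E.integrable_exp_of_tail[OF real_distribution_max_law tail_max_law_limit]) auto

lemma tail_running_sup:
  assumes "0 \<le> T"
  shows "tail (distr M borel (running_sup X T)) u = prob (crosses u T)"
proof -
  have "running_sup X T -` {u<..} \<inter> space M = {\<omega> \<in> space M. u < running_sup X T \<omega>}" by auto
  also have "\<dots> = crosses u T"
    by (intro Collect_cong conj_cong refl running_sup_gr_iff assms)
  finally show ?thesis using assms by (subst measure_distr) auto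
qed

lemma real_distribution_running_sup: "0 \<le> T \<Longrightarrow> real_distribution (distr M borel (running_sup X T))"
  by (intro real_distribution.intro prob_space_distr) (auto simp: real_distribution_axioms_def)

text \<open>Integrating the maximal inequality against \<open>\<alpha> * exp (\<alpha> * u)\<close>
  turns it into a comparison of exponential moments; the shift of the level by \<epsilon> becomes
  the factor \<open>exp (\<alpha> * \<epsilon>)\<close>.\<close>

lemma exp_running_sup_bound:
  assumes h: "0 < h" and n: "0 < n" and \<delta>: "\<delta> < 1"
    and small: "\<And>s. 0 \<le> s \<Longrightarrow> s \<le> h \<Longrightarrow> 1 - \<delta> \<le> prob (stays_above \<epsilon> s)"
  shows "integrable M (\<lambda>\<omega>. exp (\<alpha> * running_sup X (real n * h) \<omega>))"
    and "sup_exp_moment (real n * h) * (1 - \<delta>) \<le> exp (\<alpha> * \<epsilon>) * grid_exp_moment h n"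
proof -
  let ?T = "real n * h"
  have T: "0 \<le> ?T" using h by simp
  let ?D1 = "distr M borel (running_sup X ?T)"
  let ?D2 = "distr (max_law h n) borel (\<lambda>x. 1 * x + \<epsilon>)"
  note rm = real_distribution_max_law[OF less_imp_le[OF h], of n]
  note D1 = real_distribution_running_sup[OF T]
  note D2 = real_distribution_affine[OF rm, of 1 \<epsilon>]
  interpret rm: real_distribution "max_law h n" by (rule rm)
  interpret D1: real_distribution ?D1 by (rule D1)
  interpret D2: real_distribution ?D2 by (rule D2)
  have int: "integrable (max_law h n) (\<lambda>x. exp (\<alpha> * 1 * x))" using integrable_max_law[OF h] by simp
  have tail_D2: "tail ?D2 u = tail (max_law h n) (u - \<epsilon>)" for u
    by (subst measure_distr) (auto intro!: arg_cong2[where f=measure])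
  have "ennreal (1 - \<delta>) * (\<integral>\<^sup>+x. exp (\<alpha> * x) \<partial>?D1) = (\<integral>\<^sup>+u. ennreal (1 - \<delta>) * (ennreal (\<alpha> * exp (\<alpha> * u)) * tail ?D1 u) \<partial>lborel)"
    unfolding nn_integral_exp_tail[OF D1 alpha_pos] by (rule nn_integral_cmult[symmetric]) measurable
  also have "\<dots> \<le> (\<integral>\<^sup>+u. ennreal (\<alpha> * exp (\<alpha> * u)) * tail ?D2 u \<partial>lborel)"
  proof (rule nn_integral_mono)
    fix u
    have "tail ?D1 u * (1 - \<delta>) \<le> tail ?D2 u"
      unfolding tail_running_sup[OF T] tail_D2 using maximal_inequality[OF h n small] by simp
    then have "\<alpha> * exp (\<alpha> * u) * (tail ?D1 u * (1 - \<delta>)) \<le> \<alpha> * exp (\<alpha> * u) * tail ?D2 u"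
      using alpha_pos by (intro mult_left_mono) auto
    then show "ennreal (1 - \<delta>) * (ennreal (\<alpha> * exp (\<alpha> * u)) * tail ?D1 u) \<le> ennreal (\<alpha> * exp (\<alpha> * u)) * tail ?D2 u"
      using alpha_pos \<delta> by (simp add: ennreal_mult[symmetric] algebra_simps)
  qed
  also have "\<dots> = (\<integral>\<^sup>+x. exp (\<alpha> * x) \<partial>?D2)"
    by (rule nn_integral_exp_tail[OF D2 alpha_pos, symmetric])
  also have "\<dots> = ennreal (exp (\<alpha> * \<epsilon>) * grid_exp_moment h n)"
    using exp_moment_affine[OF rm int, of \<epsilon>] by (subst nn_integral_eq_integral) (auto simp: grid_exp_moment_def)
  finally have le: "ennreal (1 - \<delta>) * (\<integral>\<^sup>+x. exp (\<alpha> * x) \<partial>?D1) \<le> ennreal (exp (\<alpha> * \<epsilon>) * grid_exp_moment h n)" .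
  have eq: "(\<integral>\<^sup>+x. exp (\<alpha> * x) \<partial>?D1) = (\<integral>\<^sup>+\<omega>. exp (\<alpha> * running_sup X ?T \<omega>) \<partial>M)"
    using T by (subst nn_integral_distr) auto
  have "ennreal (1 - \<delta>) * (\<integral>\<^sup>+x. exp (\<alpha> * x) \<partial>?D1) < \<infinity>"
    using le by (rule order.strict_trans1) simp
  then have "(\<integral>\<^sup>+x. exp (\<alpha> * x) \<partial>?D1) < \<infinity>"
    using \<delta> by (auto simp: ennreal_mult_less_top)
  then show int: "integrable M (\<lambda>\<omega>. exp (\<alpha> * running_sup X ?T \<omega>))"
    unfolding eq using T by (intro integrableI_nonneg) auto
  have "ennreal (1 - \<delta>) * ennreal (sup_exp_moment ?T) \<le> ennreal (exp (\<alpha> * \<epsilon>) * grid_exp_moment h n)"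
    using le unfolding eq sup_exp_moment_def by (subst (asm) nn_integral_eq_integral[OF int]) auto
  then show "sup_exp_moment ?T * (1 - \<delta>) \<le> exp (\<alpha> * \<epsilon>) * grid_exp_moment h n"
    using \<delta> by (simp add: ennreal_mult[symmetric] sup_exp_moment_def grid_exp_moment_def mult.commute)
qed

text \<open>Fixed values of \<epsilon> and \<delta> suffice here: the moment is finite at a multiple
  of h beyond T, and monotonicity in time brings it down to T.\<close>

lemma integrable_exp_running_sup:
  assumes "0 \<le> T" shows "integrable M (\<lambda>\<omega>. exp (\<alpha> * running_sup X T \<omega>))"
proof -
  obtain h where h: "0 < h" "\<And>s. 0 \<le> s \<Longrightarrow> s \<le> h \<Longrightarrow> 1 - 1/2 \<le> prob (stays_above 1 s)"
    using small_time[of 1 "1/2"] by auto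
  obtain n where n: "T / h < real n" using reals_Archimedean2 by blast
  then have "0 < n" using assms h(1) by (cases "n = 0") (auto simp: field_simps)
  from exp_running_sup_bound(1)[OF h(1) this _ h(2)]
  have int: "integrable M (\<lambda>\<omega>. exp (\<alpha> * running_sup X (real n * h) \<omega>))" by simp
  have "T \<le> real n * h" using n h(1) by (simp add: field_simps)
  then show ?thesis
    using assms alpha_pos
    by (intro Bochner_Integration.integrable_bound[OF int] AE_I2) (auto intro!: mult_left_mono running_sup_mono)
qed

lemma sup_exp_moment_mono: "0 \<le> s \<Longrightarrow> s \<le> t \<Longrightarrow> sup_exp_moment s \<le> sup_exp_moment t"
  unfolding sup_exp_moment_def using alpha_pos
  by (intro integral_mono integrable_exp_running_sup) (auto intro!: mult_left_mono running_sup_mono)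

lemma sup_exp_moment_0: "sup_exp_moment 0 = 1"
proof -
  have "sup_exp_moment 0 = (\<integral>\<omega>. 1 \<partial>M)"
    unfolding sup_exp_moment_def by (intro Bochner_Integration.integral_cong) (auto simp: running_sup_0)
  then show ?thesis by (simp add: prob_space)
qed

lemma sup_exp_moment_ge_1: "0 \<le> t \<Longrightarrow> 1 \<le> sup_exp_moment t"
  using sup_exp_moment_mono[of 0 t] sup_exp_moment_0 by simp

lemma grid_exp_moment_le:
  assumes "0 < h" shows "grid_exp_moment h k \<le> sup_exp_moment (real k * h)"
proof -
  have "grid_exp_moment h k = (\<integral>\<omega>. exp (\<alpha> * grid_max 0 h k \<omega>) \<partial>M)"
    unfolding grid_exp_moment_def using assms by (subst integral_max_law) auto
  also have "\<dots> \<le> sup_exp_moment (real k * h)"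
    unfolding sup_exp_moment_def
  proof (rule integral_mono)
    have le: "grid_max 0 h k \<omega> \<le> running_sup X (real k * h) \<omega>" if "\<omega> \<in> space M" for \<omega>
      unfolding grid_max_def using assms that
      by (auto simp: X_0 intro!: X_le_running_sup mult_right_mono)
    show int: "integrable M (\<lambda>\<omega>. exp (\<alpha> * running_sup X (real k * h) \<omega>))"
      using assms by (intro integrable_exp_running_sup) auto
    show le': "exp (\<alpha> * grid_max 0 h k \<omega>) \<le> exp (\<alpha> * running_sup X (real k * h) \<omega>)" if "\<omega> \<in> space M" for \<omega>
      using le[OF that] alpha_pos by simp
    show "integrable M (\<lambda>\<omega>. exp (\<alpha> * grid_max 0 h k \<omega>))"
      using assms le' by (intro Bochner_Integration.integrable_bound[OF int] AE_I2) auto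
  qed
  finally show ?thesis .
qed

lemma exp_moment_pos: "0 \<le> t \<Longrightarrow> 0 < exp_moment t"
proof -
  assume t: "0 \<le> t"
  have int: "integrable M (\<lambda>\<omega>. exp (\<alpha> * X t \<omega>))"
  proof (rule Bochner_Integration.integrable_bound[OF integrable_exp_running_sup[OF t]])
    show "AE \<omega> in M. norm (exp (\<alpha> * X t \<omega>)) \<le> norm (exp (\<alpha> * running_sup X t \<omega>))"
      using t alpha_pos by (intro AE_I2) (auto intro!: mult_left_mono X_le_running_sup)
  qed (use t in measurable)
  have "0 \<le> exp_moment t" unfolding exp_moment_def by simp
  moreover have "exp_moment t \<noteq> 0"
  proof
    assume "exp_moment t = 0"
    then have "AE \<omega> in M. exp (\<alpha> * X t \<omega>) = 0"
      unfolding exp_moment_def using integral_nonneg_eq_0_iff_AE[OF int] by simp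
    then have "AE \<omega> in M. False" by simp
    then show False by (simp add: AE_False)
  qed
  ultimately show ?thesis by simp
qed

text \<open>Multiplicativity and uniqueness of positive roots settle multiples of 1 / (n + 1); the
  limit from the right is dominated by the exponential of the running supremum over
  [0, t + 1].\<close>

lemma exp_moment_exp:
  assumes t: "0 \<le> t" shows "exp_moment t = exp (levy_psi M X \<alpha> * t)"
proof -
  let ?\<psi> = "levy_psi M X \<alpha>"
  have 1: "exp_moment 1 = exp ?\<psi>"
    using exp_moment_pos[of 1] by (simp add: levy_psi_def exp_moment_def)
  have root: "exp_moment (1 / real (Suc n)) = exp (?\<psi> / real (Suc n))" for n
  proof (rule power_eq_imp_eq_base[of _ "Suc n"])
    have "exp_moment (1 / real (Suc n)) ^ Suc n = exp_moment (real (Suc n) * (1 / real (Suc n)))"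
      by (rule exp_moment_mult[symmetric]) simp
    also have "\<dots> = exp (real (Suc n) * (?\<psi> / real (Suc n)))" using 1 by simp
    finally show "exp_moment (1 / real (Suc n)) ^ Suc n = exp (?\<psi> / real (Suc n)) ^ Suc n"
      by (simp only: exp_of_nat_mult)
    show "0 \<le> exp_moment (1 / real (Suc n))" by (rule less_imp_le, rule exp_moment_pos) simp
  qed auto
  have rat: "exp_moment (rat_above t n) = exp (?\<psi> * rat_above t n)" for n
  proof -
    obtain k where k: "rat_above t n = real k * (1 / real (Suc n))"
      using rat_above_form[OF t] by blast
    have "exp_moment (rat_above t n) = exp_moment (1 / real (Suc n)) ^ k" unfolding k by (rule exp_moment_mult) simp
    also have "\<dots> = exp (real k * (?\<psi> / real (Suc n)))" unfolding root exp_of_nat_mult ..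
    finally show ?thesis unfolding k by (simp add: mult.commute)
  qed
  have nn: "0 \<le> rat_above t n" "rat_above t n \<le> t + 1" for n
    using rat_above[of t n] t by (auto intro: order_trans[OF rat_above(2)])
  have "(\<lambda>n. exp_moment (rat_above t n)) \<longlonglongrightarrow> exp_moment t"
    unfolding exp_moment_def
  proof (rule integral_dominated_convergence[where w="\<lambda>\<omega>. exp (\<alpha> * running_sup X (t + 1) \<omega>)"])
    show "integrable M (\<lambda>\<omega>. exp (\<alpha> * running_sup X (t + 1) \<omega>))"
      using t by (intro integrable_exp_running_sup) simp
    show "AE \<omega> in M. (\<lambda>n. exp (\<alpha> * X (rat_above t n) \<omega>)) \<longlonglongrightarrow> exp (\<alpha> * X t \<omega>)"
      by (intro AE_I2 tendsto_intros X_rat_above t)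
    show "AE \<omega> in M. norm (exp (\<alpha> * X (rat_above t n) \<omega>)) \<le> exp (\<alpha> * running_sup X (t + 1) \<omega>)" for n
      using alpha_pos nn by (intro AE_I2) (auto intro!: mult_left_mono X_le_running_sup)
  qed (use t nn in auto)
  moreover have "(\<lambda>n. exp_moment (rat_above t n)) \<longlonglongrightarrow> exp (?\<psi> * t)"
    unfolding rat by (intro tendsto_intros rat_above_tendsto)
  ultimately show ?thesis by (rule LIMSEQ_unique)
qed

end

section \<open>The ruin probability\<close>

lemma set_integral_le_grid_sum:
  fixes f :: "real \<Rightarrow> real"
  assumes "set_integrable lborel {0..<real n * h} f" "0 \<le> h"
    and "\<And>j t. j < n \<Longrightarrow> real j * h \<le> t \<Longrightarrow> t < real (Suc j) * h \<Longrightarrow> f t \<le> c j"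
  shows "(LINT t:{0..<real n * h}|lborel. f t) \<le> (\<Sum>j<n. h * c j)"
  using assms
proof (induction n)
  case 0
  then show ?case by (simp add: set_lebesgue_integral_def)
next
  case (Suc n)
  let ?A = "{0..<real n * h}" and ?B = "{real n * h..<real (Suc n) * h}"
  have le: "real n * h \<le> real (Suc n) * h" "0 \<le> real n * h"
    using Suc.prems(2) by (auto intro: mult_right_mono)
  then have AB: "{0..<real (Suc n) * h} = ?A \<union> ?B" by auto
  have iA: "set_integrable lborel ?A f"
    by (rule set_integrable_subset[OF Suc.prems(1)]) (use AB in auto)
  have iB: "set_integrable lborel ?B f"
    by (rule set_integrable_subset[OF Suc.prems(1)]) (use AB in auto)
  have "(LINT t:{0..<real (Suc n) * h}|lborel. f t) = (LINT t:?A|lborel. f t) + (LINT t:?B|lborel. f t)"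
    unfolding AB by (rule set_integral_Un[OF _ iA iB]) auto
  also have "(LINT t:?A|lborel. f t) \<le> (\<Sum>j<n. h * c j)"
    using Suc by (intro Suc.IH iA) auto
  also have "(LINT t:?B|lborel. f t) \<le> (LINT t:?B|lborel. c n)"
  proof (rule set_integral_mono[OF iB])
    show "set_integrable lborel ?B (\<lambda>_. c n)"
      unfolding set_integrable_def using le(1)
      by (intro integrable_scaleR_left integrable_real_indicator) (simp_all del: of_nat_Suc)
  qed (use Suc.prems(3)[of n] in auto)
  also have "(LINT t:?B|lborel. c n) = h * c n"
    using Suc.prems(2) by (simp add: set_lebesgue_integral_def algebra_simps)
  finally show ?case by simp
qed

lemma grid_sum_le_set_integral:
  fixes f :: "real \<Rightarrow> real"
  assumes "set_integrable lborel {0..<real n * h} f" "0 \<le> h"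
    and "\<And>j t. j < n \<Longrightarrow> real j * h \<le> t \<Longrightarrow> t < real (Suc j) * h \<Longrightarrow> c j \<le> f t"
  shows "(\<Sum>j<n. h * c j) \<le> (LINT t:{0..<real n * h}|lborel. f t)"
proof -
  have "(LINT t:{0..<real n * h}|lborel. - f t) \<le> (\<Sum>j<n. h * - c j)"
    using assms by (intro set_integral_le_grid_sum) (auto simp: set_integrable_def)
  then show ?thesis
    by (simp add: set_lebesgue_integral_def sum_negf)
qed

lemma (in levy) passage_time_set:
  "{\<omega> \<in> space M. passage_time X z u \<omega> < ereal s} = {\<omega> \<in> space M. \<exists>t\<in>{0<..<s}. u - z < X t \<omega>}"
  by (auto simp: passage_time_def Inf_less_iff) force+

text \<open>Passage before s is a countable union of passages over closed intervals [0, r] with r <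
  s. These include time 0, but right continuity moves a crossing to a slightly later time, so
  nothing is added.\<close>

lemma (in levy) passage_open_measurable:
  assumes s: "0 < s"
  shows "crosses_before v s \<in> events"
proof -
  \<comment> \<open>The 2 keeps every right endpoint positive, as \<open>passage_measurable\<close>
    requires.\<close>
  let ?r = "\<lambda>k. s * (1 - 1 / real (k + 2))"
  have "0 < 1 / real (k + 2)" "1 / real (k + 2) < 1" for k by auto
  then have r: "0 < ?r k" "?r k < s" for k
    using s mult_strict_left_mono[of "1 - 1 / real (k + 2)" 1 s] by (auto intro!: mult_pos_pos)
  have "crosses_before v s = (\<Union>k. crosses v (?r k))"
  proof (intro set_eqI iffI)
    fix \<omega> assume "\<omega> \<in> crosses_before v s"
    then obtain t where t: "\<omega> \<in> space M" "0 < t" "t < s" "v < X t \<omega>" by auto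
    obtain k where k: "s / (s - t) < real k" using reals_Archimedean2 by blast
    then have "s < real k * (s - t)" using t by (simp add: field_simps)
    also have "\<dots> \<le> real (k + 2) * (s - t)" using t by (intro mult_right_mono) auto
    finally have "t \<le> ?r k" by (simp add: field_simps)
    then show "\<omega> \<in> (\<Union>k. crosses v (?r k))" using t by force
  next
    fix \<omega> assume "\<omega> \<in> (\<Union>k. crosses v (?r k))"
    then obtain k t where t: "\<omega> \<in> space M" "0 \<le> t" "t \<le> ?r k" "v < X t \<omega>" by auto
    have "t < s" using t(3) r(2)[of k] by simp
    then obtain b where b: "t < b" "b \<le> s" "\<And>r. t \<le> r \<Longrightarrow> r < b \<Longrightarrow> v < X r \<omega>"
      using X_greater_right[OF t(1,2,4)] by blast
    then have "v < X ((t + b) / 2) \<omega>" "0 < (t + b) / 2" "(t + b) / 2 < s" using t(2) by auto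
    then show "\<omega> \<in> crosses_before v s" using t(1) by force
  qed
  also have "\<dots> \<in> events"
    by (intro sets.countable_UN) (use passage_measurable[OF r(1)] in blast)
  finally show ?thesis .
qed

section \<open>Riemann sums and the limit of the ruin probability\<close>

context levy_tails
begin

abbreviation \<psi> :: real where "\<psi> \<equiv> levy_psi M X \<alpha>"

lemma exp_moment_power: "0 < h \<Longrightarrow> exp_moment h ^ k = exp (\<psi> * (real k * h))"
  unfolding exp_moment_mult[symmetric] by (rule exp_moment_exp) simp

text \<open>The \<open>max 0\<close> extends the function to the whole line, where monotonicity
  gives measurability and countably many discontinuities.\<close>

lemma mono_sup_exp_moment: "mono (\<lambda>s. sup_exp_moment (max 0 s))"
  by (intro monoI sup_exp_moment_mono) auto

lemma sup_exp_moment_measurable [measurable]: "(\<lambda>s. sup_exp_moment (max 0 s)) \<in> borel_measurable borel"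
  by (rule borel_measurable_mono[OF mono_sup_exp_moment])

lemma exp_psi_diff_le: "\<bar>s - t\<bar> \<le> r \<Longrightarrow> exp (\<psi> * s) \<le> exp (\<bar>\<psi>\<bar> * r) * exp (\<psi> * t)"
proof -
  assume "\<bar>s - t\<bar> \<le> r"
  then have "\<bar>\<psi>\<bar> * \<bar>s - t\<bar> \<le> \<bar>\<psi>\<bar> * r" by (rule mult_left_mono) simp
  then have "\<psi> * (s - t) \<le> \<bar>\<psi>\<bar> * r"
    using abs_ge_self[of "\<psi> * (s - t)"] by (simp add: abs_mult)
  then show ?thesis by (simp add: exp_add[symmetric] algebra_simps)
qed

context
  fixes T :: real
  assumes T: "0 < T"
begin

definition limit_integral :: real where "limit_integral = (LINT t:{0..<T}|lborel. exp (\<psi> * t) * sup_exp_moment (T - t))"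

definition integrand_bound :: real where "integrand_bound = exp (\<bar>\<psi>\<bar> * T) * sup_exp_moment T"

lemma integrand_le_bound:
  assumes "0 \<le> t" "t < T" shows "exp (\<psi> * t) * sup_exp_moment (T - t) \<le> integrand_bound"
proof -
  have "exp (\<psi> * t) \<le> exp (\<bar>\<psi>\<bar> * T) * exp (\<psi> * 0)"
    by (rule exp_psi_diff_le) (use assms in auto)
  moreover have "0 \<le> sup_exp_moment (T - t)" using sup_exp_moment_ge_1[of "T - t"] assms by simp
  ultimately show ?thesis
    unfolding integrand_bound_def using assms by (intro mult_mono sup_exp_moment_mono) auto
qed

lemma integrand_bound_nonneg: "0 \<le> integrand_bound"
  using sup_exp_moment_ge_1[of T] T by (simp add: integrand_bound_def)

lemma integrand_integrable: "set_integrable lborel {0..<T} (\<lambda>t. exp (\<psi> * t) * sup_exp_moment (T - t))"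
proof -
  have "set_integrable lborel {0..<T} (\<lambda>t. exp (\<psi> * t) * sup_exp_moment (max 0 (T - t)))"
    unfolding set_integrable_def
  proof (rule integrableI_bounded_set_indicator[where B=integrand_bound])
    show "AE t in lborel. t \<in> {0..<T} \<longrightarrow> norm (exp (\<psi> * t) * sup_exp_moment (max 0 (T - t))) \<le> integrand_bound"
    proof (intro AE_I2 impI)
      fix t assume t: "t \<in> {0..<T}"
      then have "0 \<le> sup_exp_moment (T - t)" using sup_exp_moment_ge_1[of "T - t"] by simp
      then show "norm (exp (\<psi> * t) * sup_exp_moment (max 0 (T - t))) \<le> integrand_bound"
        using integrand_le_bound[of t] t by simp
    qed
  qed (use T in auto)
  then show ?thesis
    by (rule set_integrable_cong[THEN iffD1, rotated -1]) auto
qed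

text \<open>On cell j the remaining time T - t covers the \<open>n - 1 - j\<close> grid steps left,
  so the supremum dominates the grid maximum. The exponential is taken at the right end of the cell;
  moving it to t costs \<open>exp (\<bar>\<psi>\<bar> * h)\<close>.\<close>

lemma upper_sum:
  assumes h: "0 < h" and n: "T = real n * h"
  shows "(\<Sum>j<n. h * l * exp_moment h ^ Suc j * grid_exp_moment h (n - 1 - j)) \<le> l * exp (\<bar>\<psi>\<bar> * h) * limit_integral"
proof -
  have "(\<Sum>j<n. h * l * exp_moment h ^ Suc j * grid_exp_moment h (n - 1 - j)) \<le>
    (\<Sum>j<n. l * exp (\<bar>\<psi>\<bar> * h) * (h * (exp (- (\<bar>\<psi>\<bar> * h)) * (exp (\<psi> * (real (Suc j) * h)) * sup_exp_moment (real (n - 1 - j) * h)))))"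
  proof (rule sum_mono)
    fix j
    have "h * l * exp_moment h ^ Suc j * grid_exp_moment h (n - 1 - j) \<le> h * l * exp (\<psi> * (real (Suc j) * h)) * sup_exp_moment (real (n - 1 - j) * h)"
      unfolding exp_moment_power[OF h] using h l_pos grid_exp_moment_le[OF h, of "n - 1 - j"] by (intro mult_left_mono) auto
    also have "\<dots> = l * exp (\<bar>\<psi>\<bar> * h) * (h * (exp (- (\<bar>\<psi>\<bar> * h)) * (exp (\<psi> * (real (Suc j) * h)) * sup_exp_moment (real (n - 1 - j) * h))))"
      by (simp add: exp_minus field_simps)
    finally show "h * l * exp_moment h ^ Suc j * grid_exp_moment h (n - 1 - j) \<le> l * exp (\<bar>\<psi>\<bar> * h) * (h * (exp (- (\<bar>\<psi>\<bar> * h)) * (exp (\<psi> * (real (Suc j) * h)) * sup_exp_moment (real (n - 1 - j) * h))))" .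
  qed
  also have "\<dots> = l * exp (\<bar>\<psi>\<bar> * h) * (\<Sum>j<n. h * (exp (- (\<bar>\<psi>\<bar> * h)) * (exp (\<psi> * (real (Suc j) * h)) * sup_exp_moment (real (n - 1 - j) * h))))"
    by (rule sum_distrib_left[symmetric])
  also have "(\<Sum>j<n. h * (exp (- (\<bar>\<psi>\<bar> * h)) * (exp (\<psi> * (real (Suc j) * h)) * sup_exp_moment (real (n - 1 - j) * h)))) \<le> limit_integral"
    unfolding limit_integral_def unfolding n
  proof (rule grid_sum_le_set_integral)
    show "set_integrable lborel {0..<real n * h} (\<lambda>t. exp (\<psi> * t) * sup_exp_moment (real n * h - t))"
      using integrand_integrable unfolding n .
    fix j t assume j: "j < n" and t: "real j * h \<le> t" "t < real (Suc j) * h"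
    have "0 \<le> t" using t(1) h by (intro order_trans[OF _ t(1)]) auto
    have "real (n - 1 - j) = real n - real (Suc j)" using j by (simp add: of_nat_diff)
    then have le: "real (n - 1 - j) * h \<le> real n * h - t" using t by (simp add: algebra_simps)
    have "exp (\<psi> * (real (Suc j) * h)) \<le> exp (\<bar>\<psi>\<bar> * h) * exp (\<psi> * t)"
      by (rule exp_psi_diff_le) (use t in \<open>auto simp: algebra_simps\<close>)
    then have "exp (- (\<bar>\<psi>\<bar> * h)) * exp (\<psi> * (real (Suc j) * h)) \<le> exp (\<psi> * t)"
      by (simp add: exp_minus field_simps)
    moreover have "sup_exp_moment (real (n - 1 - j) * h) \<le> sup_exp_moment (real n * h - t)"
      using h by (intro sup_exp_moment_mono le) auto
    moreover have "0 \<le> sup_exp_moment (real (n - 1 - j) * h)" using h sup_exp_moment_ge_1[of "real (n - 1 - j) * h"] by simp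
    ultimately have "exp (- (\<bar>\<psi>\<bar> * h)) * exp (\<psi> * (real (Suc j) * h)) * sup_exp_moment (real (n - 1 - j) * h) \<le> exp (\<psi> * t) * sup_exp_moment (real n * h - t)"
      by (intro mult_mono) auto
    then show "exp (- (\<bar>\<psi>\<bar> * h)) * (exp (\<psi> * (real (Suc j) * h)) * sup_exp_moment (real (n - 1 - j) * h)) \<le> exp (\<psi> * t) * sup_exp_moment (real n * h - t)"
      by (simp add: mult.assoc)
  qed (use h in auto)
  finally show ?thesis using l_pos by (simp add: mult_left_mono)
qed

text \<open>The grid has n + 1 steps although T is n + 2 steps long, so that it stays strictly
  before T. Term j is matched with cell j + 2: one shift is the missing last step, the other ensures
  that \<open>n - j\<close> steps cover T - t on the whole cell. The two unmatched cells are bounded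
  crudely by \<open>integrand_bound\<close>, whence \<open>2 * \<eta>\<close>.\<close>

lemma lower_sum:
  assumes h: "0 < h" "h \<le> \<eta>" and n: "T = real (Suc (Suc n)) * h" and \<eta>: "0 < \<eta>" "\<eta> < 1"
    and small: "\<And>s. 0 \<le> s \<Longrightarrow> s \<le> h \<Longrightarrow> 1 - \<eta> \<le> prob (stays_above \<eta> s)"
  shows "limit_integral \<le> 2 * \<eta> * integrand_bound + exp (\<bar>\<psi>\<bar> * (2 * \<eta>)) * exp (\<alpha> * \<eta>) / (1 - \<eta>) *
    ((\<Sum>j<Suc n. h * l * exp_moment h ^ Suc j * grid_exp_moment h (Suc n - 1 - j)) / l)"
proof -
  let ?N = "Suc (Suc n)"
  let ?C = "exp (\<bar>\<psi>\<bar> * (2 * \<eta>)) * exp (\<alpha> * \<eta>) / (1 - \<eta>)"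
  let ?b = "\<lambda>j. exp_moment h ^ Suc j * grid_exp_moment h (n - j)"
  have C: "0 \<le> ?C" using \<eta> by simp
  have e_nonneg: "0 \<le> grid_exp_moment h k" for k unfolding grid_exp_moment_def by simp
  have q_nonneg: "0 \<le> exp_moment h" unfolding exp_moment_def by simp
  define c where "c i = (if i < 2 then integrand_bound else ?C * ?b (i - 2))" for i
  have "limit_integral \<le> (\<Sum>i<?N. h * c i)"
    unfolding limit_integral_def unfolding n
  proof (rule set_integral_le_grid_sum)
    show "set_integrable lborel {0..<real ?N * h} (\<lambda>t. exp (\<psi> * t) * sup_exp_moment (real ?N * h - t))"
      using integrand_integrable unfolding n .
    fix i t assume i: "i < ?N" and t: "real i * h \<le> t" "t < real (Suc i) * h"
    have t0: "0 \<le> t" using h by (intro order_trans[OF _ t(1)]) auto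
    have "real (Suc i) * h \<le> T" unfolding n using i h by (intro mult_right_mono) auto
    then have tT: "t < T" using t by simp
    show "exp (\<psi> * t) * sup_exp_moment (real ?N * h - t) \<le> c i"
    proof (cases "i < 2")
      case True
      then show ?thesis using integrand_le_bound[OF t0 tT] by (simp add: c_def n)
    next
      case False
      define j where "j = i - 2"
      have ij: "i = j + 2" "j < n" using False i by (auto simp: j_def)
      have nj: "real (n - j) = real n - real j" "0 < n - j" using ij by (auto simp: of_nat_diff)
      have "sup_exp_moment (T - t) \<le> sup_exp_moment (real (n - j) * h)"
        using t tT by (intro sup_exp_moment_mono) (auto simp: n nj ij algebra_simps)
      also have "\<dots> \<le> exp (\<alpha> * \<eta>) / (1 - \<eta>) * grid_exp_moment h (n - j)"
        using exp_running_sup_bound(2)[OF h(1) nj(2) \<eta>(2) small] \<eta> by (simp add: field_simps)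
      finally have 1: "sup_exp_moment (T - t) \<le> exp (\<alpha> * \<eta>) / (1 - \<eta>) * grid_exp_moment h (n - j)" .
      \<comment> \<open>On cell j + 2 the time t is within two steps of (j + 1) h, and
        \<open>h \<le> \<eta>\<close>.\<close>
      have "exp (\<psi> * t) \<le> exp (\<bar>\<psi>\<bar> * (2 * \<eta>)) * exp (\<psi> * (real (Suc j) * h))"
        by (rule exp_psi_diff_le) (use t h ij in \<open>auto simp: algebra_simps\<close>)
      also have "exp (\<psi> * (real (Suc j) * h)) = exp_moment h ^ Suc j"
        by (rule exp_moment_power[OF h(1), symmetric])
      finally have 2: "exp (\<psi> * t) \<le> exp (\<bar>\<psi>\<bar> * (2 * \<eta>)) * exp_moment h ^ Suc j" .
      have "0 \<le> sup_exp_moment (T - t)" using sup_exp_moment_ge_1[of "T - t"] tT by simp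
      then have "exp (\<psi> * t) * sup_exp_moment (T - t) \<le> (exp (\<bar>\<psi>\<bar> * (2 * \<eta>)) * exp_moment h ^ Suc j) * (exp (\<alpha> * \<eta>) / (1 - \<eta>) * grid_exp_moment h (n - j))"
        using q_nonneg by (intro mult_mono 1 2) auto
      also have "\<dots> = c i" using False by (simp add: c_def j_def)
      finally show ?thesis by (simp add: n)
    qed
  qed (use h in auto)
  also have "\<dots> = 2 * h * integrand_bound + ?C * (\<Sum>j<n. h * ?b j)"
  proof -
    have "(\<Sum>i<?N. h * c i) = h * c 0 + (h * c 1 + (\<Sum>j<n. h * c (Suc (Suc j))))"
      unfolding sum.lessThan_Suc_shift by simp
    also have "(\<Sum>j<n. h * c (Suc (Suc j))) = ?C * (\<Sum>j<n. h * ?b j)"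
      unfolding sum_distrib_left by (intro sum.cong refl) (simp add: c_def)
    finally show ?thesis by (simp add: c_def)
  qed
  also have "\<dots> \<le> 2 * \<eta> * integrand_bound + ?C * (\<Sum>j<Suc n. h * ?b j)"
  proof (intro add_mono mult_left_mono C)
    show "2 * h * integrand_bound \<le> 2 * \<eta> * integrand_bound" using h integrand_bound_nonneg by (intro mult_right_mono) auto
    show "(\<Sum>j<n. h * ?b j) \<le> (\<Sum>j<Suc n. h * ?b j)"
      using h q_nonneg e_nonneg by simp
  qed
  also have "(\<Sum>j<Suc n. h * ?b j) = (\<Sum>j<Suc n. h * l * exp_moment h ^ Suc j * grid_exp_moment h (Suc n - 1 - j)) / l"
    unfolding sum_divide_distrib using l_pos by (intro sum.cong) auto
  finally show ?thesis .
qed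

text \<open>For each bound \<eta> is fixed first, then a mesh admissible for \<eta>, and only then u
  tends to infinity. Below, a large grid maximum forces passage before T; above, the maximal
  inequality costs \<open>exp (\<alpha> * \<eta>) / (1 - \<eta>)\<close>, which tends to 1 with
  \<eta>.\<close>

lemma ruin_probability_limit:
  "((\<lambda>u. prob (crosses_before u T) / tail F u) \<longlongrightarrow> l * limit_integral) at_top"
proof (rule order_tendstoI)
  fix a assume a: "a < l * limit_integral"
  let ?C = "\<lambda>\<eta>. exp (\<bar>\<psi>\<bar> * (2 * \<eta>)) * exp (\<alpha> * \<eta>) / (1 - \<eta>)"
  \<comment> \<open>The estimate of \<open>lower_sum\<close> solved for the grid sum; at \<eta> = 0
    it reads \<open>l * limit_integral\<close>.\<close>
  have "((\<lambda>\<eta>. l * (limit_integral - 2 * \<eta> * integrand_bound) / ?C \<eta>) \<longlongrightarrow> l * (limit_integral - 2 * 0 * integrand_bound) / (exp (\<bar>\<psi>\<bar> * (2 * 0)) * exp (\<alpha> * 0) / (1 - 0))) (at_right 0)"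
    by (intro tendsto_intros) auto
  then have "\<forall>\<^sub>F \<eta> in at_right 0. a < l * (limit_integral - 2 * \<eta> * integrand_bound) / ?C \<eta>"
    using a by (intro order_tendstoD) auto
  then have "\<forall>\<^sub>F \<eta> in at_right 0. 0 < \<eta> \<and> \<eta> < 1 \<and> a < l * (limit_integral - 2 * \<eta> * integrand_bound) / ?C \<eta>"
    using eventually_at_right_real[of 0 "1::real"] by (auto elim: eventually_elim2)
  then obtain \<eta> where \<eta>: "0 < \<eta>" "\<eta> < 1" and a\<eta>: "a < l * (limit_integral - 2 * \<eta> * integrand_bound) / ?C \<eta>"
    using eventually_happens'[OF trivial_limit_at_right_real] by blast
  obtain h0 where h0: "0 < h0" "\<And>s. 0 \<le> s \<Longrightarrow> s \<le> h0 \<Longrightarrow> 1 - \<eta> \<le> prob (stays_above \<eta> s)"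
    using small_time[OF \<eta>(1) \<eta>(1)] by blast
  obtain n where n: "T / min h0 \<eta> < real n" using reals_Archimedean2 by blast
  define h where "h = T / real (Suc (Suc n))"
  have Tn: "T = real (Suc (Suc n)) * h" by (simp add: h_def)
  have h: "0 < h" using T by (simp add: h_def)
  define m where "m = min h0 \<eta>"
  have m: "0 < m" "m \<le> h0" "m \<le> \<eta>" using h0(1) \<eta> by (auto simp: m_def)
  have "T < real n * m" using n m(1) by (simp add: m_def[symmetric] divide_less_eq)
  also have "\<dots> \<le> real (Suc (Suc n)) * m" using m(1) by (intro mult_right_mono) auto
  finally have "h < m" unfolding h_def by (subst pos_divide_less_eq) (simp_all add: mult.commute)
  then have hh: "h \<le> h0" "h \<le> \<eta>" using m by auto
  let ?S = "\<Sum>j<Suc n. h * l * exp_moment h ^ Suc j * grid_exp_moment h (Suc n - 1 - j)"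
  have low: "limit_integral \<le> 2 * \<eta> * integrand_bound + ?C \<eta> * (?S / l)"
    by (rule lower_sum[OF h hh(2) Tn \<eta> h0(2)]) (use hh in auto)
  have solve: "l * (i - p) / c \<le> s" if "i \<le> p + c * (s / l)" "0 < c" for i p c s :: real
  proof -
    have "l * (i - p) \<le> l * (c * (s / l))" using that l_pos by (intro mult_left_mono) auto
    also have "\<dots> = s * c" using l_pos by simp
    finally show ?thesis using that(2) by (simp add: pos_divide_le_eq)
  qed
  have "l * (limit_integral - 2 * \<eta> * integrand_bound) / ?C \<eta> \<le> ?S"
    by (rule solve[OF low]) (use \<eta> in simp)
  with a\<eta> have "a < ?S" by simp
  from order_tendstoD(1)[OF tail_max_law_limit[OF h, of "Suc n"] this]
  show "\<forall>\<^sub>F u in at_top. a < prob (crosses_before u T) / tail F u"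
    using eventually_ge_at_top[of 0]
  proof eventually_elim
    case (elim u)
    have "tail (max_law h (Suc n)) u \<le> prob (crosses_before u T)"
      unfolding tail_max_law[OF less_imp_le[OF h]]
    proof (rule finite_measure_mono[OF _ passage_open_measurable[OF T]], safe)
      fix \<omega> i assume *: "\<omega> \<in> space M" "i \<le> Suc n" "u < X (real i * h) \<omega>"
      \<comment> \<open>For \<open>u \<ge> 0\<close> the starting value 0 is not above u, so the
        crossing happens at a positive time.\<close>
      have "i \<noteq> 0" using * elim(2) X_0[OF *(1)] by (intro notI) auto
      moreover have "real i * h < T" unfolding Tn using *(2) h by (intro mult_strict_right_mono) auto
      ultimately show "\<exists>t\<in>{0<..<T}. u < X t \<omega>" using h * by (intro bexI[of _ "real i * h"]) auto
    qed
    then have "tail (max_law h (Suc n)) u / tail F u \<le> prob (crosses_before u T) / tail F u"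
      by (rule divide_right_mono) simp
    then show ?case using elim(1) by simp
  qed
next
  fix b assume b: "l * limit_integral < b"
  have "((\<lambda>\<eta>. l * exp (\<bar>\<psi>\<bar> * \<eta>) * limit_integral * exp (\<alpha> * \<eta>) / (1 - \<eta>)) \<longlongrightarrow> l * exp (\<bar>\<psi>\<bar> * 0) * limit_integral * exp (\<alpha> * 0) / (1 - 0)) (at_right 0)"
    by (intro tendsto_intros) auto
  then have "\<forall>\<^sub>F \<eta> in at_right 0. l * exp (\<bar>\<psi>\<bar> * \<eta>) * limit_integral * exp (\<alpha> * \<eta>) / (1 - \<eta>) < b"
    using b by (intro order_tendstoD) auto
  then have "\<forall>\<^sub>F \<eta> in at_right 0. 0 < \<eta> \<and> \<eta> < 1 \<and> l * exp (\<bar>\<psi>\<bar> * \<eta>) * limit_integral * exp (\<alpha> * \<eta>) / (1 - \<eta>) < b"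
    using eventually_at_right_real[of 0 "1::real"] by (auto elim: eventually_elim2)
  then obtain \<eta> where \<eta>: "0 < \<eta>" "\<eta> < 1" and b\<eta>: "l * exp (\<bar>\<psi>\<bar> * \<eta>) * limit_integral * exp (\<alpha> * \<eta>) / (1 - \<eta>) < b"
    using eventually_happens'[OF trivial_limit_at_right_real] by blast
  obtain h0 where h0: "0 < h0" "\<And>s. 0 \<le> s \<Longrightarrow> s \<le> h0 \<Longrightarrow> 1 - \<eta> \<le> prob (stays_above \<eta> s)"
    using small_time[OF \<eta>(1) \<eta>(1)] by blast
  obtain n where n: "T / min h0 \<eta> < real n" using reals_Archimedean2 by blast
  define h where "h = T / real (Suc n)"
  have Tn: "T = real (Suc n) * h" by (simp add: h_def)
  have h: "0 < h" using T by (simp add: h_def)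
  define m where "m = min h0 \<eta>"
  have m: "0 < m" "m \<le> h0" "m \<le> \<eta>" using h0(1) \<eta> by (auto simp: m_def)
  have "T < real n * m" using n m(1) by (simp add: m_def[symmetric] divide_less_eq)
  also have "\<dots> \<le> real (Suc n) * m" using m(1) by (intro mult_right_mono) auto
  finally have "h < m" unfolding h_def by (subst pos_divide_less_eq) (simp_all add: mult.commute)
  then have hh: "h \<le> h0" "h \<le> \<eta>" using m by auto
  let ?S = "\<Sum>j<Suc n. h * l * exp_moment h ^ Suc j * grid_exp_moment h (Suc n - 1 - j)"
  have limit_integral_nonneg: "0 \<le> limit_integral"
    unfolding limit_integral_def set_lebesgue_integral_def
  proof (rule Bochner_Integration.integral_nonneg)
    show "0 \<le> indicat_real {0..<T} t *\<^sub>R (exp (\<psi> * t) * sup_exp_moment (T - t))" for t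
      using sup_exp_moment_ge_1[of "T - t"] by (auto simp: indicator_def)
  qed
  have "?S \<le> l * exp (\<bar>\<psi>\<bar> * h) * limit_integral" by (rule upper_sum[OF h Tn])
  also have "\<dots> \<le> l * exp (\<bar>\<psi>\<bar> * \<eta>) * limit_integral"
    using hh l_pos limit_integral_nonneg by (intro mult_right_mono mult_left_mono) (auto intro!: mult_left_mono)
  finally have "?S * exp (\<alpha> * \<eta>) / (1 - \<eta>) \<le> l * exp (\<bar>\<psi>\<bar> * \<eta>) * limit_integral * exp (\<alpha> * \<eta>) / (1 - \<eta>)"
    using \<eta> by (intro divide_right_mono mult_right_mono) auto
  with b\<eta> have "?S * exp (\<alpha> * \<eta>) / (1 - \<eta>) < b" by simp
  moreover have "((\<lambda>u. tail (max_law h (Suc n)) (u - \<eta>) / tail F u / (1 - \<eta>)) \<longlongrightarrow> ?S * exp (\<alpha> * \<eta>) / (1 - \<eta>)) at_top"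
    using \<eta> by (intro tendsto_divide tendsto_const E.tail_shift tail_max_law_limit h) auto
  ultimately have "\<forall>\<^sub>F u in at_top. tail (max_law h (Suc n)) (u - \<eta>) / tail F u / (1 - \<eta>) < b"
    by (intro order_tendstoD(2))
  then show "\<forall>\<^sub>F u in at_top. prob (crosses_before u T) / tail F u < b"
  proof eventually_elim
    case (elim u)
    have "prob (crosses_before u T) \<le> prob (crosses u T)"
      by (rule finite_measure_mono[OF _ passage_measurable[OF T]]) force
    also have "\<dots> \<le> tail (max_law h (Suc n)) (u - \<eta>) / (1 - \<eta>)"
    proof -
      have "prob (crosses u T) * (1 - \<eta>) \<le> tail (max_law h (Suc n)) (u - \<eta>)"
        unfolding Tn by (rule maximal_inequality[OF h _ h0(2)]) (use hh in auto)
      then show ?thesis using \<eta> by (simp only: pos_le_divide_eq diff_gt_0_iff_gt)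
    qed
    finally have "prob (crosses_before u T) / tail F u \<le> tail (max_law h (Suc n)) (u - \<eta>) / (1 - \<eta>) / tail F u"
      by (rule divide_right_mono) simp
    also have "tail (max_law h (Suc n)) (u - \<eta>) / (1 - \<eta>) / tail F u = tail (max_law h (Suc n)) (u - \<eta>) / tail F u / (1 - \<eta>)"
      unfolding divide_divide_eq_left by (simp only: mult.commute)
    finally show ?case using elim by (rule order.strict_trans1)
  qed
qed

end

section \<open>The function \<open>levy_nu\<close> and the two forms of the integral\<close>

lemma exp_tail_integral:
  assumes "0 \<le> T"
  shows "integrable lborel (\<lambda>u. \<alpha> * exp (\<alpha> * u) * tail (distr M borel (running_sup X T)) u)"
    and "(\<integral>u. \<alpha> * exp (\<alpha> * u) * tail (distr M borel (running_sup X T)) u \<partial>lborel) = sup_exp_moment T"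
proof -
  let ?D = "distr M borel (running_sup X T)"
  note D = real_distribution_running_sup[OF assms]
  interpret D: real_distribution ?D by (rule D)
  have "(\<integral>\<^sup>+u. ennreal (\<alpha> * exp (\<alpha> * u) * tail ?D u) \<partial>lborel) = (\<integral>\<^sup>+x. exp (\<alpha> * x) \<partial>?D)"
    unfolding nn_integral_exp_tail[OF D alpha_pos] using alpha_pos
    by (intro nn_integral_cong) (simp add: ennreal_mult)
  also have "\<dots> = (\<integral>\<^sup>+\<omega>. exp (\<alpha> * running_sup X T \<omega>) \<partial>M)"
    using assms by (subst nn_integral_distr) auto
  also have "\<dots> = ennreal (sup_exp_moment T)"
    unfolding sup_exp_moment_def by (subst nn_integral_eq_integral[OF integrable_exp_running_sup[OF assms]]) auto
  finally have *: "(\<integral>\<^sup>+u. ennreal (\<alpha> * exp (\<alpha> * u) * tail ?D u) \<partial>lborel) = ennreal (sup_exp_moment T)" .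
  show "integrable lborel (\<lambda>u. \<alpha> * exp (\<alpha> * u) * tail ?D u)"
    by (rule integrableI_nonneg) (use alpha_pos * in auto)
  show "(\<integral>u. \<alpha> * exp (\<alpha> * u) * tail ?D u \<partial>lborel) = sup_exp_moment T"
    by (subst integral_eq_nn_integral) (use alpha_pos * sup_exp_moment_ge_1[OF assms] in auto)
qed

text \<open>Substituting u = - z makes \<open>levy_nu\<close> a layer cake integral for passage over
  u in the open time interval (0, s). This event lies between passage over u in [0, r] with r < s
  and passage over u in [0, s].\<close>

lemma nu_bounds:
  assumes s: "0 < s"
  shows "levy_nu M X \<alpha> s \<le> sup_exp_moment s" and "0 \<le> r \<Longrightarrow> r < s \<Longrightarrow> sup_exp_moment r \<le> levy_nu M X \<alpha> s"
proof -
  let ?A = "\<lambda>u. prob (crosses_before u s)"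
  have le: "?A u \<le> tail (distr M borel (running_sup X s)) u" for u
    unfolding tail_running_sup[OF less_imp_le[OF s]]
    by (rule finite_measure_mono[OF _ passage_measurable[OF s]]) force
  have ge: "tail (distr M borel (running_sup X r)) u \<le> ?A u" if r: "0 \<le> r" "r < s" for r u
    unfolding tail_running_sup[OF r(1)]
  proof (rule finite_measure_mono[OF _ passage_open_measurable[OF s]], safe)
    fix \<omega> t assume t: "\<omega> \<in> space M" "t \<in> {0..r}" "u < X t \<omega>"
    then have "t < s" "0 \<le> t" using r by auto
    \<comment> \<open>Right continuity replaces a crossing at t, possibly at t = 0, by one inside
      (0, s).\<close>
    then obtain b where b: "t < b" "b \<le> s" "\<And>r. t \<le> r \<Longrightarrow> r < b \<Longrightarrow> u < X r \<omega>"
      using X_greater_right[OF t(1) _ t(3)] by blast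
    then show "\<exists>t\<in>{0<..<s}. u < X t \<omega>" using \<open>0 \<le> t\<close>
      by (intro bexI[of _ "(t + b) / 2"]) auto
  qed
  have "mono (\<lambda>u. - ?A u)"
  proof (rule monoI, simp, rule finite_measure_mono[OF _ passage_open_measurable[OF s]], safe)
    fix x y \<omega> t assume "x \<le> y" "t \<in> {0<..<s}" "y < X t \<omega>"
    then show "\<exists>t\<in>{0<..<s}. x < X t \<omega>" by (intro bexI[of _ t]) auto
  qed
  from borel_measurable_mono[OF this] have [measurable]: "?A \<in> borel_measurable borel" by simp
  have nu: "levy_nu M X \<alpha> s = (\<integral>u. \<alpha> * exp (\<alpha> * u) * ?A u \<partial>lborel)"
  proof -
    have "levy_nu M X \<alpha> s = (\<integral>z. \<alpha> * exp (- \<alpha> * z) * ?A (0 - z) \<partial>lborel)"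
      unfolding levy_nu_def passage_time_set ..
    also have "\<dots> = (\<integral>u. \<alpha> * exp (- \<alpha> * (0 + (-1) * u)) * ?A (0 - (0 + (-1) * u)) \<partial>lborel)"
      by (subst lborel_integral_real_affine[where c="-1" and t=0]) auto
    finally show ?thesis by simp
  qed
  have le': "\<alpha> * exp (\<alpha> * u) * ?A u \<le> \<alpha> * exp (\<alpha> * u) * tail (distr M borel (running_sup X s)) u" for u
    using alpha_pos by (intro mult_left_mono le) auto
  have int: "integrable lborel (\<lambda>u. \<alpha> * exp (\<alpha> * u) * ?A u)"
  proof (rule Bochner_Integration.integrable_bound[OF exp_tail_integral(1)[OF less_imp_le[OF s]]])
    show "AE u in lborel. norm (\<alpha> * exp (\<alpha> * u) * ?A u) \<le> norm (\<alpha> * exp (\<alpha> * u) * tail (distr M borel (running_sup X s)) u)"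
      using alpha_pos le' by (intro AE_I2) simp
  qed measurable
  show "levy_nu M X \<alpha> s \<le> sup_exp_moment s"
    unfolding nu exp_tail_integral(2)[OF less_imp_le[OF s], symmetric]
    by (intro integral_mono int exp_tail_integral less_imp_le[OF s] le')
  show "sup_exp_moment r \<le> levy_nu M X \<alpha> s" if r: "0 \<le> r" "r < s"
    unfolding nu exp_tail_integral(2)[OF r(1), symmetric]
    using alpha_pos by (intro integral_mono int exp_tail_integral r mult_left_mono ge) auto
qed

text \<open>A monotone function has countably many discontinuities. Where
  \<open>sup_exp_moment\<close> is continuous, its left limit and the two bounds of
  \<open>nu_bounds\<close> squeeze \<open>levy_nu\<close> onto it.\<close>

lemma AE_nu_eq_sup_exp_moment: "AE t in lborel. t < T \<longrightarrow> levy_nu M X \<alpha> (T - t) = sup_exp_moment (T - t)"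
proof -
  let ?G = "\<lambda>s. sup_exp_moment (max 0 s)"
  have "countable {s. \<not> isCont ?G s}" by (rule mono_ctble_discont[OF mono_sup_exp_moment])
  then have "countable ((\<lambda>s. T - s) ` {s. \<not> isCont ?G s})" by (rule countable_image)
  then have "AE t in lborel. t \<notin> (\<lambda>s. T - s) ` {s. \<not> isCont ?G s}"
    by (intro AE_not_in countable_imp_null_set_lborel)
  then show ?thesis
  proof eventually_elim
    case (elim t)
    have cont: "isCont ?G (T - t)"
    proof (rule ccontr)
      assume "\<not> isCont ?G (T - t)"
      then have "T - (T - t) \<in> (\<lambda>s. T - s) ` {s. \<not> isCont ?G s}" by blast
      then show False using elim by simp
    qed
    show ?case
    proof
      assume "t < T"
      then have s: "0 < T - t" by simp
      have "(?G \<longlongrightarrow> ?G (T - t)) (at_left (T - t))"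
        using cont unfolding isCont_def by (rule filterlim_mono) (auto simp: at_le)
      moreover have "\<forall>\<^sub>F r in at_left (T - t). ?G r \<le> levy_nu M X \<alpha> (T - t)"
        using eventually_at_left_real[OF s] by eventually_elim (auto intro!: nu_bounds(2) s)
      ultimately have "?G (T - t) \<le> levy_nu M X \<alpha> (T - t)"
        by (rule tendsto_upperbound) simp
      then show "levy_nu M X \<alpha> (T - t) = sup_exp_moment (T - t)"
        using nu_bounds(1)[OF s] s by simp
    qed
  qed
qed

text \<open>Measurable because monotone: \<open>levy_nu\<close> at x is at most
  \<open>sup_exp_moment x\<close>, which is at most \<open>levy_nu\<close> at any larger y. These
  bounds concern positive arguments, hence the value 0 elsewhere.\<close>

lemma nu_measurable: "(\<lambda>s. if s \<le> 0 then 0 else levy_nu M X \<alpha> s) \<in> borel_measurable borel"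
proof (rule borel_measurable_mono, rule monoI)
  fix x y :: real assume xy: "x \<le> y"
  have nonneg: "0 \<le> levy_nu M X \<alpha> s" if "0 < s" for s
    using nu_bounds(2)[OF that, of 0] sup_exp_moment_0 that by simp
  have "levy_nu M X \<alpha> x \<le> levy_nu M X \<alpha> y" if "0 < x" "x < y"
    using nu_bounds(1)[OF that(1)] nu_bounds(2)[of y x] that by simp
  then show "(if x \<le> 0 then 0 else levy_nu M X \<alpha> x) \<le> (if y \<le> 0 then 0 else levy_nu M X \<alpha> y)"
    using xy nonneg[of y] by (cases "x = y") auto
qed

lemma nu_integral_eq:
  "(LINT t:{0..<T}|lborel. levy_nu M X \<alpha> (T - t) * exp_moment t) = (LINT t:{0..<T}|lborel. exp (\<psi> * t) * sup_exp_moment (T - t))"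
proof -
  let ?N = "\<lambda>s. if s \<le> 0 then 0 else levy_nu M X \<alpha> s"
  note [measurable] = nu_measurable
  have "(LINT t:{0..<T}|lborel. levy_nu M X \<alpha> (T - t) * exp_moment t) = (LINT t:{0..<T}|lborel. ?N (T - t) * exp (\<psi> * t))"
    by (rule set_lebesgue_integral_cong) (auto simp: exp_moment_exp)
  also have "\<dots> = (LINT t:{0..<T}|lborel. exp (\<psi> * t) * sup_exp_moment (max 0 (T - t)))"
    unfolding set_lebesgue_integral_def
  proof (rule integral_cong_AE)
    show "AE t in lborel. indicat_real {0..<T} t *\<^sub>R (?N (T - t) * exp (\<psi> * t)) = indicat_real {0..<T} t *\<^sub>R (exp (\<psi> * t) * sup_exp_moment (max 0 (T - t)))"
      using AE_nu_eq_sup_exp_moment[of T] by eventually_elim (auto simp: indicator_def)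
  qed measurable
  also have "\<dots> = (LINT t:{0..<T}|lborel. exp (\<psi> * t) * sup_exp_moment (T - t))"
    by (rule set_lebesgue_integral_cong) auto
  finally show ?thesis .
qed

end

theorem theorem4p1:
  fixes M :: "'a measure" and X :: "real \<Rightarrow> 'a \<Rightarrow> real" and LM :: "real measure"
    and \<alpha> T :: real
  assumes "levy_process M X"
    and "levy_measure M X LM"
    and "\<alpha> > 0"
    and "tail_in_S_alpha \<alpha> (levy_tail_plus LM)"
    and "0 < T"
  shows "((\<lambda>u. measure M {\<omega> \<in> space M. passage_time X 0 u \<omega> < ereal T}
                 / levy_tail_plus LM u)
           \<longlongrightarrow> (LINT t:{0..<T}|lborel. levy_nu M X \<alpha> (T - t) * (\<integral>\<omega>. exp (\<alpha> * X t \<omega>) \<partial>M)))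
           at_top
       \<and> (LINT t:{0..<T}|lborel. levy_nu M X \<alpha> (T - t) * (\<integral>\<omega>. exp (\<alpha> * X t \<omega>) \<partial>M))
         = (LINT t:{0..<T}|lborel. exp (levy_psi M X \<alpha> * t)
               * (\<integral>\<omega>. exp (\<alpha> * running_sup X (T - t) \<omega>) \<partial>M))"
proof -
  obtain F c l where CE: "conv_equiv F \<alpha> c" and l: "0 < l"
    and ev: "\<forall>\<^sub>F u in at_top. levy_tail_plus LM u = l * tail F u"
    and int: "\<And>t. 0 < t \<Longrightarrow> integrable (distr M borel (X t)) (\<lambda>x. exp (\<alpha> * x))"
    and lim: "\<And>t. 0 < t \<Longrightarrow> ((\<lambda>u. tail (distr M borel (X t)) u / tail F u) \<longlongrightarrow>
      t * l * (\<integral>x. exp (\<alpha> * x) \<partial>distr M borel (X t))) at_top"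
    using levy_marginal_tails[OF assms(1-4)] by blast
  have "prob_space M" using assms(1) by (simp add: levy_process_def)
  then have L: "levy M X" using assms(1) by (simp add: levy_def levy_axioms_def)
  interpret levy_tails M X F \<alpha> c l
    using L CE l int lim by (simp add: levy_tails_def levy_tails_axioms_def)
  \<comment> \<open>Dividing by l passes from the tail of F to that of the Levy measure, which
    eventually equals l times the former; l cancels in the limit.\<close>
  have "((\<lambda>u. prob {\<omega> \<in> space M. \<exists>t\<in>{0<..<T}. u < X t \<omega>} / tail F u / l) \<longlongrightarrow> l * limit_integral T / l) at_top"
    using l by (intro tendsto_divide tendsto_const ruin_probability_limit assms(5)) simp
  moreover have "\<forall>\<^sub>F u in at_top. prob {\<omega> \<in> space M. \<exists>t\<in>{0<..<T}. u < X t \<omega>} / tail F u / l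
    = measure M {\<omega> \<in> space M. passage_time X 0 u \<omega> < ereal T} / levy_tail_plus LM u"
    using ev by eventually_elim (simp add: passage_time_set mult.commute)
  ultimately have "((\<lambda>u. measure M {\<omega> \<in> space M. passage_time X 0 u \<omega> < ereal T} / levy_tail_plus LM u) \<longlongrightarrow> l * limit_integral T / l) at_top"
    by (rule Lim_transform_eventually)
  moreover have "l * limit_integral T / l = (LINT t:{0..<T}|lborel. exp (levy_psi M X \<alpha> * t) * sup_exp_moment (T - t))"
    using l by (simp add: limit_integral_def[OF assms(5)])
  ultimately show ?thesis
    using nu_integral_eq[of T] by (simp add: exp_moment_def sup_exp_moment_def)
qed

end
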